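(* Let $p$ and $q$ be different Dini-smooth boundary points of a domain $D\subset\mathbb{C}$. Then the function $$2c_D(z,w)+\log d_D(z)+\log d_D(w)$$ is bounded for $z$ near $q$ and $w$ near $p$; that is, there exist neighborhoods $V_q$ of $q$ and $V_p$ of $p$ such that this function is bounded on $(D\cap V_q)\times(D\cap V_p)$.
   Context: $\mathbb{D}$ is the open unit disc in $\mathbb{C}$; $\mathcal{O}(X,Y)$ is the set of holomorphic maps $X\to Y$; $d_D(w)=\mathrm{dist}(w,\partial D)$ is the Euclidean distance to the boundary. A boundary point $p$ of a planar domain $D$ is Dini-smooth if $\partial D$ near $p$ is a Dini-smooth curve $\gamma:[0,1]\to\mathbb{C}$, i.e. a (regular) $C^1$ curve such that $\int_0^1\frac{\omega(t)}{t}\,dt<\infty$, where $\omega$ is the modulus of continuity of $\gamma'$. The Carathéodory distance is $c_D(z,w)=\sup\{\tanh^{-1}|f(w)|: f\in\mathcal{O}(D,\mathbb{D}),\ f(z)=0\}$. *)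

theory Defs
  imports "HOL-Complex_Analysis.Complex_Analysis"
begin

definition modulus_of_continuity_01 :: "(real \<Rightarrow> complex) \<Rightarrow> real \<Rightarrow> real" where
  "modulus_of_continuity_01 g t =
     (SUP (s, u) \<in> {(s, u). s \<in> {0..1} \<and> u \<in> {0..1} \<and> \<bar>s - u\<bar> \<le> t}. dist (g s) (g u))"

text \<open>Derivatives are taken within \<open>{0..1}\<close>, hence one-sided at the end points. The supremum
  defining the modulus of continuity of \<open>g\<close> is finite because \<open>g\<close> is continuous on
  \<open>{0..1}\<close>.\<close>

definition dini_smooth_curve :: "(real \<Rightarrow> complex) \<Rightarrow> bool" where
  "dini_smooth_curve \<gamma> \<longleftrightarrow>
     (\<exists>g. (\<forall>t\<in>{0..1}. (\<gamma> has_vector_derivative g t) (at t within {0..1})) \<and>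
          continuous_on {0..1} g \<and>
          (\<forall>t\<in>{0..1}. g t \<noteq> 0) \<and>
          (\<integral>\<^sup>+ t\<in>{0<..1}. ennreal (modulus_of_continuity_01 g t / t) \<partial>lborel) < \<infinity>)"

text \<open>Near \<open>p\<close> the whole boundary is a simple curve having \<open>p\<close> as an interior point, so that
  \<open>p\<close> is neither the tip of a slit nor a crossing point. The domain may lie on one side or on
  both sides of the curve.\<close>

definition dini_smooth_boundary_point :: "complex set \<Rightarrow> complex \<Rightarrow> bool" where
  "dini_smooth_boundary_point D p \<longleftrightarrow>
     (\<exists>U \<gamma>. open U \<and> p \<in> U \<and> dini_smooth_curve \<gamma> \<and> inj_on \<gamma> {0..1} \<and>
            p \<in> \<gamma> ` {0<..<1} \<and> frontier D \<inter> U = \<gamma> ` {0..1} \<inter> U)"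

definition boundary_dist :: "complex set \<Rightarrow> complex \<Rightarrow> real" where
  "boundary_dist D w = infdist w (frontier D)"

text \<open>For a domain \<open>D\<close> and \<open>z, w \<in> D\<close> the set below is nonempty (take \<open>f = 0\<close>) and bounded
  above (Montel's theorem and the maximum principle), so the real supremum is the genuine one.\<close>

definition caratheodory_dist :: "complex set \<Rightarrow> complex \<Rightarrow> complex \<Rightarrow> real" where
  "caratheodory_dist D z w =
     (SUP f \<in> {f. f holomorphic_on D \<and> f ` D \<subseteq> ball 0 1 \<and> f z = 0}. artanh (norm (f w)))"

end

theory Submission
  imports Defs
begin

text \<open>No boundary regularity of Riemann maps is needed. In coordinates at a boundary point, with the
  tangent as real axis, the boundary lies in \<open>\<bar>Im \<zeta>\<bar> \<le> \<theta>(\<bar>\<zeta>\<bar>) \<bar>\<zeta>\<bar>\<close> with \<open>\<Sum> \<theta>(2\<^sup>-\<^sup>n) < \<infinity>\<close>. The function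
  \<open>T(\<zeta>) = \<Sum> \<theta>(2\<^sup>-\<^sup>n) / (1 - \<i> 2\<^sup>n \<zeta>)\<close> is bounded by the Dini condition, and its imaginary part dominates
  \<open>\<theta>(\<bar>\<zeta>\<bar>)\<close> up to sign near the real axis, so multiplication by \<open>exp (c T)\<close> turns arguments by enough to
  pass between half-planes and such domains without distorting moduli.

  Upper bound: \<open>\<zeta> exp (c T(\<zeta>))\<close> maps a disc into \<open>D\<close> and a radius of it onto the normal through a given
  point, so \<open>1 - \<bar>f\<bar>\<close> decreases at most linearly towards the boundary by the Schwarz-Pick lemma; a
  Harnack chain in the interior joins the neighbourhoods of the two points.

  Lower bound: \<open>D\<close> avoids an arc around each of the two points. The logarithm branched along an arc opens
  it, also when \<open>D\<close> lies on both sides. Its Moebius images \<open>V\<^sub>p\<close> and \<open>V\<^sub>q\<close> have a simple pole at one of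
  the two boundary points and vanish at the other one, and with \<open>E(V) = c T(1/V) - log (1 + \<i> \<kappa> V)\<close> the function
  \<open>E(V\<^sub>p) - E(V\<^sub>q)\<close> maps \<open>D\<close> into the strip \<open>\<bar>Im\<bar> < \<pi>/2\<close>, sending the two points to its opposite ends.\<close>

section \<open>Harnack estimates for holomorphic maps into the disc\<close>

text \<open>Since \<open>2 * artanh x\<close> equals \<open>- ln (1 - x)\<close> up to an error of
  at most \<open>ln 2\<close>, the theorem says that the infimum of 1 - |f w| over the holomorphic
  maps f of D into the disc with f z = 0 is comparable to the product of the two boundary distances.
  Hence everything is stated for 1 - |f|, whose Harnack constants multiply along chains. The
  obstacle is uniformity: the models are placed not at p and q but at the frontier points p' and q'
  nearest to w and z, which move with w and z. So the scale, the modulus \<theta> and all constants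
  have to be fixed before p' and q' are known. Nearest points are worth this effort because w then
  lies exactly on the normal at p', that is, on the imaginary axis of the coordinates at height
  equal to its boundary distance. The poles -i 2^-n of the kernels of T lie on the same axis. By
  this symmetry T is real there, and off the axis the imaginary parts of all kernels have one sign,
  so that a single kernel, the one of the scale of |\<zeta>|, already gives the required
  rotation.\<close>

definition unit_disc_maps :: "complex set \<Rightarrow> (complex \<Rightarrow> complex) set" where
  "unit_disc_maps D = {f. f holomorphic_on D \<and> f ` D \<subseteq> ball 0 1}"

lemma unit_disc_maps_norm: "f \<in> unit_disc_maps D \<Longrightarrow> z \<in> D \<Longrightarrow> cmod (f z) < 1"
  by (force simp: unit_disc_maps_def)

text \<open>The identity behind the pseudo-hyperbolic distance: it links the quotient of |x - y| by
  |1 - cnj y x| with the distances of x and y to the unit circle.\<close>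

lemma norm_one_minus_cnj_mult_power2:
  "(cmod (1 - cnj y * x))\<^sup>2 = (cmod (x - y))\<^sup>2 + (1 - (cmod x)\<^sup>2) * (1 - (cmod y)\<^sup>2)"
  unfolding cmod_power2 by (simp add: algebra_simps power2_eq_square)

text \<open>If x and y have pseudo-hyperbolic distance at most \<beta>, so have their moduli, and
  for real numbers the claim is elementary. The division-free hypothesis has the form of the
  Schwarz-Pick inequality.\<close>

lemma pseudo_hyperbolic_harnack:
  fixes x y :: complex
  assumes "cmod x < 1" "cmod y < 1" "cmod (x - y) \<le> \<beta> * cmod (1 - cnj y * x)" "0 \<le> \<beta>" "\<beta> < 1"
  shows "(1 - cmod y) * ((1 - \<beta>) / 2) \<le> 1 - cmod x"
proof -
  define u v where "u = cmod x" and "v = cmod y"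
  define A where "A = (cmod (1 - cnj y * x))\<^sup>2"
  have uv: "0 \<le> u" "u < 1" "0 \<le> v" "v < 1" using assms by (auto simp: u_def v_def)
  have uv1: "u * v < 1" using uv by (smt (verit) mult_left_le)
  have "1 - u * v \<le> cmod (1 - cnj y * x)"
    using norm_triangle_ineq2[of 1 "cnj y * x"] by (simp add: u_def v_def norm_mult mult.commute)
  then have A: "(1 - u * v)\<^sup>2 \<le> A" unfolding A_def using uv1 by (intro power_mono) auto
  have A2: "A = (cmod (x - y))\<^sup>2 + (1 - u\<^sup>2) * (1 - v\<^sup>2)"
    unfolding A_def u_def v_def by (rule norm_one_minus_cnj_mult_power2)
  have "(cmod (x - y))\<^sup>2 \<le> (\<beta> * cmod (1 - cnj y * x))\<^sup>2"
    using assms by (intro power_mono) auto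
  then have "(1 - \<beta>\<^sup>2) * A \<le> (1 - u\<^sup>2) * (1 - v\<^sup>2)"
    using A2 by (simp add: power_mult_distrib A_def algebra_simps)
  moreover have "(1 - \<beta>\<^sup>2) * (1 - u * v)\<^sup>2 \<le> (1 - \<beta>\<^sup>2) * A"
    using A assms by (intro mult_left_mono) (auto simp: power_le_one)
  ultimately have "(1 - \<beta>\<^sup>2) * (1 - u * v)\<^sup>2 \<le> (1 - u\<^sup>2) * (1 - v\<^sup>2)" by linarith
  \<comment> \<open>By (1 - u^2)(1 - v^2) = (1 - u v)^2 - (u - v)^2.\<close>
  then have "(u - v)\<^sup>2 \<le> (\<beta> * (1 - u * v))\<^sup>2"
    by (simp add: algebra_simps power2_eq_square)
  then have "u - v \<le> \<beta> * (1 - u * v)"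
    by (rule power2_le_imp_le) (use assms uv1 in simp)
  \<comment> \<open>Write 1 - u v = (1 - v) + v (1 - u) and u - v = (1 - v) - (1 - u).\<close>
  then have *: "(1 - v) * (1 - \<beta>) \<le> (1 - u) * (1 + \<beta> * v)" by (simp add: algebra_simps)
  have "\<beta> * v \<le> 1 * 1" using assms uv by (intro mult_mono) auto
  then have "(1 - u) * (1 + \<beta> * v) \<le> (1 - u) * 2" using uv by (intro mult_left_mono) auto
  with * show ?thesis by (simp add: u_def v_def)
qed

text \<open>The Schwarz lemma for f rescaled to the unit disc and followed by the disc automorphism
  that sends f c to 0.\<close>

lemma Schwarz_Pick_ball:
  fixes c z :: complex
  assumes "f \<in> unit_disc_maps (ball c R)" "z \<in> ball c R"
  shows "cmod (f z - f c) \<le> cmod (z - c) / R * cmod (1 - cnj (f c) * f z)"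
proof -
  have R: "0 < R" using assms(2) by (metis ball_eq_empty empty_iff not_less)
  have hol: "f holomorphic_on ball c R" and im: "\<And>z. z \<in> ball c R \<Longrightarrow> cmod (f z) < 1"
    using assms(1) unit_disc_maps_norm by (auto simp: unit_disc_maps_def)
  have fc: "cmod (f c) < 1" using im R by simp
  define g where "g = (\<lambda>b. f (c + of_real R * b))"
  define h where "h = (\<lambda>b. (g b - f c) / (1 - cnj (f c) * g b))"
  have in_ball: "c + of_real R * b \<in> ball c R" if "cmod b < 1" for b
    using that R by (simp add: dist_norm norm_mult)
  have g1: "cmod (g b) < 1" if "cmod b < 1" for b
    unfolding g_def using im in_ball that by blast
  have nz: "1 - cnj (f c) * g b \<noteq> 0" if "cmod b < 1" for b
  proof
    assume "1 - cnj (f c) * g b = 0"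
    then have "cmod (f c) * cmod (g b) = 1" by (metis complex_mod_cnj eq_iff_diff_eq_0 norm_mult norm_one)
    then show False using fc g1[OF that] by (smt (verit) mult_left_le norm_ge_zero)
  qed
  have holg: "g holomorphic_on ball 0 1"
    unfolding g_def
    by (rule holomorphic_on_compose_gen[where g=f and t = "ball c R", unfolded o_def])
       (use hol in_ball in \<open>auto intro!: holomorphic_intros\<close>)
  have "h holomorphic_on ball 0 1"
    unfolding h_def using nz by (auto intro!: holomorphic_intros holg)
  moreover have "h 0 = 0" by (simp add: h_def g_def)
  moreover have "cmod (h b) < 1" if b: "cmod b < 1" for b
  proof -
    have "(1 - (cmod (g b))\<^sup>2) * (1 - (cmod (f c))\<^sup>2) > 0"
      using g1[OF b] fc by (simp add: power_less_one_iff abs_square_less_1)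
    then have "(cmod (g b - f c))\<^sup>2 < (cmod (1 - cnj (f c) * g b))\<^sup>2"
      by (simp add: norm_one_minus_cnj_mult_power2)
    then have "cmod (g b - f c) < cmod (1 - cnj (f c) * g b)"
      by (rule power2_less_imp_less) simp
    then show ?thesis using nz[OF b] by (simp add: h_def norm_divide)
  qed
  ultimately have S: "cmod (h b) \<le> cmod b" if "cmod b < 1" for b
    using Schwarz_Lemma(1)[of h b] that by blast
  define b where "b = (z - c) / of_real R"
  have b1: "cmod b < 1" using assms(2) R by (simp add: b_def norm_divide dist_norm norm_minus_commute)
  have gz: "g b = f z" using R by (simp add: g_def b_def)
  have "cmod (g b - f c) \<le> cmod b * cmod (1 - cnj (f c) * g b)"
    using S[OF b1] nz[OF b1] by (simp add: h_def norm_divide field_simps)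
  moreover have "cmod b = cmod (z - c) / R" using R by (simp add: b_def norm_divide)
  ultimately show ?thesis by (simp only: gz)
qed

lemma harnack_ball:
  fixes c z :: complex
  assumes "f \<in> unit_disc_maps (ball c R)" "z \<in> ball c R"
  shows "(1 - cmod (f c)) * ((1 - cmod (z - c) / R) / 2) \<le> 1 - cmod (f z)"
    and "(1 - cmod (f z)) * ((1 - cmod (z - c) / R) / 2) \<le> 1 - cmod (f c)"
proof -
  have R: "0 < R" using assms(2) by (metis ball_eq_empty empty_iff not_less)
  have im: "cmod (f z) < 1" "cmod (f c) < 1" using assms R by (auto intro: unit_disc_maps_norm)
  have \<beta>: "0 \<le> cmod (z - c) / R" "cmod (z - c) / R < 1"
    using assms(2) R by (auto simp: dist_norm norm_minus_commute)
  note P = Schwarz_Pick_ball[OF assms]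
  have "1 - cnj (f c) * f z = cnj (1 - cnj (f z) * f c)" by simp
  then have "cmod (1 - cnj (f c) * f z) = cmod (1 - cnj (f z) * f c)" by (simp only: complex_mod_cnj)
  then have P': "cmod (f c - f z) \<le> cmod (z - c) / R * cmod (1 - cnj (f z) * f c)"
    using P by (simp add: norm_minus_commute)
  show "(1 - cmod (f c)) * ((1 - cmod (z - c) / R) / 2) \<le> 1 - cmod (f z)"
    by (rule pseudo_hyperbolic_harnack[OF im P \<beta>])
  show "(1 - cmod (f z)) * ((1 - cmod (z - c) / R) / 2) \<le> 1 - cmod (f c)"
    by (rule pseudo_hyperbolic_harnack[OF im(2,1) P' \<beta>])
qed

lemma unit_disc_maps_subset: "f \<in> unit_disc_maps D \<Longrightarrow> S \<subseteq> D \<Longrightarrow> f \<in> unit_disc_maps S"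
  unfolding unit_disc_maps_def using holomorphic_on_subset by blast

text \<open>Within half the radius the factor in \<open>harnack_ball\<close> is at least (1 - 1/2) /
  2 = 1/4.\<close>

lemma harnack_half_ball:
  assumes "f \<in> unit_disc_maps D" "ball c R \<subseteq> D" "cmod (z - c) < R / 2"
  shows "(1 - cmod (f c)) / 4 \<le> 1 - cmod (f z)" "(1 - cmod (f z)) / 4 \<le> 1 - cmod (f c)"
proof -
  have R: "0 < R" using assms(3) by (smt (verit) norm_ge_zero half_gt_zero_iff)
  have z: "z \<in> ball c R" using assms(3) R by (simp add: dist_norm norm_minus_commute)
  have f: "f \<in> unit_disc_maps (ball c R)" using assms unit_disc_maps_subset by blast
  have b: "(1 - cmod (z - c) / R) / 2 \<ge> 1 / 4" using assms(3) R by (simp add: field_simps)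
  have n: "cmod (f z) < 1" "cmod (f c) < 1" using f z R by (auto intro: unit_disc_maps_norm)
  have m: "x / 4 \<le> x * ((1 - cmod (z - c) / R) / 2)" if "0 \<le> x" for x
    using mult_left_mono[OF b that] by (simp only: times_divide_eq_right mult_1_right)
  show "(1 - cmod (f c)) / 4 \<le> 1 - cmod (f z)" using order.trans[OF m harnack_ball(1)[OF f z]] n by simp
  show "(1 - cmod (f z)) / 4 \<le> 1 - cmod (f c)" using order.trans[OF m harnack_ball(2)[OF f z]] n by simp
qed

text \<open>One constant for all maps f at once, and both inequalities: comparability is then
  symmetric, and the constants of consecutive pairs multiply.\<close>

definition harnack_comparable :: "complex set \<Rightarrow> real \<Rightarrow> complex \<Rightarrow> complex \<Rightarrow> bool" where
  "harnack_comparable D c a b \<longleftrightarrow> (\<forall>f\<in>unit_disc_maps D.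
     c * (1 - cmod (f a)) \<le> 1 - cmod (f b) \<and> c * (1 - cmod (f b)) \<le> 1 - cmod (f a))"

lemma harnack_comparableD:
  assumes "harnack_comparable D c a b" "f \<in> unit_disc_maps D"
  shows "c * (1 - cmod (f a)) \<le> 1 - cmod (f b)" "c * (1 - cmod (f b)) \<le> 1 - cmod (f a)"
  using assms by (auto simp: harnack_comparable_def)

text \<open>Comparability with some positive constant is an equivalence relation, and its classes
  are open because \<open>harnack_half_ball\<close> gives the constant 1/4 on small balls. A
  connected set has only one class.\<close>

lemma harnack_chain:
  assumes D: "open D" "connected D" and ab: "a \<in> D" "b \<in> D"
  shows "\<exists>c>0. harnack_comparable D c a b"
proof -
  define R where "R = (\<lambda>a b. \<exists>c>0. harnack_comparable D c a b)"
  have "R a b"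
  proof (rule connected_equivalence_relation[OF D(2) ab])
    show "R y x" if "R x y" for x y using that unfolding R_def harnack_comparable_def by blast
    show "R x z" if xy: "R x y" and yz: "R y z" for x y z
    proof -
      obtain c where c: "c > 0" "harnack_comparable D c x y" using xy unfolding R_def by blast
      obtain d where d: "d > 0" "harnack_comparable D d y z" using yz unfolding R_def by blast
      have "d * c * (1 - cmod (f x)) \<le> 1 - cmod (f z) \<and> d * c * (1 - cmod (f z)) \<le> 1 - cmod (f x)"
        if f: "f\<in>unit_disc_maps D" for f
      proof -
        have "d * (c * (1 - cmod (f x))) \<le> d * (1 - cmod (f y))"
          using harnack_comparableD[OF c(2) f] d(1) by (intro mult_left_mono) auto
        moreover have "c * (d * (1 - cmod (f z))) \<le> c * (1 - cmod (f y))"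
          using harnack_comparableD[OF d(2) f] c(1) by (intro mult_left_mono) auto
        ultimately show ?thesis using harnack_comparableD[OF c(2) f] harnack_comparableD[OF d(2) f] by (simp add: mult.assoc mult.left_commute)
      qed
      then show ?thesis unfolding R_def harnack_comparable_def using c(1) d(1) by (intro exI[of _ "d * c"]) auto
    qed
    show "\<exists>T. openin (top_of_set D) T \<and> a \<in> T \<and> (\<forall>x\<in>T. R a x)" if a: "a \<in> D" for a
    proof -
      obtain r where r: "r > 0" "ball a r \<subseteq> D" using D(1) a openE by blast
      have "R a x" if "x \<in> ball a (r/2)" for x
      proof -
        have "cmod (x - a) < r / 2" using that by (simp add: dist_norm norm_minus_commute)
        then show ?thesis unfolding R_def harnack_comparable_def
          using harnack_half_ball[OF _ r(2)] by (intro exI[of _ "1/4"]) auto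
      qed
      moreover have "openin (top_of_set D) (ball a (r/2))"
        using r by (intro open_openin_trans[OF D(1)]) (auto intro: order.trans[OF subset_ball])
      ultimately show ?thesis using r by (intro exI[of _ "ball a (r/2)"]) auto
    qed
  qed
  then show ?thesis unfolding R_def .
qed

text \<open>Each of K and L is covered by finitely many half balls, whose centres are joined to one
  base point \<open>o'\<close> by chains; the constant is thus independent of the points a and
  b.\<close>

lemma harnack_compact:
  assumes D: "open D" "connected D" and K: "compact K" "K \<subseteq> D" and L: "compact L" "L \<subseteq> D"
  shows "\<exists>c>0. \<forall>f\<in>unit_disc_maps D. \<forall>a\<in>K. \<forall>b\<in>L. c * (1 - cmod (f a)) \<le> 1 - cmod (f b)"
proof (cases "D = {}")
  case True
  then show ?thesis using K by (intro exI[of _ 1]) auto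
next
  case False
  then obtain o' where o: "o' \<in> D" by blast
  have main: "\<exists>c>0. \<forall>a\<in>K. harnack_comparable D c a o'" if K: "compact K" "K \<subseteq> D" for K
  proof -
    have "\<forall>x\<in>K. \<exists>r. r > 0 \<and> ball x r \<subseteq> D" using D(1) K openE by (metis subsetD)
    then obtain r where r: "\<And>x. x \<in> K \<Longrightarrow> r x > 0 \<and> ball x (r x) \<subseteq> D" by metis
    have cov: "K \<subseteq> (\<Union>x\<in>K. ball x (r x / 2))" using r by force
    obtain F where F: "F \<subseteq> K" "finite F" "K \<subseteq> (\<Union>x\<in>F. ball x (r x / 2))"
      by (rule compactE_image[OF K(1) _ cov]) auto
    have "\<forall>x\<in>F. \<exists>c>0. harnack_comparable D c x o'"
      using harnack_chain[OF D _ o] F(1) K(2) by blast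
    then obtain c where c: "\<And>x. x \<in> F \<Longrightarrow> c x > 0" "\<And>x. x \<in> F \<Longrightarrow> harnack_comparable D (c x) x o'"
      by metis
    \<comment> \<open>Inserting 1 keeps the minimum meaningful when the finite cover is
      empty.\<close>
    define m where "m = Min (insert 1 (c ` F))"
    have m: "m > 0" "\<And>x. x \<in> F \<Longrightarrow> m \<le> c x" using F(2) c(1) by (auto simp: m_def)
    have "m / 4 * (1 - cmod (f a)) \<le> 1 - cmod (f o') \<and> m / 4 * (1 - cmod (f o')) \<le> 1 - cmod (f a)"
      if f: "f\<in>unit_disc_maps D" and a: "a \<in> K" for f a
    proof -
      obtain x where x: "x \<in> F" "a \<in> ball x (r x / 2)" using F(3) a by blast
      have xK: "x \<in> K" using x F by blast
      have ax: "cmod (a - x) < r x / 2" using x(2) by (simp add: dist_norm norm_minus_commute)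
      note h = harnack_half_ball[OF f _ ax]
      have h: "(1 - cmod (f x)) / 4 \<le> 1 - cmod (f a)" "(1 - cmod (f a)) / 4 \<le> 1 - cmod (f x)"
        using h r[OF xK] by auto
      have n: "cmod (f x) < 1" "cmod (f o') < 1" using f xK K o by (auto intro: unit_disc_maps_norm)
      have "m * ((1 - cmod (f a)) / 4) \<le> m * (1 - cmod (f x))"
        using h m by (intro mult_left_mono) auto
      moreover have "m * (1 - cmod (f x)) \<le> c x * (1 - cmod (f x))"
           "m * (1 - cmod (f o')) \<le> c x * (1 - cmod (f o'))"
        using n m x by (auto intro!: mult_right_mono)
      ultimately show ?thesis using harnack_comparableD[OF c(2)[OF x(1)] f] h by auto
    qed
    then show ?thesis using m unfolding harnack_comparable_def by (intro exI[of _ "m/4"]) auto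
  qed
  obtain c where c: "c > 0" "\<And>a. a \<in> K \<Longrightarrow> harnack_comparable D c a o'" using main[OF K] by blast
  obtain d where d: "d > 0" "\<And>a. a \<in> L \<Longrightarrow> harnack_comparable D d a o'" using main[OF L] by blast
  have "d * c * (1 - cmod (f a)) \<le> 1 - cmod (f b)" if "f\<in>unit_disc_maps D" "a\<in>K" "b\<in>L" for f a b
  proof -
    have "d * (c * (1 - cmod (f a))) \<le> d * (1 - cmod (f o'))"
      using harnack_comparableD(1)[OF c(2)[OF that(2)] that(1)] d(1) by (intro mult_left_mono) auto
    then show ?thesis using harnack_comparableD(2)[OF d(2)[OF that(3)] that(1)] by (simp add: mult.assoc)
  qed
  then show ?thesis using c d by (intro exI[of _ "d * c"]) auto
qed

section \<open>Dini moduli and their Cauchy series\<close>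

text \<open>The Dini condition in dyadic form, which for nondecreasing functions is equivalent to
  the convergence of the integral of \<theta>(t) / t at 0. All scales c are included so that
  rescaling the argument stays within the class.\<close>

definition dini_modulus :: "(real \<Rightarrow> real) \<Rightarrow> bool" where
  "dini_modulus \<theta> \<longleftrightarrow> mono_on {0..} \<theta> \<and> (\<forall>x\<ge>0. 0 \<le> \<theta> x) \<and> (\<forall>c>0. summable (\<lambda>n. \<theta> (c / 2 ^ n)))"

lemma dini_modulusD:
  assumes "dini_modulus \<theta>"
  shows "0 \<le> x \<Longrightarrow> x \<le> y \<Longrightarrow> \<theta> x \<le> \<theta> y" "0 \<le> x \<Longrightarrow> 0 \<le> \<theta> x"
    "0 < c \<Longrightarrow> summable (\<lambda>n. \<theta> (c / 2 ^ n))"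
  using assms by (auto simp: dini_modulus_def mono_on_def)

text \<open>Rescalings come from coordinate changes that distort moduli by bounded factors. The
  linear term comes from bounded errors added to \<open>1 / \<zeta>\<close>, which widen the cone by
  a multiple of |\<zeta>|.\<close>

lemma dini_modulus_combine:
  assumes "dini_modulus \<theta>" "0 \<le> a" "0 < b" "0 \<le> c"
  shows "dini_modulus (\<lambda>x. a * \<theta> (b * x) + c * x)"
  unfolding dini_modulus_def
proof (intro conjI allI impI)
  show "mono_on {0..} (\<lambda>x. a * \<theta> (b * x) + c * x)"
    using assms by (auto simp: mono_on_def intro!: add_mono mult_left_mono dini_modulusD(1)[OF assms(1)])
  show "0 \<le> a * \<theta> (b * x) + c * x" if "0 \<le> x" for x
    using assms that dini_modulusD(2)[OF assms(1), of "b * x"] by simp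
  show "summable (\<lambda>n. a * \<theta> (b * (d / 2 ^ n)) + c * (d / 2 ^ n))" if "0 < d" for d
  proof (intro summable_add summable_mult)
    show "summable (\<lambda>n. \<theta> (b * (d / 2 ^ n)))"
      using dini_modulusD(3)[OF assms(1), of "b * d"] assms that by simp
    have "summable (\<lambda>n. d * (1/2) ^ n)" by (intro summable_mult summable_geometric) simp
    then show "summable (\<lambda>n. d / 2 ^ n)" by (simp add: power_divide)
  qed
qed

lemma dini_modulus_small:
  assumes "dini_modulus \<theta>" "0 < \<epsilon>"
  shows "\<exists>\<delta>>0. \<forall>x. 0 \<le> x \<and> x \<le> \<delta> \<longrightarrow> \<theta> x < \<epsilon>"
proof -
  have "(\<lambda>n. \<theta> (1 / 2 ^ n)) \<longlonglongrightarrow> 0"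
    using dini_modulusD(3)[OF assms(1), of 1] summable_LIMSEQ_zero by fastforce
  then have "\<forall>\<^sub>F n in sequentially. \<theta> (1 / 2 ^ n) < \<epsilon>" using assms(2) by (rule order_tendstoD(2))
  then obtain n where "\<theta> (1 / 2 ^ n) < \<epsilon>" by (auto simp: eventually_sequentially)
  moreover have "\<theta> x \<le> \<theta> (1 / 2 ^ n)" if "0 \<le> x" "x \<le> 1 / 2 ^ n" for x
    using dini_modulusD(1)[OF assms(1) that] .
  ultimately show ?thesis by (intro exI[of _ "1 / 2 ^ n"]) fastforce
qed

text \<open>This is the function \<open>T\<close> above in the variable \<open>V = 1 / \<zeta>\<close>.\<close>

definition dini_series :: "(real \<Rightarrow> real) \<Rightarrow> nat \<Rightarrow> complex \<Rightarrow> complex" where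
  "dini_series \<theta> k V = (\<Sum>n. of_real (\<theta> (8 / 2 ^ (n + k))) * (V / (V - \<i> * 2 ^ (n + k))))"

text \<open>The total weight of the kernels that are kept; dropping those below k makes it as small
  as desired. The factor 8 in the weights leaves room for rounding |V| up to a power of two and for
  the doubling of |\<zeta>| by the interior model.\<close>

definition dini_tail :: "(real \<Rightarrow> real) \<Rightarrow> nat \<Rightarrow> real" where
  "dini_tail \<theta> k = (\<Sum>n. \<theta> (8 / 2 ^ (n + k)))"

text \<open>The poles that remain are the points i 2^m with m \<ge> k. The first set keeps away from
  the positive imaginary axis, the second is a disc of half the modulus of the nearest pole.\<close>

definition dini_region :: "nat \<Rightarrow> complex set" where
  "dini_region k = {V. Im V < cmod V / 2} \<union> ball 0 (2 ^ k / 2)"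

lemma open_dini_region: "open (dini_region k)"
  unfolding dini_region_def by (intro open_Un open_Collect_less continuous_intros open_ball) auto

lemma norm_diff_imaginary_power2: "(cmod (V - \<i> * of_real N))\<^sup>2 = (cmod V)\<^sup>2 - 2 * N * Im V + N\<^sup>2"
  unfolding cmod_power2 by (simp add: algebra_simps power2_eq_square)

lemma dini_region_dist:
  assumes "V \<in> dini_region k" "2 ^ k \<le> N"
  shows "N / 2 \<le> cmod (V - \<i> * of_real N)" "cmod V \<le> 3 * cmod (V - \<i> * of_real N)" "V \<noteq> \<i> * of_real N"
proof -
  have N: "0 < N" using assms(2) by (smt (verit) zero_less_power)
  show 1: "N / 2 \<le> cmod (V - \<i> * of_real N)"
  proof (cases "Im V < cmod V / 2")
    case True
    \<comment> \<open>Here |V - i N|^2 \<ge> |V|^2 - N |V| + N^2 = (|V| - N/2)^2 + 3 N^2 /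
      4.\<close>
    have "0 \<le> (cmod V - N / 2)\<^sup>2" by simp
    moreover have "N * Im V \<le> N * (cmod V / 2)" using True N by (intro mult_left_mono) auto
    ultimately have "(N / 2)\<^sup>2 \<le> (cmod (V - \<i> * of_real N))\<^sup>2"
      unfolding norm_diff_imaginary_power2 using zero_le_square[of N]
      by (simp add: power2_eq_square algebra_simps del: zero_le_square)
    then show ?thesis by (rule power2_le_imp_le) simp
  next
    case False
    then have "cmod V < 2 ^ k / 2" using assms(1) by (simp add: dini_region_def)
    then show ?thesis using norm_triangle_ineq2[of "\<i> * of_real N" V] assms(2) N
      by (simp add: norm_mult norm_minus_commute)
  qed
  have "cmod V \<le> cmod (V - \<i> * of_real N) + N"
    using norm_triangle_ineq2[of V "\<i> * of_real N"] N by (simp add: norm_mult)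
  with 1 show "cmod V \<le> 3 * cmod (V - \<i> * of_real N)" by linarith
  show "V \<noteq> \<i> * of_real N" using 1 N by auto
qed

section \<open>Convergence, holomorphy and sign of the Cauchy series\<close>

context
  fixes \<theta> :: "real \<Rightarrow> real" and k :: nat
  assumes dini: "dini_modulus \<theta>"
begin

lemma dini_tail_summable: "summable (\<lambda>n. \<theta> (8 / 2 ^ (n + k)))"
  using summable_ignore_initial_segment[OF dini_modulusD(3)[OF dini, of 8], of k] by simp

lemma dini_weight_nonneg: "0 \<le> \<theta> (8 / 2 ^ n)" by (rule dini_modulusD(2)[OF dini]) simp

lemma dini_tail_nonneg: "0 \<le> dini_tail \<theta> k"
  unfolding dini_tail_def by (rule suminf_nonneg[OF dini_tail_summable]) (simp add: dini_weight_nonneg)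

lemma dini_series_bound:
  assumes "\<And>n. cmod (V / (V - \<i> * 2 ^ (n + k))) \<le> B"
  shows "summable (\<lambda>n. of_real (\<theta> (8 / 2 ^ (n + k))) * (V / (V - \<i> * 2 ^ (n + k))))"
    and "cmod (dini_series \<theta> k V) \<le> B * dini_tail \<theta> k"
proof -
  have b: "norm (of_real (\<theta> (8 / 2 ^ (n + k))) * (V / (V - \<i> * 2 ^ (n + k)))) \<le> B * \<theta> (8 / 2 ^ (n + k))" for n
    using mult_mono[OF assms order.refl _ dini_weight_nonneg, of n "n+k"] dini_weight_nonneg[of "n+k"] order.trans[OF norm_ge_zero assms]
    by (simp only: norm_mult norm_of_real abs_of_nonneg mult.commute)
  have s: "summable (\<lambda>n. B * \<theta> (8 / 2 ^ (n + k)))" by (intro summable_mult dini_tail_summable)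
  show 1: "summable (\<lambda>n. of_real (\<theta> (8 / 2 ^ (n + k))) * (V / (V - \<i> * 2 ^ (n + k))))"
    by (rule summable_comparison_test'[OF s b])
  have "cmod (dini_series \<theta> k V) \<le> (\<Sum>n. B * \<theta> (8 / 2 ^ (n + k)))"
    unfolding dini_series_def by (rule norm_suminf_le[OF b s])
  then show "cmod (dini_series \<theta> k V) \<le> B * dini_tail \<theta> k"
    unfolding dini_tail_def by (simp add: suminf_mult dini_tail_summable)
qed

lemma dini_region_dist':
  assumes "V \<in> dini_region k"
  shows "2 ^ (n + k) / 2 \<le> cmod (V - \<i> * 2 ^ (n + k))" "cmod V \<le> 3 * cmod (V - \<i> * 2 ^ (n + k))"
    "V - \<i> * 2 ^ (n + k) \<noteq> 0"
proof -
  have "(2::real) ^ k \<le> 2 ^ (n + k)" by (rule power_increasing) auto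
  from dini_region_dist[OF assms this]
  show "2 ^ (n + k) / 2 \<le> cmod (V - \<i> * 2 ^ (n + k))" "cmod V \<le> 3 * cmod (V - \<i> * 2 ^ (n + k))"
    "V - \<i> * 2 ^ (n + k) \<noteq> 0" by auto
qed

lemma dini_term_le_3: "V \<in> dini_region k \<Longrightarrow> cmod (V / (V - \<i> * 2 ^ (n + k))) \<le> 3"
  using dini_region_dist'[of V n] by (simp add: norm_divide divide_le_eq)

lemma dini_series_le: "V \<in> dini_region k \<Longrightarrow> cmod (dini_series \<theta> k V) \<le> 3 * dini_tail \<theta> k"
  by (intro dini_series_bound(2) dini_term_le_3)

text \<open>Every kernel vanishes at V = 0, which gains a factor |V|. This keeps the contribution of
  one pole map small near the pole of the other.\<close>

lemma dini_series_le_small: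
  assumes "cmod V < 2 ^ k / 2"
  shows "cmod (dini_series \<theta> k V) \<le> 2 * cmod V * dini_tail \<theta> k"
proof (rule dini_series_bound(2))
  fix n
  have V: "V \<in> dini_region k" using assms by (simp add: dini_region_def)
  have "(1::real) \<le> 2 ^ (n + k)" by simp
  then have "1 \<le> 2 * cmod (V - \<i> * 2 ^ (n + k))" using dini_region_dist'(1)[OF V, of n] by linarith
  then have "cmod V * 1 \<le> cmod V * (2 * cmod (V - \<i> * 2 ^ (n + k)))" by (intro mult_left_mono) auto
  then show "cmod (V / (V - \<i> * 2 ^ (n + k))) \<le> 2 * cmod V"
    using dini_region_dist'(3)[OF V, of n] by (simp add: norm_divide divide_le_eq mult_ac)
qed

lemma dini_series_sums:
  assumes "V \<in> dini_region k"
  shows "(\<lambda>n. of_real (\<theta> (8 / 2 ^ (n + k))) * (V / (V - \<i> * 2 ^ (n + k)))) sums dini_series \<theta> k V"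
  unfolding dini_series_def by (rule summable_sums[OF dini_series_bound(1)[OF dini_term_le_3[OF assms]]])

lemma dini_series_holomorphic: "dini_series \<theta> k holomorphic_on dini_region k"
proof (rule holomorphic_uniform_sequence[OF open_dini_region])
  let ?f = "\<lambda>n V. of_real (\<theta> (8 / 2 ^ (n + k))) * (V / (V - \<i> * 2 ^ (n + k)))"
  show "(\<lambda>V. \<Sum>i<n. ?f i V) holomorphic_on dini_region k" for n
    using dini_region_dist'(3) by (auto intro!: holomorphic_intros)
  fix x assume x: "x \<in> dini_region k"
  obtain d where d: "d > 0" "cball x d \<subseteq> dini_region k"
    using open_dini_region x open_contains_cball by blast
  have "uniform_limit (cball x d) (\<lambda>n V. \<Sum>i<n. ?f i V) (\<lambda>V. suminf (\<lambda>i. ?f i V)) sequentially"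
  proof (rule Weierstrass_m_test)
    show "summable (\<lambda>n. 3 * \<theta> (8 / 2 ^ (n + k)))" by (intro summable_mult dini_tail_summable)
    show "norm (?f n V) \<le> 3 * \<theta> (8 / 2 ^ (n + k))" if "V \<in> cball x d" for n V
      using mult_right_mono[OF dini_term_le_3 dini_weight_nonneg[of "n+k"], of V n] that d(2) dini_weight_nonneg[of "n+k"]
      by (auto simp only: norm_mult norm_of_real abs_of_nonneg mult.commute)
  qed
  then show "\<exists>d>0. cball x d \<subseteq> dini_region k \<and>
      uniform_limit (cball x d) (\<lambda>n V. \<Sum>i<n. ?f i V) (dini_series \<theta> k) sequentially"
    using d unfolding dini_series_def by blast
qed

text \<open>With the pole on the imaginary axis, the imaginary part of the kernel has the sign of Re
  V, whatever N is: the rotations of all scales add up and never cancel.\<close>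

lemma Re_Im_dini_term:
  fixes V :: complex and N :: real
  shows "Im (V / (V - \<i> * of_real N)) = Re V * (N / (cmod (V - \<i> * of_real N))\<^sup>2)"
    and "Re (V / (V - \<i> * of_real N)) = ((cmod V)\<^sup>2 - N * Im V) / (cmod (V - \<i> * of_real N))\<^sup>2"
proof -
  have "Im (V / (V - \<i> * of_real N)) = N * Re V / (cmod (V - \<i> * of_real N))\<^sup>2"
    by (simp add: Im_divide cmod_power2 algebra_simps)
  then show "Im (V / (V - \<i> * of_real N)) = Re V * (N / (cmod (V - \<i> * of_real N))\<^sup>2)" by simp
  show "Re (V / (V - \<i> * of_real N)) = ((cmod V)\<^sup>2 - N * Im V) / (cmod (V - \<i> * of_real N))\<^sup>2"
    by (simp add: Re_divide cmod_power2 right_diff_distrib power2_eq_square[of "Im V"] power2_eq_square[of "Re V"] mult_ac)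
qed

lemma dini_series_Re_nonneg:
  assumes "V \<in> dini_region k" "Im V \<le> 0"
  shows "0 \<le> Re (dini_series \<theta> k V)"
proof -
  have "0 \<le> Re (of_real (\<theta> (8 / 2 ^ (n + k))) * (V / (V - \<i> * 2 ^ (n + k))))" for n
  proof -
    have "0 \<le> Re (V / (V - \<i> * of_real (2 ^ (n + k))))"
      using assms(2) order.trans[OF mult_nonneg_nonpos zero_le_power2, of "2 ^ (n + k)" "Im V" "cmod V"]
      unfolding Re_Im_dini_term by (intro divide_nonneg_nonneg) auto
    then show ?thesis using dini_weight_nonneg[of "n+k"]
      by (simp del: times_divide_eq_right times_divide_eq_left)
  qed
  then show ?thesis by (rule sums_le[OF _ sums_zero sums_Re[OF dini_series_sums[OF assms(1)]]])
qed

text \<open>As all terms have the sign of Re V, a single one suffices for the lower bound, namely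
  the one with |V| \<le> N \<le> 2 |V|. The factor Re V is split off so that the series is visibly
  real on the imaginary axis.\<close>

lemma dini_series_Im:
  assumes V: "V \<in> dini_region k"
  shows "\<exists>S\<ge>0. Im (dini_series \<theta> k V) = Re V * S \<and>
     (2 ^ k \<le> cmod V \<and> cmod V / 2 \<le> \<bar>Re V\<bar> \<longrightarrow> \<theta> (4 / cmod V) / 18 \<le> \<bar>Re V\<bar> * S)"
proof -
  define s where "s n = \<theta> (8 / 2 ^ (n + k)) * (2 ^ (n + k) / (cmod (V - \<i> * 2 ^ (n + k)))\<^sup>2)" for n
  have s0: "0 \<le> s n" for n using dini_weight_nonneg[of "n+k"] by (simp add: s_def)
  have sb: "s n \<le> 4 * \<theta> (8 / 2 ^ (n + k))" for n
  proof -
    have N1: "(1::real) \<le> 2 ^ (n + k)" by simp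
    have *: "(2 ^ (n + k) / 2)\<^sup>2 \<le> (cmod (V - \<i> * 2 ^ (n + k)))\<^sup>2"
      using dini_region_dist'(1)[OF V, of n] by (intro power_mono) auto
    have "(2::real) ^ (n + k) * 1 \<le> 2 ^ (n + k) * 2 ^ (n + k)" by (intro mult_left_mono N1) auto
    also have "\<dots> = 4 * (2 ^ (n + k) / 2)\<^sup>2" by (simp add: power2_eq_square)
    also have "\<dots> \<le> 4 * (cmod (V - \<i> * 2 ^ (n + k)))\<^sup>2" using * by (intro mult_left_mono) auto
    finally have "2 ^ (n + k) \<le> 4 * (cmod (V - \<i> * 2 ^ (n + k)))\<^sup>2" by (simp only: mult_1_right)
    then have "2 ^ (n + k) / (cmod (V - \<i> * 2 ^ (n + k)))\<^sup>2 \<le> 4"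
      using dini_region_dist'(3)[OF V, of n] by (simp add: divide_le_eq)
    then show ?thesis using mult_left_mono[OF _ dini_weight_nonneg[of "n+k"]] by (fastforce simp: s_def mult.commute)
  qed
  have summ: "summable s"
    by (rule summable_comparison_test'[OF summable_mult[OF dini_tail_summable, of 4]]) (use s0 sb in auto)
  have "Im (of_real (\<theta> (8 / 2 ^ (n + k))) * (V / (V - \<i> * 2 ^ (n + k)))) = Re V * s n" for n
    using Re_Im_dini_term(1)[of V "2 ^ (n+k)"]
    by (simp add: s_def mult.left_commute del: times_divide_eq_right times_divide_eq_left)
  then have "(\<lambda>n. Re V * s n) sums Im (dini_series \<theta> k V)"
    using sums_Im[OF dini_series_sums[OF V]] by simp
  moreover have "(\<lambda>n. Re V * s n) sums (Re V * suminf s)" by (intro sums_mult summable_sums summ)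
  ultimately have eq: "Im (dini_series \<theta> k V) = Re V * suminf s" using sums_unique2 by blast
  have lower: "\<theta> (4 / cmod V) / 18 \<le> \<bar>Re V\<bar> * suminf s" if h: "2 ^ k \<le> cmod V" "cmod V / 2 \<le> \<bar>Re V\<bar>"
  proof -
    define v where "v = cmod V"
    have v1: "1 \<le> v" using h(1) one_le_power[of "2::real" k] unfolding v_def by linarith
    have vk: "2 ^ k \<le> v" using h by (simp add: v_def)
    \<comment> \<open>The least power of two that is at least |V|. Minimality gives
      \<open>2 ^ m \<le> 2 * v\<close>, and \<open>2 ^ k \<le> v\<close> ensures that its kernel is
      among those kept.\<close>
    define m where "m = (LEAST m. v \<le> 2 ^ m)"
    have "\<exists>m. v \<le> 2 ^ m" using real_arch_pow[of 2 v] by (auto intro: less_imp_le)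
    then have m1: "v \<le> 2 ^ m" unfolding m_def by (rule LeastI_ex)
    have "k \<le> m"
    proof (rule ccontr)
      assume "\<not> k \<le> m"
      then have "(2::real) ^ m < 2 ^ k" by (intro power_strict_increasing) auto
      then show False using m1 vk by linarith
    qed
    have m2: "2 ^ m \<le> 2 * v"
    proof (cases m)
      case 0 then show ?thesis using v1 by simp
    next
      case (Suc j)
      have "\<not> v \<le> 2 ^ j" using not_less_Least[of j "\<lambda>m. v \<le> 2 ^ m"] Suc by (auto simp: m_def)
      then show ?thesis using Suc by simp
    qed
    obtain n where n: "m = n + k" using \<open>k \<le> m\<close> by (metis le_add_diff_inverse2)
    define N where "N = (2::real) ^ (n + k)"
    have N: "v \<le> N" "N \<le> 2 * v" "0 < N" using m1 m2 n by (auto simp: N_def)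
    have Ve: "V - \<i> * 2 ^ (n + k) \<noteq> 0" by (rule dini_region_dist'(3)[OF V])
    have "cmod (V - \<i> * 2 ^ (n + k)) \<le> cmod V + cmod (\<i> * 2 ^ (n + k))" by (rule norm_triangle_ineq4)
    also have "\<dots> \<le> 3 * v" using N by (simp add: norm_mult norm_power N_def v_def)
    finally have "(cmod (V - \<i> * 2 ^ (n + k)))\<^sup>2 \<le> (3 * v)\<^sup>2" by (intro power_mono) auto
    then have d: "(cmod (V - \<i> * 2 ^ (n + k)))\<^sup>2 \<le> 9 * v\<^sup>2" by (simp add: power_mult_distrib)
    have "v / 2 * v \<le> \<bar>Re V\<bar> * N" using h(2) N v1 by (intro mult_mono) (auto simp: v_def)
    then have "(cmod (V - \<i> * 2 ^ (n + k)))\<^sup>2 \<le> 18 * (\<bar>Re V\<bar> * N)"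
      using d by (simp add: power2_eq_square)
    \<comment> \<open>1/18 is the quotient of the bounds |Re V| N \<ge> v^2 / 2 and |V - i N|^2
      \<le> 9 v^2.\<close>
    then have q: "1 / 18 \<le> \<bar>Re V\<bar> * (N / (cmod (V - \<i> * 2 ^ (n + k)))\<^sup>2)"
      using Ve by (simp add: field_simps)
    have "4 / v \<le> 8 / N" using N v1 by (simp add: field_simps)
    then have t: "\<theta> (4 / v) \<le> \<theta> (8 / N)" using v1 by (intro dini_modulusD(1)[OF dini]) auto
    have "\<theta> (4 / v) / 18 \<le> \<theta> (8 / N) * (1 / 18)" using t by simp
    also have "\<dots> \<le> \<theta> (8 / N) * (\<bar>Re V\<bar> * (N / (cmod (V - \<i> * 2 ^ (n + k)))\<^sup>2))"
      using q dini_weight_nonneg[of "n+k"] by (intro mult_left_mono) (auto simp: N_def)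
    also have "\<dots> = \<bar>Re V\<bar> * s n" by (simp add: s_def N_def)
    also have "\<dots> \<le> \<bar>Re V\<bar> * suminf s"
      using sum_le_suminf[OF summ, of "{n}"] s0 by (intro mult_left_mono) auto
    finally show ?thesis by (simp add: v_def)
  qed
  show ?thesis using suminf_nonneg[OF summ s0] eq lower by blast
qed

end

lemma dini_tail_small:
  assumes "dini_modulus \<theta>" "0 < \<epsilon>"
  shows "\<exists>k0. \<forall>k\<ge>k0. dini_tail \<theta> k < \<epsilon>"
  using suminf_exist_split[OF assms(2) dini_modulusD(3)[OF assms(1), of 8]]
  unfolding dini_tail_def by (force simp: abs_less_iff)

section \<open>Model maps\<close>

lemma sin_ge_half:
  fixes u :: real assumes "0 \<le> u" "u \<le> 1" shows "u / 2 \<le> sin u" "1 / 2 \<le> cos u"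
proof -
  have c: "1 / 2 \<le> cos x" if "0 \<le> x" "x \<le> 1" for x :: real
    using cos_monotone_0_pi_le[of x "pi/3"] that pi_gt3 by (simp add: cos_60)
  show "1 / 2 \<le> cos u" using c assms by blast
  have "sin 0 - 0 / 2 \<le> sin u - u / 2"
  proof (rule DERIV_nonneg_imp_nondecreasing[OF assms(1)])
    fix x assume "0 \<le> x" "x \<le> u"
    then show "\<exists>y. ((\<lambda>x. sin x - x / 2) has_real_derivative y) (at x) \<and> 0 \<le> y"
      using c[of x] assms by (intro exI[of _ "cos x - 1/2"]) (auto intro!: derivative_eq_intros)
  qed
  then show "u / 2 \<le> sin u" by simp
qed

lemma inverse_mem_dini_region: "0 < Im z \<Longrightarrow> 1 / z \<in> dini_region k"
proof -
  assume "0 < Im z"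
  moreover have "Im (1 / z) = - (Im z / (cmod z)\<^sup>2)" by (simp add: Im_divide cmod_power2)
  ultimately have "Im (1 / z) < 0" by (auto intro!: divide_pos_pos)
  then have "Im (1 / z) < cmod (1 / z) / 2" using norm_ge_zero[of "1 / z"] by linarith
  then show ?thesis by (simp add: dini_region_def)
qed

text \<open>The factor exp (100 T) turns z towards the imaginary axis from either side, and by at
  least 4 \<theta>(|\<Phi> z|) when |Re z| \<ge> |z| / 2. On the axis T is real and nonnegative, so
  the axis is mapped into itself and the intermediate value theorem yields each height d.\<close>

lemma interior_model_map:
  assumes dini: "dini_modulus \<theta>" and r0: "0 < r0"
  obtains \<rho> \<Phi> where "0 < \<rho>" "\<Phi> holomorphic_on {z. 0 < Im z \<and> cmod z < 2 * \<rho>}"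
    "\<And>z. 0 < Im z \<Longrightarrow> cmod z < 2 * \<rho> \<Longrightarrow> cmod (\<Phi> z) < r0 \<and> \<theta> (cmod (\<Phi> z)) * cmod (\<Phi> z) < Im (\<Phi> z)"
    "\<And>t. 0 < t \<Longrightarrow> t < 2 * \<rho> \<Longrightarrow> \<exists>y. \<Phi> (\<i> * of_real t) = \<i> * of_real y \<and> t \<le> y \<and> y \<le> 2 * t"
    "\<And>d. 0 < d \<Longrightarrow> d \<le> \<rho> \<Longrightarrow> \<exists>t. d / 2 \<le> t \<and> t \<le> d \<and> \<Phi> (\<i> * of_real t) = \<i> * of_real d"
proof -
  \<comment> \<open>With this tail 100 |T| \<le> 3/10, so that \<open>exp (100 * Re (T z))\<close>
    lies between 1 and 2 and the angle of rotation is below 1.\<close>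
  obtain k where k: "dini_tail \<theta> k < 1 / 1000" using dini_tail_small[OF dini, of "1/1000"] by auto
  obtain \<delta> where \<delta>: "0 < \<delta>" "\<And>x. 0 \<le> x \<Longrightarrow> x \<le> \<delta> \<Longrightarrow> \<theta> x < 1 / 8"
    using dini_modulus_small[OF dini, of "1/8"] by auto
  \<comment> \<open>The bound by 1 / 2^k puts V = 1 / z into the range of the lower bound in
    \<open>dini_series_Im\<close>; the other two leave room for |\<Phi> z| \<le> 2 |z|.\<close>
  define \<rho> where "\<rho> = min (1 / 2 ^ k / 2) (min (r0 / 4) (\<delta> / 4))"
  have \<rho>: "0 < \<rho>" "2 * \<rho> \<le> 1 / 2 ^ k" "4 * \<rho> \<le> r0" "4 * \<rho> \<le> \<delta>"
    using r0 \<delta> by (auto simp: \<rho>_def min_def)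
  define T where "T z = dini_series \<theta> k (1 / z)" for z
  define \<Phi> where "\<Phi> z = z * exp (100 * T z)" for z
  define S where "S = {z. 0 < Im z \<and> cmod z < 2 * \<rho>}"
  note Vr = inverse_mem_dini_region[of _ k]
  have T3: "cmod (T z) \<le> 3 / 1000" if "0 < Im z" for z
    using dini_series_le[OF dini Vr[OF that]] k unfolding T_def by linarith
  have Re0: "0 \<le> Re (T z)" if "0 < Im z" for z
    unfolding T_def using that
    by (intro dini_series_Re_nonneg[OF dini Vr]) (auto simp: Im_divide intro!: divide_nonpos_nonneg)
  have hol: "\<Phi> holomorphic_on S"
  proof -
    have "T holomorphic_on S" unfolding T_def
      by (rule holomorphic_on_compose_gen[OF _ dini_series_holomorphic[OF dini], unfolded o_def])
         (auto simp: S_def intro!: holomorphic_intros Vr)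
    then show ?thesis unfolding \<Phi>_def by (auto intro!: holomorphic_intros)
  qed
  have exp2: "1 \<le> exp (100 * Re (T z)) \<and> exp (100 * Re (T z)) \<le> 2" if "0 < Im z" for z
  proof -
    have "100 * Re (T z) \<le> 1 / 2" using T3[OF that] abs_Re_le_cmod[of "T z"] by linarith
    also have "1 / 2 \<le> ln (2::real)" using ln2_ge_two_thirds by simp
    finally show ?thesis using Re0[OF that] by (simp add: ln_ge_iff flip: exp_le_cancel_iff[of _ "ln 2"])
  qed
  have norm\<Phi>: "cmod (\<Phi> z) = exp (100 * Re (T z)) * cmod z" for z
    by (simp add: \<Phi>_def norm_mult mult.commute)
  have main: "cmod (\<Phi> z) < r0 \<and> \<theta> (cmod (\<Phi> z)) * cmod (\<Phi> z) < Im (\<Phi> z)" if y: "0 < Im z" and b: "cmod z < 2 * \<rho>" for z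
  proof -
    define R where "R = exp (100 * Re (T z))"
    define m where "m = 100 * Im (T z)"
    have z0: "cmod z > 0" using y by auto
    have R: "1 \<le> R" "R \<le> 2" using exp2[OF y] by (auto simp: R_def)
    have n: "cmod (\<Phi> z) = R * cmod z" by (simp add: norm\<Phi> R_def)
    have n2: "cmod (\<Phi> z) \<le> 2 * cmod z" unfolding n using R by (intro mult_right_mono) auto
    have \<theta>1: "\<theta> (cmod (\<Phi> z)) < 1 / 8" using n2 b \<rho> by (intro \<delta>(2)) auto
    have "cmod (\<Phi> z) \<le> 4 * cmod z" using n2 z0 by linarith
    then have \<theta>2: "\<theta> (cmod (\<Phi> z)) \<le> \<theta> (4 * cmod z)" by (intro dini_modulusD(1)[OF dini]) auto
    have \<theta>0: "0 \<le> \<theta> (cmod (\<Phi> z))" by (intro dini_modulusD(2)[OF dini]) auto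
    have m1: "\<bar>m\<bar> \<le> 1" using T3[OF y] abs_Im_le_cmod[of "T z"] by (simp add: m_def)
    obtain s where s: "0 \<le> s" "Im (T z) = Re (1 / z) * s"
      "2 ^ k \<le> cmod (1 / z) \<Longrightarrow> cmod (1 / z) / 2 \<le> \<bar>Re (1 / z)\<bar> \<Longrightarrow> \<theta> (4 / cmod (1 / z)) / 18 \<le> \<bar>Re (1 / z)\<bar> * s"
      using dini_series_Im[OF dini Vr[OF y]] unfolding T_def by blast
    have Rez: "Re (1 / z) = Re z / (cmod z)\<^sup>2" by (simp add: Re_divide cmod_power2)
    have sgn: "0 \<le> Re z * m"
    proof -
      have "Re z * m = (Re z)\<^sup>2 / (cmod z)\<^sup>2 * (100 * s)"
        by (simp add: m_def s(2) Rez power2_eq_square)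
      also have "0 \<le> \<dots>" using s(1) by simp
      finally show ?thesis .
    qed
    have sinm: "\<bar>Re z\<bar> * (\<bar>m\<bar> / 2) \<le> Re z * sin m"
    proof -
      have "\<bar>Re z\<bar> * (\<bar>m\<bar> / 2) \<le> \<bar>Re z\<bar> * sin \<bar>m\<bar>" using m1 by (intro mult_left_mono sin_ge_half) auto
      also have "\<bar>Re z\<bar> * sin \<bar>m\<bar> = Re z * sin m"
        using sgn by (cases "m = 0"; cases "Re z = 0") (auto simp: abs_if zero_le_mult_iff)
      finally show ?thesis .
    qed
    have cosm: "Im z / 2 \<le> Im z * cos m"
      using mult_left_mono[OF sin_ge_half(2)[of "\<bar>m\<bar>"], of "Im z"] m1 y by simp
    have Im\<Phi>: "Im (\<Phi> z) = R * (Im z * cos m + Re z * sin m)"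
      by (simp add: \<Phi>_def R_def m_def Im_exp Re_exp algebra_simps)
    have "\<theta> (cmod (\<Phi> z)) * cmod z < Im z * cos m + Re z * sin m"
    proof (cases "cmod z / 2 \<le> \<bar>Re z\<bar>")
      case True
      have V: "cmod (1 / z) = 1 / cmod z" by (simp add: norm_divide)
      have "cmod z < 1 / 2 ^ k" using b \<rho> by linarith
      then have "2 ^ k \<le> cmod (1 / z)" unfolding V using z0 by (simp add: field_simps)
      moreover have "cmod (1 / z) / 2 \<le> \<bar>Re (1 / z)\<bar>"
        unfolding V Rez abs_divide using True z0 by (simp add: field_simps power2_eq_square)
      ultimately have "\<theta> (4 / cmod (1 / z)) / 18 \<le> \<bar>Re (1 / z)\<bar> * s" by (rule s(3))
      \<comment> \<open>The origin of 100: it makes 100 / 18 \<ge> 4, and 4 pays for the two losses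
        in |Re z| \<ge> |z| / 2 and sin |m| \<ge> |m| / 2.\<close>
      then have "100 / 18 * \<theta> (4 * cmod z) \<le> \<bar>m\<bar>"
        using s(1) by (simp add: V m_def s(2) abs_mult mult_ac)
      then have "4 * \<theta> (cmod (\<Phi> z)) \<le> \<bar>m\<bar>" using \<theta>2 \<theta>0 by linarith
      then have "cmod z / 2 * (4 * \<theta> (cmod (\<Phi> z)) / 2) \<le> \<bar>Re z\<bar> * (\<bar>m\<bar> / 2)"
        using True \<theta>0 by (intro mult_mono) auto
      then have "\<theta> (cmod (\<Phi> z)) * cmod z \<le> \<bar>Re z\<bar> * (\<bar>m\<bar> / 2)" by (simp add: mult.commute)
      then show ?thesis using sinm cosm y by linarith
    next
      case False
      \<comment> \<open>Close to the imaginary axis Im z > |z| / 2, which beats \<theta> < 1/8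
        without help from the rotation.\<close>
      have "cmod z \<le> \<bar>Re z\<bar> + \<bar>Im z\<bar>" by (rule cmod_le)
      then have "cmod z / 4 \<le> Im z / 2" using False y by linarith
      moreover have "\<theta> (cmod (\<Phi> z)) * cmod z < 1 / 8 * cmod z" using \<theta>1 z0 by (intro mult_strict_right_mono)
      moreover have "0 \<le> \<bar>Re z\<bar> * (\<bar>m\<bar> / 2)" by simp
      ultimately show ?thesis using sinm cosm z0 by linarith
    qed
    then have "R * (\<theta> (cmod (\<Phi> z)) * cmod z) < R * (Im z * cos m + Re z * sin m)"
      using R by (intro mult_strict_left_mono) auto
    then have "\<theta> (cmod (\<Phi> z)) * cmod (\<Phi> z) < Im (\<Phi> z)" unfolding Im\<Phi> n by (simp add: mult_ac)
    moreover have "cmod (\<Phi> z) < r0" using n2 b \<rho> by linarith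
    ultimately show ?thesis by blast
  qed
  have axis: "\<Phi> (\<i> * of_real t) = \<i> * of_real (t * exp (100 * Re (T (\<i> * of_real t))))" if t: "0 < t" for t
  proof -
    have y: "0 < Im (\<i> * of_real t)" using t by simp
    have "Re (1 / (\<i> * of_real t)) = 0" by (simp add: Re_divide)
    then have "Im (T (\<i> * of_real t)) = 0"
      using dini_series_Im[OF dini Vr[OF y]] unfolding T_def by auto
    then have "T (\<i> * of_real t) = of_real (Re (T (\<i> * of_real t)))" by (simp add: complex_eq_iff)
    then have "exp (100 * T (\<i> * of_real t)) = of_real (exp (100 * Re (T (\<i> * of_real t))))"
      by (metis exp_of_real of_real_mult of_real_numeral)
    then show ?thesis by (simp add: \<Phi>_def)
  qed
  have axis2: "\<exists>y. \<Phi> (\<i> * of_real t) = \<i> * of_real y \<and> t \<le> y \<and> y \<le> 2 * t" if t: "0 < t" for t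
    using axis[OF t] exp2[of "\<i> * of_real t"] t
    by (intro exI[of _ "t * exp (100 * Re (T (\<i> * of_real t)))"]) auto
  have axis3: "\<exists>t. d / 2 \<le> t \<and> t \<le> d \<and> \<Phi> (\<i> * of_real t) = \<i> * of_real d" if d: "0 < d" "d \<le> \<rho>" for d
  proof -
    have "continuous_on {d/2..d} (\<lambda>t. Im (\<Phi> (\<i> * of_real t)))"
    proof (rule continuous_on_Im[OF continuous_on_compose2[OF holomorphic_on_imp_continuous_on[OF hol]]])
      show "continuous_on {d / 2..d} (\<lambda>t. \<i> * complex_of_real t)" by (intro continuous_intros)
      show "(\<lambda>t. \<i> * complex_of_real t) ` {d / 2..d} \<subseteq> S" using d \<rho> by (auto simp: S_def norm_mult)
    qed
    moreover have "Im (\<Phi> (\<i> * of_real (d / 2))) \<le> d" "d \<le> Im (\<Phi> (\<i> * of_real d))"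
      using axis2[of "d/2"] axis2[of d] d by auto
    ultimately obtain t where t: "d / 2 \<le> t" "t \<le> d" "Im (\<Phi> (\<i> * of_real t)) = d"
      using IVT'[of "\<lambda>t. Im (\<Phi> (\<i> * of_real t))" "d/2" d d] d by auto
    then show ?thesis using axis[of t] d by (intro exI[of _ t]) auto
  qed
  show ?thesis using that[OF \<rho>(1) hol[unfolded S_def] main axis2 axis3] by blast
qed

section \<open>Exterior model: from the complement of a Dini cone into a strip\<close>

lemma arctan_lower_bounds:
  shows "x < 0 \<Longrightarrow> x \<le> arctan x" "0 \<le> x \<Longrightarrow> x / (1 + x) \<le> arctan x"
proof -
  assume "x < 0"
  then have "arctan (- x) \<le> - x" by (intro arctan_le_self) auto
  then show "x \<le> arctan x" by (simp add: arctan_minus)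
next
  assume x: "0 \<le> x"
  have "arctan 0 - 0 / (1 + 0) \<le> arctan x - x / (1 + x)"
  proof (rule DERIV_nonneg_imp_nondecreasing[OF x])
    fix u assume u: "0 \<le> u" "u \<le> x"
    have "1 + u\<^sup>2 \<le> (1 + u)\<^sup>2" using u by (simp add: power2_eq_square algebra_simps)
    then have "0 \<le> 1 / (1 + u\<^sup>2) - 1 / (1 + u)\<^sup>2"
      using u by (simp add: frac_le add_pos_nonneg)
    moreover have "((\<lambda>x. arctan x - x / (1 + x)) has_real_derivative (1 / (1 + u\<^sup>2) - 1 / (1 + u)\<^sup>2)) (at u)"
      using u by (auto intro!: derivative_eq_intros simp: power2_eq_square field_simps)
    ultimately show "\<exists>y. ((\<lambda>x. arctan x - x / (1 + x)) has_real_derivative y) (at u) \<and> 0 \<le> y" by blast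
  qed
  then show "x / (1 + x) \<le> arctan x" by simp
qed

text \<open>This form of the argument remains valid when Re z changes sign, unlike the arctan of Im
  z / Re z; the points 1 + i \<kappa> V below may leave the right half-plane.\<close>

lemma Im_Ln_eq_arctan:
  assumes "Im z \<noteq> 0"
  shows "Im (Ln z) = sgn (Im z) * (pi / 2 - arctan (Re z / \<bar>Im z\<bar>))"
proof -
  have pos: "Im (Ln z) = pi / 2 - arctan (Re z / Im z)" if z: "0 < Im z" for z
  proof -
    define u where "u = - \<i> * z"
    have u: "Re u > 0" "Im u = - Re z" "Re u = Im z" "z = \<i> * u" "u \<noteq> 0" using z by (auto simp: u_def)
    have "Im (Ln z) = Im (Ln u) + pi / 2" using u(1) by (simp add: u(4) Ln_times_ii[OF u(5)])
    also have "Im (Ln u) = arctan (Im u / Re u)"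
      using arg_conv_arctan[OF u(1)] Arg_eq_Im_Ln[OF u(5)] by simp
    finally show ?thesis unfolding u(2,3) by (simp add: arctan_minus)
  qed
  show ?thesis
  proof (cases "0 < Im z")
    case True then show ?thesis using pos by simp
  next
    case False
    then have n: "Im z < 0" using assms by simp
    have "cnj (Ln z) = Ln (cnj z)" using n by (intro cnj_Ln) (auto simp: complex_nonpos_Reals_iff)
    then have "Im (cnj (Ln z)) = Im (Ln (cnj z))" by (rule arg_cong)
    then have "Im (Ln z) = - Im (Ln (cnj z))" by simp
    also have "Im (Ln (cnj z)) = pi / 2 - arctan (Re z / - Im z)" using pos[of "cnj z"] n by simp
    finally show ?thesis using n by simp
  qed
qed

text \<open>Here Z = 1 + i \<kappa> V with a = |Re V| and b = Im V, the absolute argument of Z is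
  pi/2 minus this arctan, and t is the rotation supplied by the series. For b \<le> 0 the arctan
  alone is at least 1 / (\<kappa> a + 1); a positive b costs at most b / a, and t covers
  that.\<close>

lemma strip_model_arctan:
  fixes a b \<kappa> t :: real
  assumes a: "0 < a" and \<kappa>: "0 < \<kappa>" "\<kappa> \<le> 1" and t: "0 \<le> t" "b \<le> a * t" and v: "a \<le> v" "1 \<le> v"
  shows "1 / (2 * v) \<le> arctan ((1 - \<kappa> * b) / (\<kappa> * a)) + t"
proof (cases "1 - \<kappa> * b < 0")
  case True
  then have "(1 - \<kappa> * b) / (\<kappa> * a) \<le> arctan ((1 - \<kappa> * b) / (\<kappa> * a))"
    using a \<kappa> by (intro arctan_lower_bounds(1)) (auto intro!: divide_neg_pos)
  moreover have "(1 - \<kappa> * b) / (\<kappa> * a) = 1 / (\<kappa> * a) - b / a"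
    using a \<kappa> by (simp add: field_simps)
  moreover have "b / a \<le> t" using a t by (simp add: divide_le_eq mult.commute)
  moreover have "\<kappa> * a \<le> 1 * v" using a v \<kappa> by (intro mult_mono) auto
  then have "1 / (2 * v) \<le> 1 / (\<kappa> * a)" using a \<kappa> v by (intro frac_le) auto
  ultimately show ?thesis by linarith
next
  case False
  define x where "x = (1 - \<kappa> * b) / (\<kappa> * a)"
  have ka: "0 < \<kappa> * a" using a \<kappa> by simp
  have x: "0 \<le> x" using False ka by (simp add: x_def)
  then have *: "x / (1 + x) \<le> arctan x" by (rule arctan_lower_bounds(2))
  have eq: "x / (1 + x) = (1 - \<kappa> * b) / (\<kappa> * a + (1 - \<kappa> * b))"
  proof -
    have "\<kappa> \<noteq> 0" "a \<noteq> 0" using a \<kappa>(1) by auto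
    then have "1 + x = (\<kappa> * a + (1 - \<kappa> * b)) / (\<kappa> * a)" by (simp add: x_def add_divide_distrib)
    then show ?thesis using ka by (auto simp: x_def)
  qed
  have kv: "\<kappa> * a + 1 \<le> 2 * v" using mult_mono[of \<kappa> 1 a v] a v \<kappa> by auto
  have inv: "1 / (2 * v) \<le> 1 / (\<kappa> * a + 1)" using ka kv by (intro frac_le) auto
  have "1 / (\<kappa> * a + 1) \<le> x / (1 + x) + t"
  proof (cases "b \<le> 0")
    case True
    then have "0 \<le> - (\<kappa> * b)" using \<kappa> by (simp add: mult_nonneg_nonpos)
    define y where "y = 1 - \<kappa> * b"
    have y: "1 \<le> y" using \<open>0 \<le> - (\<kappa> * b)\<close> by (simp add: y_def)
    then have "\<kappa> * a * 1 \<le> \<kappa> * a * y" using ka by (intro mult_left_mono) auto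
    then have "1 * (\<kappa> * a + y) \<le> y * (\<kappa> * a + 1)" by (simp add: algebra_simps)
    then have "1 / (\<kappa> * a + 1) \<le> x / (1 + x)" unfolding eq y_def[symmetric]
      using ka y by (simp add: divide_le_eq le_divide_eq)
    then show ?thesis using t by simp
  next
    case False'': False
    have kb: "0 \<le> \<kappa> * b" using False'' \<kappa> by simp
    have "(1 - \<kappa> * b) / (\<kappa> * a + 1) \<le> x / (1 + x)" unfolding eq using ka False kb by (intro divide_left_mono mult_pos_pos) auto
    moreover have "(1 - \<kappa> * b) / (\<kappa> * a + 1) = 1 / (\<kappa> * a + 1) - \<kappa> * b / (\<kappa> * a + 1)" by (rule diff_divide_distrib)
    moreover have "\<kappa> * b / (\<kappa> * a + 1) \<le> t"
    proof -
      have "\<kappa> * b \<le> \<kappa> * (a * t)" using t \<kappa> by (intro mult_left_mono) auto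
      also have "\<dots> \<le> t * (\<kappa> * a + 1)" using t by (simp add: algebra_simps)
      finally show ?thesis using ka by (simp add: divide_le_eq)
    qed
    ultimately show ?thesis by linarith
  qed
  then show ?thesis using * inv unfolding x_def by linarith
qed

text \<open>The margin 1 / (4 |V|) to the edges of the strip is what allows two such maps to be
  subtracted: it pays for the second one, which is at most \<epsilon> times its own small argument.
  Hence \<epsilon> is a parameter, to be chosen after \<Lambda>.\<close>

definition strip_model ::
  "real \<Rightarrow> real \<Rightarrow> (real \<Rightarrow> real) \<Rightarrow> (complex \<Rightarrow> complex) \<Rightarrow> real \<Rightarrow> complex set \<Rightarrow> bool" where
  "strip_model \<Lambda> \<epsilon> \<theta> E C W \<longleftrightarrow> E holomorphic_on W \<and>
    (\<forall>V. (\<Lambda> < cmod V \<longrightarrow> Im V \<le> \<theta> (1 / cmod V) * cmod V) \<longrightarrow> V \<in> W) \<and>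
    (\<forall>V. cmod V \<le> \<Lambda> \<longrightarrow> cmod (E V) \<le> \<epsilon> * cmod V) \<and>
    (\<forall>V. \<Lambda> < cmod V \<longrightarrow> Im V \<le> \<theta> (1 / cmod V) * cmod V \<longrightarrow> \<bar>Im (E V)\<bar> \<le> pi / 2 - 1 / (4 * cmod V)) \<and>
    (\<forall>V. \<Lambda> < cmod V \<longrightarrow> Im V \<le> \<theta> (1 / cmod V) * cmod V \<longrightarrow> Re (E V) \<le> C - ln (cmod V))"

text \<open>On the lower half-plane 1 + i \<kappa> V has positive real part, so - Ln (1 + i \<kappa>
  V) alone maps into the strip. Slightly above the real axis its argument may exceed pi/2, and the
  imaginary part of the series offsets the excess.\<close>

lemma strip_model_map:
  assumes dini: "dini_modulus \<theta>" and \<Lambda>: "1 \<le> \<Lambda>" and small: "\<And>x. 0 \<le> x \<Longrightarrow> x \<le> 1 / \<Lambda> \<Longrightarrow> \<theta> x < 1 / 4" and \<epsilon>: "0 < \<epsilon>"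
  obtains E C W where "strip_model \<Lambda> \<epsilon> \<theta> E C W"
proof -
  obtain k0 where k0: "\<And>k. k \<ge> k0 \<Longrightarrow> dini_tail \<theta> k < min (1 / 2000) (\<epsilon> / 200)"
    using dini_tail_small[OF dini, of "min (1 / 2000) (\<epsilon> / 200)"] \<epsilon> by auto
  obtain k1 where k1: "2 * \<Lambda> < 2 ^ k1" using real_arch_pow[of 2 "2 * \<Lambda>"] by auto
  define k where "k = max k0 k1"
  have "(2::real) ^ k1 \<le> 2 ^ k" by (simp add: k_def)
  then have k: "2 * \<Lambda> < 2 ^ k" using k1 by linarith
  have tail: "dini_tail \<theta> k < 1 / 2000" "dini_tail \<theta> k < \<epsilon> / 200" using k0[of k] by (auto simp: k_def)
  have tail0: "0 \<le> dini_tail \<theta> k" by (rule dini_tail_nonneg[OF dini])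
  \<comment> \<open>For |V| \<le> 2^k this gives \<kappa> |V| \<le> 1/4, so that Ln (1 + i \<kappa>
    V) is at most 2 \<kappa> |V|; the bound \<epsilon>/4 turns this into half of \<epsilon>
    |V|.\<close>
  define \<kappa> where "\<kappa> = min (\<epsilon> / 4) (1 / (4 * 2 ^ k))"
  have "(1::real) \<le> 2 ^ k" by simp
  then have "(1::real) \<le> 4 * 2 ^ k" by linarith
  then have "1 / (4 * 2 ^ k) \<le> (1::real)" by (simp add: divide_le_eq)
  then have "\<kappa> \<le> 1" unfolding \<kappa>_def by linarith
  then have \<kappa>: "0 < \<kappa>" "\<kappa> \<le> \<epsilon> / 4" "\<kappa> * 2 ^ k \<le> 1 / 4" "\<kappa> \<le> 1"
    using \<epsilon> by (auto simp: \<kappa>_def min_def field_simps)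
  define W where "W = dini_region k \<inter> {V. 1 + \<i> * of_real \<kappa> * V \<notin> \<real>\<^sub>\<le>\<^sub>0}"
  \<comment> \<open>36 is twice the 18 of \<open>dini_series_Im\<close>: the rotation is then at
    least 2 \<theta>(1 / |V|), and the 2 pays for |Re V| \<ge> |V| / 2.\<close>
  define E where "E V = 36 * dini_series \<theta> k V - Ln (1 + \<i> * of_real \<kappa> * V)" for V
  have small\<kappa>: "cmod (\<i> * of_real \<kappa> * V) < 1 / 2" if "cmod V \<le> 2 ^ k" for V
  proof -
    have "cmod (\<i> * of_real \<kappa> * V) = \<kappa> * cmod V" using \<kappa> by (simp add: norm_mult)
    also have "\<dots> \<le> \<kappa> * 2 ^ k" using that \<kappa> by (intro mult_left_mono) auto
    finally show ?thesis using \<kappa> by linarith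
  qed
  have E1: "cmod (E V) \<le> \<epsilon> * cmod V" if V: "cmod V \<le> \<Lambda>" for V
  proof -
    have "cmod (Ln (1 + \<i> * of_real \<kappa> * V)) \<le> 2 * cmod (\<i> * of_real \<kappa> * V)"
      using V k \<Lambda> by (intro norm_Ln_le small\<kappa>) auto
    also have "\<dots> = 2 * \<kappa> * cmod V" using \<kappa> by (simp add: norm_mult)
    also have "\<dots> \<le> \<epsilon> / 2 * cmod V" using \<kappa> by (intro mult_right_mono) auto
    finally have 1: "cmod (Ln (1 + \<i> * of_real \<kappa> * V)) \<le> \<epsilon> / 2 * cmod V" .
    have "36 * cmod (dini_series \<theta> k V) \<le> 36 * (2 * cmod V * dini_tail \<theta> k)"
      using dini_series_le_small[OF dini, of V k] V k by auto
    also have "\<dots> = (72 * dini_tail \<theta> k) * cmod V" by simp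
    also have "\<dots> \<le> \<epsilon> / 2 * cmod V" using tail \<epsilon> by (intro mult_right_mono) auto
    finally have 2: "cmod (36 * dini_series \<theta> k V) \<le> \<epsilon> / 2 * cmod V" by (simp add: norm_mult)
    have "cmod (E V) \<le> cmod (36 * dini_series \<theta> k V) + cmod (Ln (1 + \<i> * of_real \<kappa> * V))"
      unfolding E_def by (rule norm_triangle_ineq4)
    then show ?thesis using 1 2 by linarith
  qed
  have quarter: "Im V \<le> cmod V / 4 \<and> 0 < cmod V" if V: "\<Lambda> < cmod V" "Im V \<le> \<theta> (1 / cmod V) * cmod V" for V
  proof -
    have "\<theta> (1 / cmod V) < 1 / 4" using V \<Lambda> by (intro small) (auto simp: frac_le)
    then have "\<theta> (1 / cmod V) * cmod V \<le> 1 / 4 * cmod V" by (intro mult_right_mono) auto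
    then show ?thesis using V \<Lambda> by linarith
  qed
  have region: "V \<in> dini_region k" if "\<Lambda> < cmod V" "Im V \<le> \<theta> (1 / cmod V) * cmod V" for V
  proof -
    have "Im V < cmod V / 2" using quarter[OF that, THEN conjunct1] quarter[OF that, THEN conjunct2] by linarith
    then show ?thesis by (simp add: dini_region_def)
  qed
  have bigRe: "cmod V / 2 \<le> \<bar>Re V\<bar>" if "Im V \<le> cmod V / 4" "0 \<le> Im V" for V
    using that cmod_le[of V] by simp
  have "V \<in> W" if V: "\<Lambda> < cmod V \<Longrightarrow> Im V \<le> \<theta> (1 / cmod V) * cmod V" for V
  proof (cases "\<Lambda> < cmod V")
    case True
    have "1 + \<i> * of_real \<kappa> * V \<notin> \<real>\<^sub>\<le>\<^sub>0"
    proof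
      assume "1 + \<i> * of_real \<kappa> * V \<in> \<real>\<^sub>\<le>\<^sub>0"
      then have h: "1 - \<kappa> * Im V \<le> 0" "Re V = 0" using \<kappa> by (auto simp: complex_nonpos_Reals_iff)
      then have "0 < \<kappa> * Im V" by simp
      then have "0 < Im V" using \<kappa> by (simp add: zero_less_mult_iff)
      then show False using bigRe[of V] quarter[OF True V[OF True]] h by auto
    qed
    then show ?thesis using region[OF True V[OF True]] by (simp add: W_def)
  next
    case False
    then have c: "cmod V < 2 ^ k / 2" using k by linarith
    then have "cmod (\<i> * of_real \<kappa> * V) < 1 / 2" using norm_ge_zero[of V] by (intro small\<kappa>) linarith
    then have "\<bar>Re (\<i> * of_real \<kappa> * V)\<bar> < 1 / 2" using abs_Re_le_cmod order.strict_trans1 by blast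
    then have "1 + \<i> * of_real \<kappa> * V \<notin> \<real>\<^sub>\<le>\<^sub>0" by (auto simp: complex_nonpos_Reals_iff)
    then show ?thesis using c by (simp add: W_def dini_region_def)
  qed
  moreover have "E holomorphic_on W"
    unfolding E_def W_def
    by (intro holomorphic_intros holomorphic_on_subset[OF dini_series_holomorphic[OF dini]]) auto
  moreover have "\<bar>Im (E V)\<bar> \<le> pi / 2 - 1 / (4 * cmod V)" if V: "\<Lambda> < cmod V" "Im V \<le> \<theta> (1 / cmod V) * cmod V" for V
  proof -
    note reg = region[OF V]
    define v where "v = cmod V"
    have v1: "1 \<le> v" using V \<Lambda> by (simp add: v_def)
    have v4: "1 / (4 * v) \<le> 1 / 4" using v1 by (simp add: field_simps)
    define m where "m = 36 * Im (dini_series \<theta> k V)"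
    have m: "\<bar>m\<bar> \<le> 1 / 16"
      using dini_series_le[OF dini reg] tail abs_Im_le_cmod[of "dini_series \<theta> k V"] by (simp add: m_def)
    have ImE: "Im (E V) = m - Im (Ln (1 + \<i> * of_real \<kappa> * V))" by (simp add: E_def m_def)
    show ?thesis
    proof (cases "cmod V \<le> 2 ^ k")
      case True
      have "cmod (Ln (1 + \<i> * of_real \<kappa> * V)) \<le> 2 * cmod (\<i> * of_real \<kappa> * V)"
        using True by (intro norm_Ln_le small\<kappa>)
      then have "\<bar>Im (Ln (1 + \<i> * of_real \<kappa> * V))\<bar> \<le> 1"
        using small\<kappa>[OF True] abs_Im_le_cmod[of "Ln (1 + \<i> * of_real \<kappa> * V)"] by linarith
      then show ?thesis using ImE m v4 pi_gt3 unfolding v_def by linarith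
    next
      case False
      obtain s where s: "0 \<le> s" "Im (dini_series \<theta> k V) = Re V * s"
        "2 ^ k \<le> cmod V \<Longrightarrow> cmod V / 2 \<le> \<bar>Re V\<bar> \<Longrightarrow> \<theta> (4 / cmod V) / 18 \<le> \<bar>Re V\<bar> * s"
        using dini_series_Im[OF dini reg] by blast
      show ?thesis
      proof (cases "Re V = 0")
        case True
        have "Im V < 0" using bigRe[of V] quarter[OF V] True by (cases "0 \<le> Im V") auto
        then have "\<kappa> * Im V < 0" using \<kappa> by (intro mult_pos_neg) auto
        then have "0 < 1 - \<kappa> * Im V" by linarith
        moreover have "1 + \<i> * of_real \<kappa> * V = of_real (1 - \<kappa> * Im V)" using True by (simp add: complex_eq_iff)
        ultimately have "Im (Ln (1 + \<i> * of_real \<kappa> * V)) = 0" by (metis Im_Ln_of_real)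
        then show ?thesis using ImE m v4 pi_gt3 unfolding v_def by linarith
      next
        case nz: False
        define a where "a = \<bar>Re V\<bar>"
        define x where "x = (1 - \<kappa> * Im V) / (\<kappa> * a)"
        have a: "0 < a" using nz by (simp add: a_def)
        have L: "Im (Ln (1 + \<i> * of_real \<kappa> * V)) = sgn (Re V) * (pi / 2 - arctan x)"
          using Im_Ln_eq_arctan[of "1 + \<i> * of_real \<kappa> * V"] nz \<kappa>
          by (simp add: x_def a_def sgn_mult abs_mult)
        \<comment> \<open>The rotation and the argument of 1 + i \<kappa> V both have the sign of Re
          V, so they work against each other in Im (E V).\<close>
        have mm: "m = sgn (Re V) * \<bar>m\<bar>"
          using s(1) nz by (cases "s = 0") (auto simp: m_def s(2) abs_mult sgn_if)
        have eq: "\<bar>Im (E V)\<bar> = \<bar>\<bar>m\<bar> - (pi / 2 - arctan x)\<bar>"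
          using ImE unfolding L by (subst (asm) mm) (use nz in \<open>auto simp: sgn_if split: if_splits\<close>)
        have tm: "Im V \<le> a * \<bar>m\<bar>"
        proof (cases "0 \<le> Im V")
          case True
          have big: "cmod V / 2 \<le> \<bar>Re V\<bar>" using bigRe quarter[OF V] True by blast
          have "\<theta> (4 / v) / 18 \<le> \<bar>Re V\<bar> * s" using s(3) big False by (simp add: v_def)
          then have "2 * \<theta> (4 / v) \<le> \<bar>m\<bar>" using s(1) by (simp add: m_def s(2) abs_mult mult_ac)
          moreover have "\<theta> (1 / v) \<le> \<theta> (4 / v)" using v1 by (intro dini_modulusD(1)[OF dini]) (auto simp: divide_right_mono)
          ultimately have t: "2 * \<theta> (1 / v) \<le> \<bar>m\<bar>" by linarith
          have "Im V \<le> \<theta> (1 / v) * v" using V by (simp add: v_def)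
          also have "\<dots> \<le> \<theta> (1 / v) * (2 * a)"
            using big v1 dini_modulusD(2)[OF dini, of "1 / v"] by (intro mult_left_mono) (auto simp: v_def a_def)
          also have "\<dots> = a * (2 * \<theta> (1 / v))" by simp
          also have "\<dots> \<le> a * \<bar>m\<bar>" using t a by (intro mult_left_mono) auto
          finally show ?thesis .
        next
          case False
          moreover have "0 \<le> a * \<bar>m\<bar>" using a by simp
          ultimately show ?thesis by linarith
        qed
        have "1 / (2 * v) \<le> arctan x + \<bar>m\<bar>"
          unfolding x_def using a \<kappa> tm v1 abs_Re_le_cmod[of V]
          by (intro strip_model_arctan) (auto simp: a_def v_def)
        moreover have "1 / (4 * v) \<le> 1 / (2 * v)" using v1 by (simp add: field_simps)
        moreover have "arctan x < pi / 2" by (rule arctan_ubound)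
        moreover have "- (pi / 2) < arctan x" by (rule arctan_lbound)
        ultimately have "\<bar>\<bar>m\<bar> - (pi / 2 - arctan x)\<bar> \<le> pi / 2 - 1 / (4 * v)"
          using m v4 pi_gt3 by linarith
        then show ?thesis unfolding eq v_def .
      qed
    qed
  qed
  moreover have "Re (E V) \<le> (1 - ln (\<kappa> / 2)) - ln (cmod V)" if V: "\<Lambda> < cmod V" "Im V \<le> \<theta> (1 / cmod V) * cmod V" for V
  proof -
    note reg = region[OF V]
    define Z where "Z = 1 + \<i> * of_real \<kappa> * V"
    have Z: "Re Z = 1 - \<kappa> * Im V" "Im Z = \<kappa> * Re V" by (auto simp: Z_def)
    have T: "36 * Re (dini_series \<theta> k V) \<le> 1"
      using dini_series_le[OF dini reg] tail abs_Re_le_cmod[of "dini_series \<theta> k V"] by linarith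
    have lower: "\<kappa> / 2 * cmod V \<le> cmod Z"
    proof (cases "cmod V / 2 \<le> \<bar>Re V\<bar>")
      case True
      then have "\<kappa> * (cmod V / 2) \<le> \<kappa> * \<bar>Re V\<bar>" using \<kappa> by (intro mult_left_mono) auto
      also have "\<dots> = \<bar>Im Z\<bar>" using \<kappa> by (simp add: Z abs_mult)
      finally show ?thesis using abs_Im_le_cmod[of Z] by simp
    next
      case False
      then have "Im V < 0" using bigRe[of V] quarter[OF V] by force
      then have "cmod V / 2 \<le> - Im V" using False cmod_le[of V] by linarith
      then have "\<kappa> * (cmod V / 2) \<le> \<kappa> * (- Im V)" using \<kappa> by (intro mult_left_mono) auto
      then show ?thesis using abs_Re_le_cmod[of Z] by (simp add: Z)
    qed
    have p: "0 < \<kappa> / 2 * cmod V" using V \<Lambda> \<kappa> by (intro mult_pos_pos) auto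
    then have "Z \<noteq> 0" using lower by auto
    then have "Re (Ln Z) = ln (cmod Z)" by (simp add: Re_Ln)
    moreover have "ln (\<kappa> / 2 * cmod V) \<le> ln (cmod Z)" using lower p by (subst ln_le_cancel_iff) auto
    moreover have "ln (\<kappa> / 2 * cmod V) = ln (\<kappa> / 2) + ln (cmod V)" using \<kappa> V \<Lambda> by (intro ln_mult_pos) auto
    ultimately show ?thesis using T by (simp add: E_def Z_def)
  qed
  ultimately have "strip_model \<Lambda> \<epsilon> \<theta> E (1 - ln (\<kappa> / 2)) W" unfolding strip_model_def using E1 by blast
  then show ?thesis by (rule that)
qed

section \<open>Dini-smooth arcs\<close>

lemma modulus_of_continuity_01:
  assumes g: "continuous_on {0..1} g"
  shows "0 \<le> t \<Longrightarrow> 0 \<le> modulus_of_continuity_01 g t"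
    and "0 \<le> t \<Longrightarrow> t \<le> t' \<Longrightarrow> modulus_of_continuity_01 g t \<le> modulus_of_continuity_01 g t'"
    and "s \<in> {0..1} \<Longrightarrow> u \<in> {0..1} \<Longrightarrow> \<bar>s - u\<bar> \<le> t \<Longrightarrow> dist (g s) (g u) \<le> modulus_of_continuity_01 g t"
proof -
  define X where "X t = {(s, u). s \<in> {0..1::real} \<and> u \<in> {0..1} \<and> \<bar>s - u\<bar> \<le> t}" for t
  define d where "d = (\<lambda>(s, u). dist (g s) (g u))"
  have \<omega>: "modulus_of_continuity_01 g t = Sup (d ` X t)" for t
    unfolding modulus_of_continuity_01_def X_def d_def ..
  have "bounded (g ` {0..1})" by (intro compact_imp_bounded compact_continuous_image g) auto
  then obtain B where "\<forall>x\<in>g ` {0..1}. norm x \<le> B" unfolding bounded_iff by blast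
  then have B: "\<And>s. s \<in> {0..1} \<Longrightarrow> norm (g s) \<le> B" by blast
  have bdd: "bdd_above (d ` X t)" for t
  proof (rule bdd_aboveI2)
    fix z assume "z \<in> X t"
    then obtain s u where "z = (s, u)" "s \<in> {0..1}" "u \<in> {0..1}" by (auto simp: X_def)
    then show "d z \<le> B + B"
      using B[of s] B[of u] norm_triangle_ineq4[of "g s" "g u"] by (simp add: d_def dist_norm)
  qed
  show 3: "dist (g s) (g u) \<le> modulus_of_continuity_01 g t"
    if "s \<in> {0..1}" "u \<in> {0..1}" "\<bar>s - u\<bar> \<le> t" for s u t
    unfolding \<omega> using that by (intro cSUP_upper2[OF bdd, of "(s, u)"]) (auto simp: X_def d_def)
  show 1: "0 \<le> modulus_of_continuity_01 g t" if "0 \<le> t" for t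
    using 3[of 0 0 t] that by simp
  show "modulus_of_continuity_01 g t \<le> modulus_of_continuity_01 g t'" if "0 \<le> t" "t \<le> t'" for t t'
    unfolding \<omega>
  proof (rule cSUP_subset_mono[OF _ bdd])
    have "(0, 0) \<in> X t" using that by (simp add: X_def)
    then show "X t \<noteq> {}" by blast
    show "X t \<subseteq> X t'" using that by (auto simp: X_def)
  qed auto
qed

text \<open>On the interval from 2^-(n+1) to 2^-n the integrand is at least \<omega>(2^-(n+1)) 2^n,
  and the interval has length 2^-(n+1): half of the n-th term is bounded by a piece of the integral.
  The minorants \<open>h n\<close> are step functions with disjoint supports.\<close>

lemma dyadic_summable:
  fixes \<omega> :: "real \<Rightarrow> real"
  assumes nonneg: "\<And>t. 0 \<le> t \<Longrightarrow> 0 \<le> \<omega> t" and mono: "\<And>s t. 0 \<le> s \<Longrightarrow> s \<le> t \<Longrightarrow> \<omega> s \<le> \<omega> t"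
    and fin: "(\<integral>\<^sup>+ t\<in>{0<..1}. ennreal (\<omega> t / t) \<partial>lborel) < \<infinity>"
  shows "summable (\<lambda>n. \<omega> (1 / 2 ^ (n + 1)))"
proof -
  define I where "I n = {1 / 2 ^ (n + 1) <.. 1 / (2::real) ^ n}" for n :: nat
  define h where "h n t = ennreal (\<omega> (1 / 2 ^ (n + 1)) * 2 ^ n) * indicator (I n) t" for n :: nat and t
  define f where "f t = ennreal (\<omega> t / t) * indicator {0<..1} t" for t
  have disj: "m = n" if "t \<in> I m" "t \<in> I n" for m n t
  proof -
    have "\<not> a < b" if "t \<in> I a" "t \<in> I b" for a b
    proof
      assume "a < b"
      then have "1 / (2::real) ^ b \<le> 1 / 2 ^ (a + 1)" by (intro divide_left_mono power_increasing) auto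
      then show False using that by (auto simp: I_def)
    qed
    then show ?thesis using that by (metis nat_neq_iff)
  qed
  have le: "h n t \<le> f t" if t: "t \<in> I n" for n t
  proof -
    have pos: "0 < 1 / (2::real) ^ (n + 1)" by simp
    then have t0: "0 < t" using t unfolding I_def by (auto intro: order.strict_trans)
    have "1 / (2::real) ^ n \<le> 1" by simp
    then have t1: "t \<le> 1" using t unfolding I_def by (auto simp del: divide_le_eq_1_pos)
    have "\<omega> (1 / 2 ^ (n + 1)) \<le> \<omega> t" using t by (intro mono) (auto simp: I_def)
    moreover have "(2::real) ^ n \<le> 1 / t" using t t0 by (simp add: I_def field_simps)
    ultimately have "\<omega> (1 / 2 ^ (n + 1)) * 2 ^ n \<le> \<omega> t * (1 / t)"
      using nonneg[of t] t0 by (intro mult_mono) auto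
    then show ?thesis using t t0 t1 by (simp add: h_def f_def ennreal_leI)
  qed
  have sum_le: "(\<Sum>n<N. h n t) \<le> f t" for N t
  proof (cases "\<exists>m<N. t \<in> I m")
    case True
    then obtain m where m: "m < N" "t \<in> I m" by blast
    have "(\<Sum>n<N. h n t) = (\<Sum>n<N. if n = m then h m t else 0)"
      using disj[OF m(2)] by (intro sum.cong) (auto simp: h_def indicator_def)
    also have "\<dots> = h m t" using m by simp
    finally show ?thesis using le[OF m(2)] by simp
  next
    case False
    then have "(\<Sum>n<N. h n t) = 0" by (intro sum.neutral) (auto simp: h_def indicator_def)
    then show ?thesis by simp
  qed
  have int_h: "(\<integral>\<^sup>+ t. h n t \<partial>lborel) = ennreal (\<omega> (1 / 2 ^ (n + 1)) / 2)" for n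
  proof -
    have "emeasure lborel (I n) = ennreal (1 / 2 ^ n - 1 / 2 ^ (n + 1))"
      unfolding I_def by (intro emeasure_lborel_Ioc divide_left_mono power_increasing) auto
    then have "(\<integral>\<^sup>+ t. h n t \<partial>lborel) = ennreal (\<omega> (1 / 2 ^ (n + 1)) * 2 ^ n) * ennreal (1 / 2 ^ n - 1 / 2 ^ (n + 1))"
      unfolding h_def by (subst nn_integral_cmult_indicator) (auto simp: I_def)
    also have "\<dots> = ennreal (\<omega> (1 / 2 ^ (n + 1)) * 2 ^ n * (1 / 2 ^ n - 1 / 2 ^ (n + 1)))"
      by (rule ennreal_mult'[symmetric]) (simp add: nonneg)
    also have "\<omega> (1 / 2 ^ (n + 1)) * 2 ^ n * (1 / 2 ^ n - 1 / 2 ^ (n + 1)) = \<omega> (1 / 2 ^ (n + 1)) / 2"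
      by (simp add: field_simps)
    finally show ?thesis .
  qed
  obtain B where B: "(\<integral>\<^sup>+ t. f t \<partial>lborel) = ennreal B" "0 \<le> B"
    using fin unfolding f_def
    by (cases "\<integral>\<^sup>+ t\<in>{0<..1}. ennreal (\<omega> t / t) \<partial>lborel") auto
  have "(\<Sum>n<N. \<omega> (1 / 2 ^ (n + 1)) / 2) \<le> B" for N
  proof -
    have "ennreal (\<Sum>n<N. \<omega> (1 / 2 ^ (n + 1)) / 2) = (\<Sum>n<N. \<integral>\<^sup>+ t. h n t \<partial>lborel)"
      unfolding int_h by (intro sum_ennreal[symmetric]) (simp add: nonneg)
    also have "\<dots> = (\<integral>\<^sup>+ t. (\<Sum>n<N. h n t) \<partial>lborel)"
      by (intro nn_integral_sum[symmetric]) (auto simp: h_def I_def)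
    also have "\<dots> \<le> (\<integral>\<^sup>+ t. f t \<partial>lborel)" by (intro nn_integral_mono sum_le)
    finally show ?thesis using B by simp
  qed
  then have "summable (\<lambda>n. \<omega> (1 / 2 ^ (n + 1)) / 2)"
    by (intro summableI_nonneg_bounded[where x = B]) (auto simp: nonneg)
  then show ?thesis by (simp add: summable_divide_iff)
qed

text \<open>A scale c < 2^k is reduced to the dyadic scale by monotonicity after an index shift by
  about k.\<close>

lemma dini_modulus_of_continuity:
  assumes g: "continuous_on {0..1} g"
    and fin: "(\<integral>\<^sup>+ t\<in>{0<..1}. ennreal (modulus_of_continuity_01 g t / t) \<partial>lborel) < \<infinity>"
  shows "dini_modulus (modulus_of_continuity_01 g)"
proof -
  let ?\<omega> = "modulus_of_continuity_01 g"
  note \<omega> = modulus_of_continuity_01(1,2)[OF g]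
  have s: "summable (\<lambda>n. ?\<omega> (1 / 2 ^ (n + 1)))" by (rule dyadic_summable[OF \<omega> fin])
  have "summable (\<lambda>n. ?\<omega> (c / 2 ^ n))" if c: "0 < c" for c
  proof -
    obtain k where k: "c < 2 ^ k" using real_arch_pow[of 2 c] by auto
    have "summable (\<lambda>n. ?\<omega> (c / 2 ^ (n + (k + 1))))"
    proof (rule summable_comparison_test'[OF s])
      fix n
      have "c / 2 ^ (n + (k + 1)) \<le> 1 / 2 ^ (n + 1)" using k c by (simp add: field_simps power_add)
      then show "norm (?\<omega> (c / 2 ^ (n + (k + 1)))) \<le> ?\<omega> (1 / 2 ^ (n + 1))"
        using c \<omega>(1)[of "c / 2 ^ (n + (k + 1))"] \<omega>(2)[of "c / 2 ^ (n + (k + 1))" "1 / 2 ^ (n + 1)"] by simp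
    qed
    then show ?thesis using summable_iff_shift by blast
  qed
  then show ?thesis using \<omega> by (auto simp: dini_modulus_def mono_on_def)
qed

section \<open>Almost straight boundary arcs with uniform tangent cones\<close>

lemma vector_derivative_bound:
  fixes f :: "real \<Rightarrow> 'a::real_normed_vector"
  assumes "convex S" "\<And>x. x \<in> S \<Longrightarrow> (f has_vector_derivative f' x) (at x within S)"
    "\<And>x. x \<in> S \<Longrightarrow> norm (f' x) \<le> B" "x \<in> S" "y \<in> S"
  shows "norm (f x - f y) \<le> B * \<bar>x - y\<bar>"
proof -
  have "norm (f x - f y) \<le> B * norm (x - y)"
  proof (rule differentiable_bound[where f' = "\<lambda>x h. h *\<^sub>R f' x"])
    show "(f has_derivative (\<lambda>h. h *\<^sub>R f' x)) (at x within S)" if "x \<in> S" for x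
      using assms(2)[OF that] by (simp add: has_vector_derivative_def)
    show "onorm (\<lambda>h. h *\<^sub>R f' x) \<le> B" if "x \<in> S" for x
      using assms(3)[OF that] by (intro onorm_le) (simp add: mult.commute[of B] mult_left_mono)
  qed (use assms in auto)
  then show ?thesis by simp
qed

text \<open>The difference of the arc and the identity is Lipschitz with constant 1/8. So the arc is
  a graph over the real axis, bi-Lipschitz to its parameter with absolute constants.\<close>

definition near_straight :: "real \<Rightarrow> (real \<Rightarrow> complex) \<Rightarrow> bool" where
  "near_straight h a \<longleftrightarrow> (\<forall>s\<in>{-h..h}. \<forall>t\<in>{-h..h}. cmod (a s - a t - of_real (s - t)) \<le> \<bar>s - t\<bar> / 8)"

text \<open>The cone is measured by the chord, not by the parameter, and \<theta> does not depend on
  t: one modulus serves every base point of the arc.\<close>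

definition arc_tangent :: "(real \<Rightarrow> real) \<Rightarrow> real \<Rightarrow> (real \<Rightarrow> complex) \<Rightarrow> real \<Rightarrow> complex \<Rightarrow> bool" where
  "arc_tangent \<theta> h a t \<tau> \<longleftrightarrow> cmod \<tau> = 1 \<and> 0 < Re \<tau> \<and>
     (\<exists>c>0. (a has_vector_derivative of_real c * \<tau>) (at t)) \<and>
     (\<forall>s\<in>{-h..h}. \<bar>Im ((a s - a t) / \<tau>)\<bar> \<le> \<theta> (cmod (a s - a t)) * cmod (a s - a t))"

text \<open>The curve is rotated by its direction u at p and rescaled to have derivative 1 at the
  parameter 0. By injectivity the part of the curve outside |s| < h / 2 is a compact set without p,
  so it does not meet a small ball; the parameters up to h keep nearest points away from the ends of
  the arc.\<close>

lemma dini_smooth_boundary_arc: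
  assumes p: "dini_smooth_boundary_point D p" and \<delta>: "0 < \<delta>"
  obtains u a h \<theta> r where "cmod u = 1" "0 < h" "h < \<delta>" "dini_modulus \<theta>" "0 < r"
    "a 0 = 0" "near_straight h a" "\<And>s. s \<in> {-h..h} \<Longrightarrow> p + u * a s \<in> frontier D"
    "\<And>x. x \<in> frontier D \<Longrightarrow> x \<in> ball p r \<Longrightarrow> \<exists>s. \<bar>s\<bar> < h / 2 \<and> x = p + u * a s"
    "\<And>t. t \<in> {-h..h} \<Longrightarrow> \<exists>\<tau>. arc_tangent \<theta> h a t \<tau>"
proof -
  obtain U \<gamma> where U: "open U" "p \<in> U" and \<gamma>: "dini_smooth_curve \<gamma>" "inj_on \<gamma> {0..1}"
    "p \<in> \<gamma> ` {0<..<1}" "frontier D \<inter> U = \<gamma> ` {0..1} \<inter> U"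
    using p unfolding dini_smooth_boundary_point_def by blast
  obtain t0 where t0: "0 < t0" "t0 < 1" "p = \<gamma> t0" using \<gamma>(3) by auto
  obtain g where g: "\<And>t. t\<in>{0..1} \<Longrightarrow> (\<gamma> has_vector_derivative g t) (at t within {0..1})"
     "continuous_on {0..1} g" "\<And>t. t\<in>{0..1} \<Longrightarrow> g t \<noteq> 0"
     "(\<integral>\<^sup>+ t\<in>{0<..1}. ennreal (modulus_of_continuity_01 g t / t) \<partial>lborel) < \<infinity>"
    using \<gamma>(1) unfolding dini_smooth_curve_def by blast
  let ?\<omega> = "modulus_of_continuity_01 g"
  have dini: "dini_modulus ?\<omega>" by (rule dini_modulus_of_continuity[OF g(2,4)])
  have cont\<gamma>: "continuous_on {0..1} \<gamma>"
    using g(1) has_vector_derivative_continuous continuous_on_eq_continuous_within by blast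
  define m where "m = cmod (g t0)"
  have m: "0 < m" using g(3)[of t0] t0 by (simp add: m_def)
  define u where "u = g t0 / of_real m"
  have u: "cmod u = 1" "u \<noteq> 0" using m by (auto simp: u_def norm_divide m_def)
  have t01: "t0 \<in> {0..1}" using t0 by simp
  obtain e1 where e1: "e1 > 0" "\<And>t. t \<in> {0..1} \<Longrightarrow> dist t t0 < e1 \<Longrightarrow> dist (g t) (g t0) < m / 8"
    using g(2) m t01 unfolding continuous_on_iff by (metis divide_pos_pos zero_less_numeral)
  obtain e2 where e2: "e2 > 0" "ball p e2 \<subseteq> U" using U openE by blast
  obtain e3 where e3: "e3 > 0" "\<And>t. t \<in> {0..1} \<Longrightarrow> dist t t0 < e3 \<Longrightarrow> dist (\<gamma> t) (\<gamma> t0) < e2"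
    using cont\<gamma> e2(1) t01 unfolding continuous_on_iff by metis
  define e where "e = min (min e1 e3) (min t0 (1 - t0))"
  have e: "0 < e" "e \<le> e1" "e \<le> e3" "e \<le> t0" "e \<le> 1 - t0" using e1 e3 t0 by (auto simp: e_def)
  \<comment> \<open>For |s| \<le> h the derivative \<open>g\<close> is within m / 8 of its value at
    \<open>t0\<close>, the origin of the 1/8 in \<open>near_straight\<close>, and the curve stays in
    U.\<close>
  define h where "h = min (e * m) \<delta> / 2"
  have "0 < e * m" using e m by simp
  then have h: "0 < h" "h < \<delta>" "h < e * m" using \<delta> by (auto simp: h_def min_def)
  define T where "T x = t0 + x / m" for x
  have T: "T x \<in> {0<..<1}" "dist (T x) t0 < e" if "x \<in> {-h..h}" for x
  proof -
    have "\<bar>x\<bar> < e * m" using that h by auto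
    then have x: "\<bar>x / m\<bar> < e" using m by (simp add: abs_mult divide_less_eq)
    then show "dist (T x) t0 < e" by (simp add: T_def dist_real_def)
    have "- e < x / m" "x / m < e" using x by (simp_all only: abs_less_iff) linarith
    then show "T x \<in> {0<..<1}" using e unfolding T_def greaterThanLessThan_iff by linarith
  qed
  define a where "a x = (\<gamma> (T x) - p) / u" for x
  define g' where "g' x = g (T x) / g t0" for x
  have der: "(a has_vector_derivative g' x) (at x)" if x: "x \<in> {-h..h}" for x
  proof -
    have "(\<gamma> has_vector_derivative g (T x)) (at (T x))"
      using g(1)[of "T x"] T(1)[OF x] at_within_interior[of "T x" "{0..1}"] by (auto simp: less_imp_le)
    moreover have "(T has_vector_derivative (1 / m)) (at x)"
      unfolding T_def has_real_derivative_iff_has_vector_derivative[symmetric] using m by (auto intro!: derivative_eq_intros)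
    ultimately have "((\<gamma> \<circ> T) has_vector_derivative (1 / m) *\<^sub>R g (T x)) (at x)"
      by (intro vector_diff_chain_at)
    then have "((\<lambda>x. ((\<gamma> \<circ> T) x - p) / u) has_vector_derivative ((1 / m) *\<^sub>R g (T x) - 0) / u) (at x)"
      by (intro has_vector_derivative_divide has_vector_derivative_diff has_vector_derivative_const)
    moreover have "((1 / m) *\<^sub>R g (T x) - 0) / u = g' x"
      using m by (simp add: g'_def u_def scaleR_conv_of_real)
    ultimately show ?thesis unfolding a_def[abs_def] o_def by simp
  qed
  have g'1: "cmod (g' x - 1) \<le> 1 / 8" if x: "x \<in> {-h..h}" for x
  proof -
    have "dist (g (T x)) (g t0) < m / 8" using T[OF x] e by (intro e1(2)) auto
    moreover have "g' x - 1 = (g (T x) - g t0) / g t0" using g(3)[OF t01] by (simp add: g'_def diff_divide_distrib)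
    ultimately show ?thesis using m by (simp add: norm_divide dist_norm m_def[symmetric] divide_le_eq)
  qed
  have straight: "near_straight h a"
    unfolding near_straight_def
  proof (intro ballI)
    fix s t assume s: "s \<in> {-h..h}" and t: "t \<in> {-h..h}"
    have "cmod ((a s - of_real s) - (a t - of_real t)) \<le> 1 / 8 * \<bar>s - t\<bar>"
    proof (rule vector_derivative_bound[where S = "{-h..h}" and f' = "\<lambda>x. g' x - 1"])
      fix x assume x: "x \<in> {-h..h}"
      have "(of_real has_vector_derivative (1::complex)) (at x)"
        using has_vector_derivative_of_real[of "\<lambda>x. x" 1 "at x"] by simp
      then show "((\<lambda>x. a x - of_real x) has_vector_derivative g' x - 1) (at x within {-h..h})"
        by (rule has_vector_derivative_at_within[OF has_vector_derivative_diff[OF der[OF x]]])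
    qed (use s t g'1 in auto)
    then show "cmod (a s - a t - of_real (s - t)) \<le> \<bar>s - t\<bar> / 8" by (simp add: algebra_simps)
  qed
  \<comment> \<open>One 2 / m passes from the original parameter to the chord, by |s - t| \<le> 2 |a
    s - a t|, the other collects the same two factors in the mean value bound. The summand
    \<open>0 * x\<close> gives the shape of \<open>dini_modulus_combine\<close>.\<close>
  define \<theta> where "\<theta> x = 2 / m * ?\<omega> (2 / m * x) + 0 * x" for x
  have dini\<theta>: "dini_modulus \<theta>"
    unfolding \<theta>_def using m by (intro dini_modulus_combine[OF dini]) auto
  have tangent: "\<exists>\<tau>. arc_tangent \<theta> h a t \<tau>" if t: "t \<in> {-h..h}" for t
  proof -
    define c where "c = cmod (g' t)"
    have Re: "7 / 8 \<le> Re (g' t)"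
      using abs_Re_le_cmod[of "g' t - 1"] g'1[OF t] by simp
    then have c: "0 < c" by (auto simp: c_def)
    define \<tau> where "\<tau> = g' t / of_real c"
    have \<tau>3: "g' t = of_real c * \<tau>" using c by (simp add: \<tau>_def)
    have "cmod \<tau> = cmod (g' t) / c" using c by (simp add: \<tau>_def norm_divide)
    then have \<tau>1: "cmod \<tau> = 1" using c by (simp flip: c_def)
    have "Re \<tau> = Re (g' t) / c" by (simp add: \<tau>_def)
    then have \<tau>2: "0 < Re \<tau>" using c Re by simp
    note \<tau> = \<tau>1 \<tau>2 \<tau>3
    have "\<bar>Im ((a s - a t) / \<tau>)\<bar> \<le> \<theta> (cmod (a s - a t)) * cmod (a s - a t)" if s: "s \<in> {-h..h}" for s
    proof -
      define S where "S = {min s t..max s t}"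
      have S: "x \<in> {-h..h}" "\<bar>x - t\<bar> \<le> \<bar>s - t\<bar>" if "x \<in> S" for x
        using that s t by (auto simp: S_def min_def max_def split: if_splits)
      define B where "B = ?\<omega> (\<bar>s - t\<bar> / m) / m"
      \<comment> \<open>Mean value bound for the deviation of the arc from its tangent line at t;
        the derivative g' x - g' t is controlled by the modulus of continuity.\<close>
      have b: "cmod ((a s - of_real s * g' t) - (a t - of_real t * g' t)) \<le> B * \<bar>s - t\<bar>"
      proof (rule vector_derivative_bound[where S = S and f' = "\<lambda>x. g' x - g' t"])
        fix x assume x: "x \<in> S"
        have "((\<lambda>x. of_real x * g' t) has_vector_derivative (of_real 1 * g' t)) (at x)"
          by (intro has_vector_derivative_mult_left has_vector_derivative_of_real) auto
        then have "((\<lambda>x. of_real x * g' t) has_vector_derivative g' t) (at x)" by simp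
        then show "((\<lambda>x. a x - of_real x * g' t) has_vector_derivative g' x - g' t) (at x within S)"
          by (rule has_vector_derivative_at_within[OF has_vector_derivative_diff[OF der[OF S(1)[OF x]]]])
        have "dist (g (T x)) (g (T t)) \<le> ?\<omega> (\<bar>s - t\<bar> / m)"
        proof (rule modulus_of_continuity_01(3)[OF g(2)])
          show "T x \<in> {0..1}" "T t \<in> {0..1}" using T(1)[OF S(1)[OF x]] T(1)[OF t] by (auto simp: less_imp_le)
          have "T x - T t = (x - t) / m" by (simp add: T_def diff_divide_distrib)
          then show "\<bar>T x - T t\<bar> \<le> \<bar>s - t\<bar> / m" using S(2)[OF x] m by (simp add: divide_right_mono)
        qed
        moreover have "g' x - g' t = (g (T x) - g (T t)) / g t0" by (simp add: g'_def diff_divide_distrib)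
        ultimately show "cmod (g' x - g' t) \<le> B"
          using m by (simp add: norm_divide dist_norm m_def[symmetric] divide_right_mono B_def)
      qed (auto simp: S_def)
      define n where "n = cmod (a s - a t)"
      have "\<bar>s - t\<bar> - n \<le> cmod (a s - a t - of_real (s - t))"
        using norm_triangle_ineq2[of "of_real (s - t)" "a s - a t"] by (simp add: n_def norm_minus_commute flip: of_real_diff)
      also have "\<dots> \<le> \<bar>s - t\<bar> / 8" using straight s t unfolding near_straight_def by blast
      finally have "\<bar>s - t\<bar> - n \<le> \<bar>s - t\<bar> / 8" .
      moreover have "x \<le> 2 * y" if "x - y \<le> x / 8" "0 \<le> y" for x y :: real using that by (simp add: field_simps)
      moreover have "0 \<le> n" by (simp add: n_def)
      ultimately have st: "\<bar>s - t\<bar> \<le> 2 * n" by blast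
      have "Im ((a s - a t) / \<tau>) = Im ((a s - a t - of_real (s - t) * g' t) / \<tau>)"
      proof -
        have "of_real (s - t) * g' t / \<tau> = of_real ((s - t) * c)" using \<tau> by auto
        then show ?thesis unfolding diff_divide_distrib[of "a s - a t"] by (simp only: minus_complex.sel Im_complex_of_real diff_0_right)
      qed
      then have "\<bar>Im ((a s - a t) / \<tau>)\<bar> \<le> cmod (a s - a t - of_real (s - t) * g' t)"
        using abs_Im_le_cmod[of "(a s - a t - of_real (s - t) * g' t) / \<tau>"] \<tau>(1) by (simp add: norm_divide)
      also have "\<dots> \<le> B * \<bar>s - t\<bar>" using b by (simp add: algebra_simps)
      also have "\<dots> \<le> (?\<omega> (2 / m * n) / m) * (2 * n)"
      proof (intro mult_mono st)
        have "\<bar>s - t\<bar> / m \<le> 2 / m * n" using st m by (simp add: divide_right_mono)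
        then show "B \<le> ?\<omega> (2 / m * n) / m"
          unfolding B_def using m by (intro divide_right_mono dini_modulusD(1)[OF dini]) auto
        have "0 \<le> 2 / m * n" using m by (simp add: n_def)
        then show "0 \<le> ?\<omega> (2 / m * n) / m" using m dini_modulusD(2)[OF dini] by simp
      qed auto
      finally show ?thesis by (simp add: \<theta>_def n_def mult_ac)
    qed
    then show ?thesis using \<tau> der[OF t] c unfolding arc_tangent_def by (intro exI[of _ \<tau>]) auto
  qed
  have A: "p + u * a x = \<gamma> (T x)" for x using u by (simp add: a_def)
  have frontier: "p + u * a s \<in> frontier D" if s: "s \<in> {-h..h}" for s
  proof -
    have "dist (\<gamma> (T s)) (\<gamma> t0) < e2" using T[OF s] e by (intro e3(2)) (auto simp: less_imp_le)
    then have "\<gamma> (T s) \<in> U" using e2 t0 by (auto simp: dist_commute)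
    moreover have "\<gamma> (T s) \<in> \<gamma> ` {0..1}" using T(1)[OF s] by (auto simp: less_imp_le)
    ultimately show ?thesis using \<gamma>(4) A by auto
  qed
  define C where "C = \<gamma> ` ({0..1} - {T (- (h / 2)) <..< T (h / 2)})"
  have "compact C" unfolding C_def
    by (intro compact_continuous_image continuous_on_subset[OF cont\<gamma>] compact_diff) auto
  moreover have "p \<notin> C"
  proof
    assume "p \<in> C"
    then obtain t where t: "t \<in> {0..1}" "t \<notin> {T (- (h / 2)) <..< T (h / 2)}" "\<gamma> t0 = \<gamma> t" using t0 by (auto simp: C_def)
    then have "t0 = t" using \<gamma>(2) t01 by (auto dest: inj_onD)
    then show False using t h m by (auto simp: T_def)
  qed
  ultimately obtain r1 where r1: "0 < r1" "ball p r1 \<inter> C = {}"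
    using compact_imp_closed[of C] open_contains_ball[of "- C"] by (auto simp: open_Compl disjoint_eq_subset_Compl)
  have near: "\<exists>s. \<bar>s\<bar> < h / 2 \<and> x = p + u * a s" if x: "x \<in> frontier D" "x \<in> ball p (min r1 e2)" for x
  proof -
    have "x \<in> U" using x e2 by auto
    then obtain t where t: "t \<in> {0..1}" "x = \<gamma> t" using x \<gamma>(4) by blast
    have "x \<notin> C" using r1 x by auto
    then have "t \<in> {T (- (h / 2)) <..< T (h / 2)}" using t by (auto simp: C_def)
    then have "- (h / 2) / m < t - t0" "t - t0 < h / 2 / m" by (auto simp: T_def)
    then have "- (h / 2) < (t - t0) * m" "(t - t0) * m < h / 2"
      by (simp_all only: pos_less_divide_eq[OF m] pos_divide_less_eq[OF m])
    then have "\<bar>(t - t0) * m\<bar> < h / 2" by linarith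
    moreover have "T ((t - t0) * m) = t" using m by (simp add: T_def)
    ultimately show ?thesis using t by (intro exI[of _ "(t - t0) * m"]) (auto simp: A)
  qed
  show ?thesis
    by (rule that[of u h \<theta> "min r1 e2" a, OF u(1) h(1,2) dini\<theta> _ _ straight frontier near tangent])
       (use r1 e2 t0 in \<open>auto simp: a_def T_def\<close>)
qed

section \<open>The logarithm branched along an arc\<close>

lemma Ln_rotate:
  "0 < Re x \<Longrightarrow> Ln (\<i> * x) = Ln (- \<i> * x) + \<i> * of_real pi"
  "Re x < 0 \<Longrightarrow> Ln (\<i> * x) = Ln (- \<i> * x) - \<i> * of_real pi"
  using Ln_minus[of "- \<i> * x"] by (auto simp: complex_eq_iff)

lemma near_straight_Re_Im:
  assumes a: "near_straight h a" and st: "s \<in> {-h..h}" "t \<in> {-h..h}"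
  shows "7 / 8 * \<bar>s - t\<bar> \<le> \<bar>Re (a s - a t)\<bar>" "cmod (a s - a t) \<le> 9 / 8 * \<bar>s - t\<bar>"
    "s \<le> t \<Longrightarrow> 7 / 8 * (t - s) \<le> Re (a t) - Re (a s)"
proof -
  have n: "cmod (a s - a t - of_real (s - t)) \<le> \<bar>s - t\<bar> / 8" using a st unfolding near_straight_def by blast
  have "\<bar>Re (a s - a t - of_real (s - t))\<bar> \<le> \<bar>s - t\<bar> / 8" using n abs_Re_le_cmod order.trans by blast
  then have r: "\<bar>Re (a s) - Re (a t) - (s - t)\<bar> \<le> \<bar>s - t\<bar> / 8" by simp
  show "7 / 8 * \<bar>s - t\<bar> \<le> \<bar>Re (a s - a t)\<bar>" using r by (simp add: abs_if split: if_splits)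
  show "s \<le> t \<Longrightarrow> 7 / 8 * (t - s) \<le> Re (a t) - Re (a s)" using r by (simp add: abs_if split: if_splits)
  have "cmod (a s - a t) \<le> cmod (a s - a t - of_real (s - t)) + cmod (of_real (s - t) :: complex)"
    using norm_triangle_ineq[of "a s - a t - of_real (s - t)" "of_real (s - t)"] by simp
  also have "cmod (of_real (s - t) :: complex) = \<bar>s - t\<bar>" by (rule norm_of_real)
  finally have "cmod (a s - a t) \<le> cmod (a s - a t - of_real (s - t)) + \<bar>s - t\<bar>" .
  moreover have "x \<le> 9 / 8 * d" if "x \<le> y + d" "y \<le> d / 8" for x y d :: real using that by linarith
  ultimately show "cmod (a s - a t) \<le> 9 / 8 * \<bar>s - t\<bar>" using n by blast
qed

lemma near_straight_continuous:
  assumes a: "near_straight h a" shows "continuous_on {-h..h} a"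
proof (rule continuous_onI)
  fix x \<epsilon> :: real assume x: "x \<in> {-h..h}" and \<epsilon>: "0 < \<epsilon>"
  have "dist (a y) (a x) \<le> \<epsilon>" if "y \<in> {-h..h}" "dist y x < \<epsilon> / 2" for y
    using near_straight_Re_Im(2)[OF a that(1) x] that(2) \<epsilon> by (simp add: dist_norm)
  then show "\<exists>d>0. \<forall>x'\<in>{-h..h}. dist x' x < d \<longrightarrow> dist (a x') (a x) \<le> \<epsilon>"
    using \<epsilon> by (intro exI[of _ "\<epsilon> / 2"]) auto
qed

text \<open>A point whose vertical line misses the arc belongs to both this set and
  \<open>below_arc\<close>. This makes both sets open, and on the overlap the two branches of the
  logarithm agree.\<close>

definition above_arc :: "real \<Rightarrow> (real \<Rightarrow> complex) \<Rightarrow> complex set" where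
  "above_arc h a = {z. \<forall>s\<in>{-h..h}. Re (a s) = Re z \<longrightarrow> Im (a s) < Im z}"

definition below_arc :: "real \<Rightarrow> (real \<Rightarrow> complex) \<Rightarrow> complex set" where
  "below_arc h a = {z. \<forall>s\<in>{-h..h}. Re (a s) = Re z \<longrightarrow> Im z < Im (a s)}"

text \<open>The complement of each set is the sum of the compact arc and a closed vertical ray,
  hence closed.\<close>

lemma open_above_below_arc:
  assumes a: "near_straight h a"
  shows "open (above_arc h a)" "open (below_arc h a)"
proof -
  have "compact (a ` {-h..h})" by (intro compact_continuous_image near_straight_continuous[OF a]) auto
  note sums = compact_closed_sums[OF this]
  have shift: "closed {z. \<exists>s\<in>{-h..h}. z - a s \<in> T}" if "closed T" for T
  proof -
    have "z - x \<in> T \<longleftrightarrow> (\<exists>y\<in>T. z = x + y)" for z x by (metis add_diff_cancel_left' add_diff_eq)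
    then have "{z. \<exists>s\<in>{-h..h}. z - a s \<in> T} = (\<Union>x\<in>a ` {-h..h}. \<Union>y\<in>T. {x + y})" by auto
    then show ?thesis using sums[OF that] by simp
  qed
  have "- above_arc h a = {z. \<exists>s\<in>{-h..h}. z - a s \<in> {y. Re y = 0 \<and> Im y \<le> 0}}"
    "- below_arc h a = {z. \<exists>s\<in>{-h..h}. z - a s \<in> {y. Re y = 0 \<and> 0 \<le> Im y}}"
    unfolding above_arc_def below_arc_def set_eq_iff Compl_iff mem_Collect_eq
    by (simp_all add: not_less) metis+
  moreover have "closed {y. Re y = 0 \<and> Im y \<le> 0}" "closed {y. Re y = 0 \<and> 0 \<le> Im y}"
    by (auto intro!: closed_Collect_conj closed_Collect_eq closed_Collect_le continuous_intros)
  ultimately show "open (above_arc h a)" "open (below_arc h a)"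
    unfolding open_closed using shift by (simp_all only:)
qed

lemma above_below_arc_Un:
  assumes a: "near_straight h a"
  shows "above_arc h a \<union> below_arc h a = - (a ` {-h..h})"
proof (intro equalityI subsetI)
  fix z assume z: "z \<in> - (a ` {-h..h})"
  show "z \<in> above_arc h a \<union> below_arc h a"
  proof (rule ccontr)
    assume "z \<notin> above_arc h a \<union> below_arc h a"
    then obtain s t where s: "s \<in> {-h..h}" "Re (a s) = Re z" "Im z \<le> Im (a s)"
      and t: "t \<in> {-h..h}" "Re (a t) = Re z" "Im (a t) \<le> Im z"
      by (force simp: above_arc_def below_arc_def not_less)
    have "s = t" using near_straight_Re_Im(1)[OF a s(1) t(1)] s t by simp
    then have "z = a s" using s t by (simp add: complex_eq_iff)
    then show False using z s by blast
  qed
qed (auto simp: above_arc_def below_arc_def)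

lemma arc_Re_surj:
  assumes a: "near_straight h a" and h: "0 < h" and x: "Re (a (-h)) \<le> x" "x \<le> Re (a h)"
  shows "\<exists>s\<in>{-h..h}. Re (a s) = x"
  using IVT'[of "\<lambda>s. Re (a s)" "-h" x h] x h continuous_on_Re[OF near_straight_continuous[OF a]] by auto

text \<open>As functions of z these logarithms are cut along the rays that hang down from the two
  ends of the arc. They are therefore holomorphic across the arc near its inner points, on which the
  local estimates rely.\<close>

definition arc_log_above :: "real \<Rightarrow> (real \<Rightarrow> complex) \<Rightarrow> complex \<Rightarrow> complex" where
  "arc_log_above h a z = Ln (\<i> * (a h - z)) - Ln (\<i> * (a (-h) - z))"

definition arc_log_below :: "real \<Rightarrow> (real \<Rightarrow> complex) \<Rightarrow> complex \<Rightarrow> complex" where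
  "arc_log_below h a z = Ln (- \<i> * (a h - z)) - Ln (- \<i> * (a (-h) - z))"

text \<open>The branch of \<open>log ((z - a h) / (z - a (-h)))\<close> on the complement of the arc. A logarithm cut
  along an upward (downward) ray is holomorphic above (below) the arc, and the two differences of
  logarithms agree off the strip over the arc.\<close>

definition arc_log :: "real \<Rightarrow> (real \<Rightarrow> complex) \<Rightarrow> complex \<Rightarrow> complex" where
  "arc_log h a z = (if z \<in> above_arc h a then arc_log_above h a z else arc_log_below h a z)"

text \<open>Between the ends the two jumps of \<open>Ln_rotate\<close> have opposite signs, so their
  difference is 2 pi i, whereas outside the strip they cancel. This jump separates the two sides of
  the arc.\<close>

lemma arc_log_above_minus_below:
  assumes "Re z < Re (a h)" "Re (a (-h)) < Re z"
  shows "arc_log_above h a z = arc_log_below h a z + 2 * \<i> * of_real pi"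
  unfolding arc_log_above_def arc_log_below_def using assms
  by (subst Ln_rotate(1), simp, subst Ln_rotate(2), simp, simp add: algebra_simps)

context
  fixes h :: real and a :: "real \<Rightarrow> complex"
  assumes a: "near_straight h a" and h: "0 < h"
begin

lemma arc_ends: "Re (a (-h)) < Re (a h)"
  using near_straight_Re_Im(3)[OF a, of "-h" h] h by simp

lemma arc_log_eq_below:
  assumes "z \<in> below_arc h a" shows "arc_log h a z = arc_log_below h a z"
proof (cases "z \<in> above_arc h a")
  case True
  then have "\<not> (\<exists>s\<in>{-h..h}. Re (a s) = Re z)" using assms by (force simp: above_arc_def below_arc_def)
  then consider "Re z < Re (a (-h))" | "Re (a h) < Re z" using arc_Re_surj[OF a h, of "Re z"] by force
  then have "arc_log_above h a z = arc_log_below h a z"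
  proof cases
    case 1
    then show ?thesis unfolding arc_log_above_def arc_log_below_def using arc_ends
      by (subst Ln_rotate(1), simp, subst Ln_rotate(1), simp, simp)
  next
    case 2
    then show ?thesis unfolding arc_log_above_def arc_log_below_def using arc_ends
      by (subst Ln_rotate(2), simp, subst Ln_rotate(2), simp, simp)
  qed
  then show ?thesis by (simp add: arc_log_def)
qed (simp add: arc_log_def)

lemma Ln_mult_diff_deriv:
  assumes "c * (w - z) \<notin> \<real>\<^sub>\<le>\<^sub>0"
  shows "((\<lambda>z. Ln (c * (w - z))) has_field_derivative 1 / (z - w)) (at z)"
proof -
  have nz: "c \<noteq> 0" "w - z \<noteq> 0" using assms by auto
  have "((\<lambda>z. c * (w - z)) has_field_derivative - c) (at z)" by (auto intro!: derivative_eq_intros)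
  from DERIV_chain2[OF has_field_derivative_Ln[OF assms] this]
  have "((\<lambda>z. Ln (c * (w - z))) has_field_derivative inverse (c * (w - z)) * - c) (at z)" .
  moreover have "inverse (c * (w - z)) * - c = 1 / (z - w)" using nz by (simp add: divide_simps)
  ultimately show ?thesis by simp
qed

lemma arc_log_above_deriv:
  assumes "\<i> * (a h - z) \<notin> \<real>\<^sub>\<le>\<^sub>0" "\<i> * (a (-h) - z) \<notin> \<real>\<^sub>\<le>\<^sub>0"
  shows "(arc_log_above h a has_field_derivative (1 / (z - a h) - 1 / (z - a (-h)))) (at z)"
  unfolding arc_log_above_def[abs_def] by (intro DERIV_diff Ln_mult_diff_deriv assms)

lemma arc_log_deriv:
  assumes z: "z \<notin> a ` {-h..h}"
  shows "(arc_log h a has_field_derivative (1 / (z - a h) - 1 / (z - a (-h)))) (at z)"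
proof (cases "z \<in> above_arc h a")
  case True
  have "\<i> * (a s - z) \<notin> \<real>\<^sub>\<le>\<^sub>0" if "s \<in> {-h..h}" for s
    using True that by (force simp: above_arc_def complex_nonpos_Reals_iff)
  then have "(arc_log_above h a has_field_derivative (1 / (z - a h) - 1 / (z - a (-h)))) (at z)"
    using h by (intro arc_log_above_deriv) auto
  then show ?thesis
    by (rule has_field_derivative_transform_within_open[OF _ open_above_below_arc(1)[OF a] True])
       (simp add: arc_log_def)
next
  case False
  then have B: "z \<in> below_arc h a" using z above_below_arc_Un[OF a] by blast
  have "- \<i> * (a s - z) \<notin> \<real>\<^sub>\<le>\<^sub>0" if "s \<in> {-h..h}" for s
    using B that by (force simp: below_arc_def complex_nonpos_Reals_iff)
  then have "(arc_log_below h a has_field_derivative (1 / (z - a h) - 1 / (z - a (-h)))) (at z)"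
    unfolding arc_log_below_def[abs_def] using h by (intro DERIV_diff Ln_mult_diff_deriv) auto
  then show ?thesis
    by (rule has_field_derivative_transform_within_open[OF _ open_above_below_arc(2)[OF a] B])
       (simp add: arc_log_eq_below)
qed

lemma exp_arc_log:
  assumes z: "z \<noteq> a h" "z \<noteq> a (-h)"
  shows "exp (arc_log h a z) = (a h - z) / (a (-h) - z)" "exp (arc_log_above h a z) = (a h - z) / (a (-h) - z)"
proof -
  show 1: "exp (arc_log_above h a z) = (a h - z) / (a (-h) - z)"
    unfolding arc_log_above_def using z by (simp add: exp_diff)
  have "exp (arc_log_below h a z) = (- \<i> * (a h - z)) / (- \<i> * (a (-h) - z))"
    unfolding arc_log_below_def using z by (subst exp_diff) (simp del: mult_minus_left)
  then show "exp (arc_log h a z) = (a h - z) / (a (-h) - z)"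
    using 1 by (simp add: arc_log_def)
qed

text \<open>The arc point with the same real part as z lies in the cone at \<open>a t\<close>. The
  vertical step y from there to z changes the imaginary part by y Re \<tau>, which has the sign of y
  because Re \<tau> > 0. The factor 2 covers |a s - a t| \<le> (9/7) |z - a t|.\<close>

lemma above_below_cone:
  assumes \<theta>: "dini_modulus \<theta>" and t: "\<bar>t\<bar> \<le> h / 2" and \<tau>: "arc_tangent \<theta> h a t \<tau>" and z: "cmod (z - a t) \<le> h / 8"
  shows "z \<in> above_arc h a \<Longrightarrow> - (\<theta> (2 * cmod (z - a t)) * (2 * cmod (z - a t))) \<le> Im ((z - a t) / \<tau>)"
    and "z \<in> below_arc h a \<Longrightarrow> Im ((z - a t) / \<tau>) \<le> \<theta> (2 * cmod (z - a t)) * (2 * cmod (z - a t))"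
proof -
  have th: "t \<in> {-h..h}" using t h by auto
  have zt: "\<bar>Re z - Re (a t)\<bar> \<le> h / 8" using z abs_Re_le_cmod[of "z - a t"] by simp
  have "Re (a (-h)) \<le> Re z" using near_straight_Re_Im(3)[OF a _ th, of "-h"] t h zt by (simp, linarith)
  moreover have "Re z \<le> Re (a h)" using near_straight_Re_Im(3)[OF a th, of h] t h zt by (simp, linarith)
  ultimately obtain s where s: "s \<in> {-h..h}" "Re (a s) = Re z" using arc_Re_surj[OF a h] by blast
  define y where "y = Im z - Im (a s)"
  have zy: "z - a t = (a s - a t) + \<i> * of_real y" using s by (simp add: y_def complex_eq_iff)
  have \<tau>1: "cmod \<tau> = 1" "0 < Re \<tau>" "\<bar>Im ((a s - a t) / \<tau>)\<bar> \<le> \<theta> (cmod (a s - a t)) * cmod (a s - a t)"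
    using \<tau> s unfolding arc_tangent_def by auto
  have "Im (\<i> * of_real y / \<tau>) = y * Re \<tau> / (cmod \<tau>)\<^sup>2" by (simp add: Im_divide cmod_power2)
  then have Imy: "Im (\<i> * of_real y / \<tau>) = y * Re \<tau>" using \<tau>1(1) by simp
  have split: "Im ((z - a t) / \<tau>) = Im ((a s - a t) / \<tau>) + y * Re \<tau>"
    unfolding zy add_divide_distrib plus_complex.sel Imy ..
  have "7 / 8 * \<bar>s - t\<bar> \<le> cmod (z - a t)"
    using near_straight_Re_Im(1)[OF a s(1) th] s(2) abs_Re_le_cmod[of "z - a t"] by simp
  moreover have "x \<le> 2 * y" if "7 / 8 * d \<le> y" "x \<le> 9 / 8 * d" "0 \<le> d" for x y d :: real using that by linarith
  ultimately have n: "cmod (a s - a t) \<le> 2 * cmod (z - a t)" using near_straight_Re_Im(2)[OF a s(1) th] abs_ge_zero by blast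
  have "\<theta> (cmod (a s - a t)) * cmod (a s - a t) \<le> \<theta> (2 * cmod (z - a t)) * (2 * cmod (z - a t))"
    using n by (intro mult_mono dini_modulusD(1,2)[OF \<theta>]) auto
  then have b: "\<bar>Im ((a s - a t) / \<tau>)\<bar> \<le> \<theta> (2 * cmod (z - a t)) * (2 * cmod (z - a t))" using \<tau>1(3) by linarith
  show "- (\<theta> (2 * cmod (z - a t)) * (2 * cmod (z - a t))) \<le> Im ((z - a t) / \<tau>)" if "z \<in> above_arc h a"
  proof -
    have "0 < y" using that s by (auto simp: above_arc_def y_def)
    then have "0 < y * Re \<tau>" using \<tau>1 by simp
    then show ?thesis using split b by linarith
  qed
  show "Im ((z - a t) / \<tau>) \<le> \<theta> (2 * cmod (z - a t)) * (2 * cmod (z - a t))" if "z \<in> below_arc h a"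
  proof -
    have "y < 0" using that s by (auto simp: below_arc_def y_def)
    then have "y * Re \<tau> < 0" using \<tau>1 by (simp add: mult_neg_pos)
    then show ?thesis using split b by linarith
  qed
qed

end

lemma exp_close_one:
  fixes \<epsilon> :: real assumes "0 < \<epsilon>"
  shows "\<exists>c>0. \<forall>w. cmod w < c \<longrightarrow> cmod (exp w - 1) < \<epsilon>"
proof -
  have "isCont exp (0::complex)" by simp
  then show ?thesis using assms unfolding continuous_at_eps_delta by (auto simp: dist_norm)
qed

section \<open>Local behaviour of the branched logarithm at a point of the arc\<close>

context
  fixes h :: real and a :: "real \<Rightarrow> complex" and t :: real
  assumes a: "near_straight h a" and h: "0 < h" and t: "\<bar>t\<bar> \<le> h / 2"
begin

lemma arc_mem: "t \<in> {-h..h}" "h \<in> {-h..h}" "- h \<in> {-h..h}"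
  using t h by auto

text \<open>The restriction |t| \<le> h / 2 keeps \<open>a t\<close> at a distance comparable to h
  from both ends, where the logarithm is singular.\<close>

lemma arc_end_bounds:
  "7 / 16 * h \<le> Re (a h) - Re (a t)" "7 / 16 * h \<le> Re (a t) - Re (a (-h))"
  "7 / 16 * h \<le> cmod (a t - a h)" "7 / 16 * h \<le> cmod (a t - a (-h))"
  "cmod (a t - a h) \<le> 27 / 16 * h" "cmod (a t - a (-h)) \<le> 27 / 16 * h"
  "7 / 4 * h \<le> cmod (a h - a (-h))" "cmod (a h - a (-h)) \<le> 9 / 4 * h"
proof -
  have tt: "- (h / 2) \<le> t" "t \<le> h / 2" using t by auto
  have "7 / 8 * (h - t) \<le> Re (a h) - Re (a t)"
    using near_straight_Re_Im(3)[OF a arc_mem(1,2)] arc_mem(1) by simp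
  then show 1: "7 / 16 * h \<le> Re (a h) - Re (a t)" using tt by (simp add: field_simps)
  have "7 / 8 * (t - (- h)) \<le> Re (a t) - Re (a (-h))"
    using near_straight_Re_Im(3)[OF a arc_mem(3,1)] arc_mem(1) by simp
  then show 2: "7 / 16 * h \<le> Re (a t) - Re (a (-h))" using tt by (simp add: field_simps)
  have "Re (a h) - Re (a t) \<le> cmod (a h - a t)" using complex_Re_le_cmod[of "a h - a t"] by simp
  then show "7 / 16 * h \<le> cmod (a t - a h)" using 1 by (simp add: norm_minus_commute)
  have "Re (a t) - Re (a (-h)) \<le> cmod (a t - a (-h))" using complex_Re_le_cmod[of "a t - a (-h)"] by simp
  then show "7 / 16 * h \<le> cmod (a t - a (-h))" using 2 by simp
  have "\<bar>t - h\<bar> \<le> 3 / 2 * h" using tt by simp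
  then show "cmod (a t - a h) \<le> 27 / 16 * h"
    using near_straight_Re_Im(2)[OF a arc_mem(1,2)] by simp
  have "\<bar>t - (- h)\<bar> \<le> 3 / 2 * h" using tt by simp
  then show "cmod (a t - a (-h)) \<le> 27 / 16 * h"
    using near_straight_Re_Im(2)[OF a arc_mem(1,3)] by simp
  have "\<bar>h - - h\<bar> = 2 * h" using h by simp
  then show "cmod (a h - a (-h)) \<le> 9 / 4 * h"
    using near_straight_Re_Im(2)[OF a arc_mem(2,3)] by simp
  have "7 / 8 * (h - (- h)) \<le> Re (a h) - Re (a (-h))"
    using near_straight_Re_Im(3)[OF a arc_mem(3,2)] h by simp
  then show "7 / 4 * h \<le> cmod (a h - a (-h))"
    using complex_Re_le_cmod[of "a h - a (-h)"] by simp
qed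

text \<open>The derivative of \<open>arc_log_above\<close> at \<open>a t\<close>.\<close>

definition "arc_log_slope = 1 / (a t - a h) - 1 / (a t - a (-h))"

lemma arc_log_slope_eq: "arc_log_slope = (a h - a (-h)) / ((a t - a h) * (a t - a (-h)))"
proof -
  have "a t - a h \<noteq> 0" "a t - a (-h) \<noteq> 0" using arc_end_bounds(3,4) h by auto
  then show ?thesis unfolding arc_log_slope_def by (simp add: diff_frac_eq)
qed

lemma arc_log_slope_bounds: "1 / (2 * h) \<le> cmod arc_log_slope" "cmod arc_log_slope \<le> 12 / h"
proof -
  define x y z where "x = cmod (a t - a h)" and "y = cmod (a t - a (-h))" and "z = cmod (a h - a (-h))"
  have b: "7 / 16 * h \<le> x" "7 / 16 * h \<le> y" "x \<le> 27 / 16 * h" "y \<le> 27 / 16 * h" "7 / 4 * h \<le> z" "z \<le> 9 / 4 * h"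
    using arc_end_bounds by (auto simp: x_def y_def z_def)
  have eq: "cmod arc_log_slope = z / (x * y)"
    unfolding arc_log_slope_eq by (simp add: norm_divide norm_mult x_def y_def z_def)
  have p: "0 < x" "0 < y" using b h by auto
  have "x * y \<le> (27 / 16 * h) * (27 / 16 * h)" using b p by (intro mult_mono) auto
  also have "\<dots> \<le> 2 * h * (7 / 4 * h)" using h by (simp add: mult_mono)
  also have "\<dots> \<le> 2 * h * z" using b h by (intro mult_left_mono) auto
  finally show "1 / (2 * h) \<le> cmod arc_log_slope" unfolding eq using p h by (simp add: field_simps)
  have "z * h \<le> 9 / 4 * h * h" using b h by (intro mult_right_mono) auto
  also have "\<dots> \<le> 12 * ((7 / 16 * h) * (7 / 16 * h))" using h by simp
  also have "\<dots> \<le> 12 * (x * y)" using b h p by (intro mult_left_mono mult_mono) auto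
  finally show "cmod arc_log_slope \<le> 12 / h" unfolding eq using p h by (simp add: field_simps)
qed

text \<open>The arc passes through the disc around \<open>a t\<close>, but the cuts of
  \<open>arc_log_above\<close> do not. The error is estimated by the variation of the derivative on
  this disc, with 8 / h^2 for each end of the arc.\<close>

lemma arc_log_above_taylor:
  assumes z: "cmod (z - a t) \<le> h / 8"
  shows "cmod (arc_log_above h a z - arc_log_above h a (a t) - arc_log_slope * (z - a t)) \<le> 16 / h\<^sup>2 * (cmod (z - a t))\<^sup>2"
proof -
  define r where "r = cmod (z - a t)"
  define f where "f x = arc_log_above h a x - arc_log_slope * x" for x
  have "cmod (f z - f (a t)) \<le> (16 / h\<^sup>2 * r) * cmod (z - a t)"
  proof (rule field_differentiable_bound[where S = "cball (a t) r" and f' = "\<lambda>x. (1 / (x - a h) - 1 / (x - a (-h))) - arc_log_slope"])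
    fix x assume x: "x \<in> cball (a t) r"
    then have xr: "cmod (x - a t) \<le> r" by (simp add: dist_norm norm_minus_commute)
    have x8: "cmod (x - a t) \<le> h / 8" using xr z unfolding r_def by (rule order.trans)
    have "\<bar>Re x - Re (a t)\<bar> \<le> h / 8" using abs_Re_le_cmod[of "x - a t"] x8 by simp
    then have "Re x < Re (a h)" "Re (a (-h)) < Re x" using arc_end_bounds(1,2) h by linarith+
    then have "(arc_log_above h a has_field_derivative (1 / (x - a h) - 1 / (x - a (-h)))) (at x)"
      by (intro arc_log_above_deriv[OF a h]) (auto simp: complex_nonpos_Reals_iff)
    then show "(f has_field_derivative (1 / (x - a h) - 1 / (x - a (-h))) - arc_log_slope) (at x within cball (a t) r)"
      unfolding f_def[abs_def] by (intro has_field_derivative_at_within[OF DERIV_diff] DERIV_cmult_Id)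
    have d: "cmod (1 / (x - e) - 1 / (a t - e)) \<le> 8 / h\<^sup>2 * r" if e: "7 / 16 * h \<le> cmod (a t - e)" for e
    proof -
      have xe: "5 / 16 * h \<le> cmod (x - e)"
        using norm_triangle_ineq2[of "a t - e" "a t - x"] e x8 by (simp add: norm_minus_commute)
      have nz: "x - e \<noteq> 0" "a t - e \<noteq> 0" using e xe h by auto
      have "1 / (x - e) - 1 / (a t - e) = (a t - x) / ((x - e) * (a t - e))" using nz by (simp add: diff_frac_eq)
      then have "cmod (1 / (x - e) - 1 / (a t - e)) = cmod (x - a t) / (cmod (x - e) * cmod (a t - e))"
        by (simp add: norm_divide norm_mult norm_minus_commute)
      also have "\<dots> \<le> r / ((5 / 16 * h) * (7 / 16 * h))"
        using xr xe e h norm_ge_zero[of "x - a t"] by (intro frac_le mult_mono mult_pos_pos) (auto simp: r_def)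
      also have "\<dots> \<le> r / (h\<^sup>2 / 8)"
        using h by (intro divide_left_mono) (auto simp: r_def power2_eq_square)
      finally show ?thesis by (simp add: mult.commute)
    qed
    have "(1 / (x - a h) - 1 / (x - a (-h))) - arc_log_slope
      = (1 / (x - a h) - 1 / (a t - a h)) - (1 / (x - a (-h)) - 1 / (a t - a (-h)))"
      unfolding arc_log_slope_def by simp
    then have "cmod ((1 / (x - a h) - 1 / (x - a (-h))) - arc_log_slope) \<le> 8 / h\<^sup>2 * r + 8 / h\<^sup>2 * r"
      using norm_triangle_ineq4 add_mono[OF d[OF arc_end_bounds(3)] d[OF arc_end_bounds(4)]] by (metis order.trans)
    then show "cmod ((1 / (x - a h) - 1 / (x - a (-h))) - arc_log_slope) \<le> 16 / h\<^sup>2 * r" by simp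
  qed (auto simp: r_def dist_norm norm_minus_commute)
  moreover have "f z - f (a t) = arc_log_above h a z - arc_log_above h a (a t) - arc_log_slope * (z - a t)"
    by (simp add: f_def algebra_simps)
  ultimately show ?thesis by (simp add: r_def power2_eq_square)
qed

lemma arc_log_above_near:
  assumes z: "cmod (z - a t) \<le> h / 64"
  shows "cmod (z - a t) / (4 * h) \<le> cmod (arc_log_above h a z - arc_log_above h a (a t))"
    "cmod (arc_log_above h a z - arc_log_above h a (a t)) \<le> 1"
proof -
  define r where "r = cmod (z - a t)"
  define w where "w = arc_log_above h a z - arc_log_above h a (a t)"
  have r: "0 \<le> r" "r \<le> h / 64" using z by (auto simp: r_def)
  have "16 / h\<^sup>2 * r\<^sup>2 = (16 / h * (r / h)) * r" using h by (simp add: power2_eq_square)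
  also have "\<dots> \<le> (16 / h * (1 / 64)) * r" using r h by (intro mult_right_mono mult_left_mono) (auto simp: divide_le_eq)
  finally have q: "16 / h\<^sup>2 * r\<^sup>2 \<le> r / (4 * h)" by simp
  have T: "cmod (w - arc_log_slope * (z - a t)) \<le> r / (4 * h)"
    using order.trans[OF arc_log_above_taylor[of z] q[unfolded r_def]] z h by (simp add: w_def r_def)
  have "1 / (2 * h) * r \<le> cmod arc_log_slope * r" using arc_log_slope_bounds r by (intro mult_right_mono)
  then have "r / (2 * h) \<le> cmod (arc_log_slope * (z - a t))" by (simp add: norm_mult r_def)
  moreover have "r / (2 * h) = r / (4 * h) + r / (4 * h)" by simp
  ultimately show "cmod (z - a t) / (4 * h) \<le> cmod (arc_log_above h a z - arc_log_above h a (a t))"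
    using T norm_triangle_ineq2[of "arc_log_slope * (z - a t)" w] norm_minus_commute[of w "arc_log_slope * (z - a t)"]
    unfolding w_def[symmetric] r_def[symmetric] by linarith
  have "cmod (arc_log_slope * (z - a t)) \<le> 12 / h * r"
    unfolding norm_mult r_def[symmetric] using arc_log_slope_bounds r by (intro mult_right_mono)
  also have "\<dots> = 12 * (r / h)" by simp
  finally have 1: "cmod (arc_log_slope * (z - a t)) \<le> 12 * (r / h)" .
  have "r / h \<le> 1 / 64" using r h by (simp add: divide_le_eq)
  moreover have "r / (4 * h) = (r / h) / 4" by simp
  ultimately show "cmod (arc_log_above h a z - arc_log_above h a (a t)) \<le> 1"
    using 1 T norm_triangle_ineq2[of w "arc_log_slope * (z - a t)"] unfolding w_def[symmetric] by linarith
qed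

text \<open>If the value of the logarithm at z were close to the upper value at \<open>a t\<close>,
  so would be its exponential, a Moebius function of z. This forces z to be close to
  \<open>a t\<close>, hence to lie on the lower side, where the logarithm differs from the upper
  branch by 2 pi i.\<close>

lemma arc_log_far:
  assumes c: "\<And>w. cmod w < c \<Longrightarrow> cmod (exp w - 1) < 1 / 600" "c \<le> 1"
    and z: "z \<notin> a ` {-h..h}" "\<not> (z \<in> above_arc h a \<and> cmod (z - a t) \<le> h / 64)"
  shows "c \<le> cmod (arc_log h a z - arc_log_above h a (a t))"
proof (rule ccontr)
  define w where "w = arc_log h a z - arc_log_above h a (a t)"
  assume "\<not> c \<le> cmod (arc_log h a z - arc_log_above h a (a t))"
  then have wc: "cmod w < c" by (simp add: w_def)
  define r where "r = cmod (z - a t)"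
  define x y where "x = cmod (a t - a (-h))" and "y = cmod (a t - a h)"
  have b: "7 / 16 * h \<le> x" "x \<le> 27 / 16 * h" "7 / 16 * h \<le> y" "y \<le> 27 / 16 * h" "7 / 4 * h \<le> cmod (a h - a (-h))"
    using arc_end_bounds by (auto simp: x_def y_def)
  have ne: "z \<noteq> a h" "z \<noteq> a (-h)" "a t \<noteq> a h" "a t \<noteq> a (-h)" using z(1) h arc_end_bounds(3,4) by auto
  define X where "X = (a h - z) / (a (-h) - z)"
  define X0 where "X0 = (a h - a t) / (a (-h) - a t)"
  have "X = X0 * exp w"
    using exp_arc_log(1)[OF a h ne(1,2)] exp_arc_log(2)[OF a h ne(3,4)]
      ne by (simp add: w_def exp_diff X_def X0_def)
  then have XX: "X - X0 = X0 * (exp w - 1)" by (simp add: algebra_simps)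
  have "cmod X0 = y / x" by (simp add: X0_def norm_divide x_def y_def norm_minus_commute)
  also have "\<dots> \<le> 4" using b h by (simp add: divide_le_eq)
  finally have "cmod (X - X0) \<le> 4 * cmod (exp w - 1)" unfolding XX norm_mult by (intro mult_right_mono) auto
  then have small: "cmod (X - X0) < 4 / 600" using c(1)[OF wc] by simp
  have "X - X0 = (z - a t) * (a h - a (-h)) / ((a (-h) - z) * (a (-h) - a t))"
    using ne unfolding X_def X0_def by (subst diff_frac_eq) (auto simp: algebra_simps)
  then have eq: "cmod (X - X0) = r * cmod (a h - a (-h)) / (cmod (a (-h) - z) * x)"
    by (simp add: norm_divide norm_mult r_def x_def norm_minus_commute)
  have ez: "cmod (a (-h) - z) \<le> r + x"
    using norm_triangle_ineq[of "a (-h) - a t" "a t - z"] by (simp add: r_def x_def norm_minus_commute)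
  have ez0: "0 < cmod (a (-h) - z)" using ne by simp
  have r0: "0 \<le> r" by (simp add: r_def)
  have x0: "0 < x" using b h by linarith
  have "r * cmod (a h - a (-h)) < 4 / 600 * (cmod (a (-h) - z) * x)"
    using small ez0 x0 unfolding eq by (simp add: divide_less_eq)
  moreover have "r * (7 / 4 * h) \<le> r * cmod (a h - a (-h))" using b r0 by (intro mult_left_mono) auto
  moreover have "cmod (a (-h) - z) * x \<le> (r + 27 / 16 * h) * (27 / 16 * h)"
    using ez b r0 x0 by (intro mult_mono) auto
  ultimately have "r * (7 / 4 * h) < 4 / 600 * ((r + 27 / 16 * h) * (27 / 16 * h))" by linarith
  then have "(r * (7 / 4)) * h < (4 / 600 * ((r + 27 / 16 * h) * (27 / 16))) * h" by (simp add: mult_ac)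
  then have "r * (7 / 4) < 4 / 600 * ((r + 27 / 16 * h) * (27 / 16))" using h by (simp only: mult_less_cancel_right_pos)
  \<comment> \<open>The tolerance 1/600 is chosen to make this radius at most h / 64.\<close>
  then have near: "r \<le> h / 64" using h r0 by (simp add: field_simps)
  then have notabove: "z \<notin> above_arc h a" using z(2) by (simp add: r_def)
  have "\<bar>Re z - Re (a t)\<bar> \<le> h / 64" using abs_Re_le_cmod[of "z - a t"] near by (simp add: r_def)
  then have "Re z < Re (a h)" "Re (a (-h)) < Re z" using arc_end_bounds(1,2) h by linarith+
  then have "arc_log_above h a z = arc_log_below h a z + 2 * \<i> * of_real pi" by (rule arc_log_above_minus_below)
  then have "2 * \<i> * of_real pi = (arc_log_above h a z - arc_log_above h a (a t)) - w"
    using notabove by (simp add: w_def arc_log_def)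
  then have "cmod (2 * \<i> * of_real pi) \<le> 1 + cmod w"
    using norm_triangle_ineq4[of "arc_log_above h a z - arc_log_above h a (a t)" w]
      arc_log_above_near(2)[of z] near by (simp add: r_def)
  then show False using wc c(2) pi_gt3 by (simp add: norm_mult)
qed

end

section \<open>Maps with a pole at a boundary point\<close>

text \<open>\<open>V\<close> is a Moebius image of the branched logarithm, normalised to behave like \<open>\<tau> / (z - a t)\<close> on
  the upper side of the arc; on the lower side, where the logarithm differs by \<open>2 \<pi> \<i>\<close>, it is bounded.\<close>

definition arc_pole ::
  "real \<Rightarrow> real \<Rightarrow> (real \<Rightarrow> real) \<Rightarrow> (real \<Rightarrow> complex) \<Rightarrow> real \<Rightarrow> complex \<Rightarrow> complex \<Rightarrow> complex \<Rightarrow> (complex \<Rightarrow> complex) \<Rightarrow> bool" where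
  "arc_pole h C \<theta> a t \<tau> q q' V \<longleftrightarrow>
     V holomorphic_on - (a ` {-h..h}) \<and>
     (\<forall>z. z \<notin> a ` {-h..h} \<longrightarrow> cmod (V z) * cmod (z - a t) \<le> 1 + C * cmod (z - a t)) \<and>
     (\<forall>z. z \<notin> a ` {-h..h} \<longrightarrow> C < cmod (V z) \<longrightarrow>
        Im (V z) \<le> (4 * \<theta> (4 * (1 / cmod (V z))) + C * (1 / cmod (V z))) * cmod (V z)) \<and>
     (\<forall>z\<in>ball q h. cmod (V z) \<le> C * cmod (z - q')) \<and>
     (\<forall>d. 0 < d \<longrightarrow> d \<le> h / 64 \<longrightarrow> \<theta> (2 * d) < 1 / 2 \<longrightarrow> a t + \<i> * \<tau> * of_real d \<notin> a ` {-h..h} \<longrightarrow>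
        1 / d \<le> cmod (V (a t + \<i> * \<tau> * of_real d)) + C)"

text \<open>C is obtained from h alone, before the arc, the base point and the modulus, so it serves
  all nearest points. By the second-order Taylor bound V differs from its model by a bounded amount,
  which only adds a linear term to the modulus of the cone.\<close>

lemma arc_pole_map:
  assumes h: "0 < h"
  obtains C where "1 \<le> C"
    "\<And>a q q' t \<tau> \<theta>. near_straight h a \<Longrightarrow> a 0 = 0 \<Longrightarrow> dini_modulus \<theta> \<Longrightarrow> \<bar>t\<bar> \<le> h / 2 \<Longrightarrow> arc_tangent \<theta> h a t \<tau> \<Longrightarrow> 4 * h \<le> cmod q \<Longrightarrow> q' \<in> ball q h \<Longrightarrow>
      \<exists>V. arc_pole h C \<theta> a t \<tau> q q' V"
proof -
  obtain c' where c': "0 < c'" "\<And>w. cmod w < c' \<Longrightarrow> cmod (exp w - 1) < 1 / 600"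
    using exp_close_one[of "1/600"] by auto
  define c where "c = min c' 1"
  have c: "0 < c" "c \<le> 1" "\<And>w. cmod w < c \<Longrightarrow> cmod (exp w - 1) < 1 / 600" using c' by (auto simp: c_def)
  \<comment> \<open>100 dominates both 24, the bound for V away from the pole, and 76 = 64 + 12, the
    error near the pole.\<close>
  define C1 where "C1 = 100 / (h * c)"
  define C where "C = max 1 (max (2 * C1) (24 / (h * c)\<^sup>2))"
  have C1: "0 < C1" using h c by (simp add: C1_def)
  have C: "1 \<le> C" "2 * C1 \<le> C" "24 / (h * c)\<^sup>2 \<le> C" by (auto simp: C_def)
  have main: "\<exists>V. arc_pole h C \<theta> a t \<tau> q q' V"
    if a: "near_straight h a" and a0: "a 0 = 0" and \<theta>: "dini_modulus \<theta>" and t: "\<bar>t\<bar> \<le> h / 2" and \<tau>: "arc_tangent \<theta> h a t \<tau>" and q: "4 * h \<le> cmod q" and q': "q' \<in> ball q h"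
    for a q q' t \<tau> \<theta>
  proof -
    let ?A = "a ` {-h..h}"
    have A: "cmod (a s) \<le> 9 / 8 * h" if "s \<in> {-h..h}" for s
    proof -
      have "cmod (a s - a 0) \<le> 9 / 8 * \<bar>s - 0\<bar>" using h by (intro near_straight_Re_Im(2)[OF a that]) auto
      moreover have "\<bar>s\<bar> \<le> h" using that by auto
      ultimately show ?thesis by (simp add: a0)
    qed
    define L where "L = arc_log h a"
    define l where "l = arc_log_above h a (a t)"
    define \<mu> where "\<mu> = arc_log_slope h a t"
    define near where "near z \<longleftrightarrow> z \<in> above_arc h a \<and> cmod (z - a t) \<le> h / 64" for z
    \<comment> \<open>\<mu> cancels the slope of the logarithm at \<open>a t\<close>, and \<tau>
      rotates the tangent to the real axis. The constant subtracted in V places its zero at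
      q'.\<close>
    define K where "K = \<mu> * \<tau>"
    define V where "V z = K * (1 / (L z - l) - 1 / (L q' - l))" for z
    have th: "t \<in> {-h..h}" by (rule arc_mem[OF a h t])
    have \<tau>1: "cmod \<tau> = 1" using \<tau> by (simp add: arc_tangent_def)
    have \<mu>: "1 / (2 * h) \<le> cmod \<mu>" "cmod \<mu> \<le> 12 / h"
      unfolding \<mu>_def by (rule arc_log_slope_bounds[OF a h t])+
    have K: "cmod K \<le> 12 / h" using \<mu> \<tau>1 by (simp add: K_def norm_mult)
    have far: "c \<le> cmod (L z - l)" if "z \<notin> ?A" "\<not> near z" for z
      using arc_log_far[OF a h t c(3,2) that(1)] that(2) unfolding L_def l_def near_def by blast
    have nearL: "cmod (z - a t) / (4 * h) \<le> cmod (L z - l)" if "near z" for z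
      using arc_log_above_near(1)[OF a h t, of z] that unfolding near_def L_def l_def by (simp add: arc_log_def)
    have L0: "L z - l \<noteq> 0" if z: "z \<notin> ?A" for z
    proof (cases "near z")
      case True
      have "z \<noteq> a t" using z th by blast
      then have "0 < cmod (z - a t) / (4 * h)" using h by simp
      then show ?thesis using nearL[OF True] by auto
    next
      case False
      then show ?thesis using far[OF z False] c by auto
    qed
    have ballq: "z \<notin> ?A" "\<not> near z" "h \<le> cmod (z - a s)" if z: "z \<in> ball q h" and s: "s \<in> {-h..h}" for z s
    proof -
      have "cmod (q - z) < h" using z by (simp add: dist_norm)
      then have "3 * h < cmod z" using norm_triangle_ineq2[of q "q - z"] q by simp
      then have *: "h < cmod (z - a s)" if "s \<in> {-h..h}" for s
        using norm_triangle_ineq2[of z "a s"] A[OF that] h by linarith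
      show "h \<le> cmod (z - a s)" using *[OF s] by simp
      show "z \<notin> ?A" using * h by force
      show "\<not> near z" using *[OF th] h by (simp add: near_def)
    qed
    have Lder: "(L has_field_derivative (1 / (z - a h) - 1 / (z - a (-h)))) (at z)" if "z \<notin> ?A" for z
      unfolding L_def by (rule arc_log_deriv[OF a h that])
    have Lq': "c \<le> cmod (L q' - l)" using ballq[OF q' th] by (intro far)
    have inv_c: "1 / cmod x \<le> 1 / c" if "c \<le> cmod x" for x :: complex using that c by (intro frac_le) auto
    have Kq': "cmod (K * (1 / (L q' - l))) \<le> 12 / (h * c)"
    proof -
      have "cmod (K * (1 / (L q' - l))) \<le> (12 / h) * (1 / c)"
        unfolding norm_mult norm_divide norm_one using K inv_c[OF Lq'] h by (intro mult_mono) auto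
      then show ?thesis by simp
    qed
    have V_split: "V z = K * (1 / (L z - l)) - K * (1 / (L q' - l))" for z by (simp add: V_def right_diff_distrib)
    have V_far: "cmod (V z) \<le> C1" if "z \<notin> ?A" "\<not> near z" for z
    proof -
      have "cmod (K * (1 / (L z - l))) \<le> (12 / h) * (1 / c)"
        unfolding norm_mult norm_divide norm_one using K inv_c[OF far[OF that]] h by (intro mult_mono) auto
      also have "12 / h * (1 / c) = 12 / (h * c)" by simp
      finally have "cmod (K * (1 / (L z - l))) \<le> 12 / (h * c)" .
      then have "cmod (V z) \<le> 12 / (h * c) + 12 / (h * c)"
        using norm_triangle_ineq4[of "K * (1 / (L z - l))" "K * (1 / (L q' - l))"] Kq' unfolding V_split by linarith
      also have "\<dots> = 24 / (h * c)" by (simp add: add_divide_distrib[symmetric])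
      also have "\<dots> \<le> C1" unfolding C1_def using h c by (intro divide_right_mono) auto
      finally show ?thesis .
    qed
    have V_near: "cmod (V z - \<tau> / (z - a t)) \<le> C1" if z: "z \<notin> ?A" "near z" for z
    proof -
      define r where "r = cmod (z - a t)"
      define W where "W = L z - l"
      have W: "W \<noteq> 0" using L0[OF z(1)] by (simp add: W_def)
      have zt: "z - a t \<noteq> 0" using z th by force
      have r: "0 < r" using zt by (simp add: r_def)
      have Wr: "r / (4 * h) \<le> cmod W" using nearL[OF z(2)] by (simp add: W_def r_def)
      have \<mu>0: "\<mu> \<noteq> 0" using \<mu>(1) h by auto
      have T: "cmod (W - \<mu> * (z - a t)) \<le> 16 / h\<^sup>2 * r\<^sup>2"
        using arc_log_above_taylor[OF a h t, of z] z(2) h unfolding near_def W_def L_def l_def \<mu>_def r_def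
        by (simp add: arc_log_def)
      have "K * (1 / W) - \<tau> / (z - a t) = - \<tau> * ((W - \<mu> * (z - a t)) / (W * (z - a t)))"
        using W zt by (simp add: K_def field_simps)
      then have "cmod (K * (1 / W) - \<tau> / (z - a t)) = cmod (W - \<mu> * (z - a t)) / (cmod W * r)"
        using \<tau>1 by (simp add: norm_mult norm_divide r_def)
      also have "\<dots> \<le> (16 / h\<^sup>2 * r\<^sup>2) / (r / (4 * h) * r)"
        using T Wr r h by (intro frac_le mult_right_mono) auto
      also have "\<dots> = 64 / h" using r h by (simp add: power2_eq_square field_simps)
      also have "\<dots> \<le> 64 / (h * c)" using h c by (intro frac_le) auto
      finally have 1: "cmod (K * (1 / W) - \<tau> / (z - a t)) \<le> 64 / (h * c)" .
      have eq: "V z - \<tau> / (z - a t) = (K * (1 / W) - \<tau> / (z - a t)) - K * (1 / (L q' - l))"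
        by (simp add: V_split W_def)
      have "cmod (V z - \<tau> / (z - a t)) \<le> 64 / (h * c) + 12 / (h * c)"
        unfolding eq using norm_triangle_ineq4[of "K * (1 / W) - \<tau> / (z - a t)" "K * (1 / (L q' - l))"] 1 Kq' by linarith
      also have "\<dots> = 76 / (h * c)" by (simp add: add_divide_distrib[symmetric])
      also have "\<dots> \<le> C1" unfolding C1_def using h c by (intro divide_right_mono) auto
      finally show ?thesis .
    qed
    have "V holomorphic_on - ?A"
    proof -
      have "L holomorphic_on - ?A"
        unfolding holomorphic_on_def field_differentiable_def
        using Lder has_field_derivative_at_within by blast
      then show ?thesis unfolding V_def[abs_def] using L0 by (auto intro!: holomorphic_intros)
    qed
    moreover have "cmod (V z) * cmod (z - a t) \<le> 1 + C * cmod (z - a t)" if z: "z \<notin> ?A" for z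
    proof -
      have CC: "C1 * cmod (z - a t) \<le> C * cmod (z - a t)" using C C1 by (intro mult_right_mono) auto
      show ?thesis
      proof (cases "near z")
        case True
        have zt: "z - a t \<noteq> 0" using z th by force
        have "cmod (V z) \<le> 1 / cmod (z - a t) + C1"
          using norm_triangle_ineq2[of "V z" "\<tau> / (z - a t)"] V_near[OF z True] \<tau>1 by (simp add: norm_divide)
        then have "cmod (V z) * cmod (z - a t) \<le> (1 / cmod (z - a t) + C1) * cmod (z - a t)" by (intro mult_right_mono) auto
        also have "\<dots> = 1 + C1 * cmod (z - a t)" using zt by (simp add: distrib_right)
        finally show ?thesis using CC by linarith
      next
        case False
        have "cmod (V z) * cmod (z - a t) \<le> C1 * cmod (z - a t)" using V_far[OF z False] by (intro mult_right_mono) auto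
        then show ?thesis using CC by linarith
      qed
    qed
    moreover have "Im (V z) \<le> (4 * \<theta> (4 * (1 / cmod (V z))) + C * (1 / cmod (V z))) * cmod (V z)"
      if z: "z \<notin> ?A" and big: "C < cmod (V z)" for z
    proof -
      \<comment> \<open>V is large only on the upper side near \<open>a t\<close>, so the one-sided
        cone estimate is enough.\<close>
      have nz: "near z" using V_far[OF z] big C C1 by force
      define v where "v = cmod (V z)"
      define r where "r = cmod (z - a t)"
      have v: "0 < v" "2 * C1 < v" using big C by (auto simp: v_def)
      have r0: "0 < r" using z th by (force simp: r_def)
      have n: "cmod (\<tau> / (z - a t)) = 1 / r" using \<tau>1 by (simp add: norm_divide r_def)
      have lo: "v \<le> 2 / r"
        using norm_triangle_ineq2[of "V z" "\<tau> / (z - a t)"] V_near[OF z nz] v unfolding n v_def[symmetric] by simp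
      have up: "1 / r \<le> 2 * v"
        using norm_triangle_ineq3[of "V z" "\<tau> / (z - a t)"] V_near[OF z nz] v C1 unfolding n v_def[symmetric] by linarith
      have "r * v \<le> 2" using lo r0 by (simp add: field_simps)
      then have r2: "2 * r \<le> 4 * (1 / v)" using v by (simp add: field_simps)
      have Imt: "Im (\<tau> / (z - a t)) = - (Im ((z - a t) / \<tau>) / r\<^sup>2)"
      proof -
        have "\<tau> / (z - a t) = inverse ((z - a t) / \<tau>)" by (simp add: field_simps)
        moreover have "Im (inverse u) = - (Im u / (cmod u)\<^sup>2)" for u by (simp add: cmod_power2)
        moreover have "cmod ((z - a t) / \<tau>) = r" using \<tau>1 by (simp add: r_def norm_divide)
        ultimately show ?thesis by (simp only:)
      qed
      have "- (\<theta> (2 * r) * (2 * r)) \<le> Im ((z - a t) / \<tau>)"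
        unfolding r_def using nz h by (intro above_below_cone(1)[OF a h \<theta> t \<tau>]) (auto simp: near_def)
      then have "- Im ((z - a t) / \<tau>) / r\<^sup>2 \<le> (\<theta> (2 * r) * (2 * r)) / r\<^sup>2" by (intro divide_right_mono) auto
      also have "\<dots> = 2 * \<theta> (2 * r) * (1 / r)" using r0 by (simp add: power2_eq_square)
      also have "\<dots> \<le> 2 * \<theta> (4 * (1 / v)) * (2 * v)"
        using dini_modulusD(1)[OF \<theta> _ r2] dini_modulusD(2)[OF \<theta>, of "4 * (1 / v)"] dini_modulusD(2)[OF \<theta>, of "2 * r"] r0 v up
        by (intro mult_mono) auto
      finally have I: "Im (\<tau> / (z - a t)) \<le> 4 * \<theta> (4 * (1 / v)) * v" unfolding Imt by simp
      have "Im (V z) = Im (\<tau> / (z - a t)) + Im (V z - \<tau> / (z - a t))" by simp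
      also have "\<dots> \<le> 4 * \<theta> (4 * (1 / v)) * v + C"
        using I V_near[OF z nz] abs_Im_le_cmod[of "V z - \<tau> / (z - a t)"] C C1 by linarith
      also have "\<dots> = (4 * \<theta> (4 * (1 / v)) + C * (1 / v)) * v" using v by (simp add: distrib_right)
      finally show ?thesis by (simp add: v_def)
    qed
    moreover have "cmod (V z) \<le> C * cmod (z - q')" if z: "z \<in> ball q h" for z
    proof -
      have "cmod (L q' - L z) \<le> 2 / h * cmod (q' - z)"
      proof (rule field_differentiable_bound[OF convex_ball _ _ q' z])
        fix x assume x: "x \<in> ball q h"
        show "(L has_field_derivative (1 / (x - a h) - 1 / (x - a (-h)))) (at x within ball q h)"
          using Lder[OF ballq(1)[OF x th]] has_field_derivative_at_within by blast
        have "cmod (1 / (x - a s)) \<le> 1 / h" if "s \<in> {-h..h}" for s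
          unfolding norm_divide norm_one using ballq(3)[OF x that] h by (intro frac_le) auto
        then have "cmod (1 / (x - a h)) \<le> 1 / h" "cmod (1 / (x - a (-h))) \<le> 1 / h" using h by auto
        then show "cmod (1 / (x - a h) - 1 / (x - a (-h))) \<le> 2 / h"
          using norm_triangle_ineq4[of "1 / (x - a h)" "1 / (x - a (-h))"] by simp
      qed
      then have lip: "cmod (L q' - L z) \<le> 2 / h * cmod (z - q')" by (simp only: norm_minus_commute[of q' z])
      have Lz: "c \<le> cmod (L z - l)" using ballq[OF z th] by (intro far)
      have "V z = K * ((L q' - L z) / ((L z - l) * (L q' - l)))"
        unfolding V_def using L0[OF ballq(1)[OF z th]] L0[OF ballq(1)[OF q' th]] by (subst diff_frac_eq) auto
      then have "cmod (V z) = cmod K * (cmod (L q' - L z) / (cmod (L z - l) * cmod (L q' - l)))"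
        by (simp add: norm_mult norm_divide)
      also have "\<dots> \<le> 12 / h * ((2 / h * cmod (z - q')) / (c * c))"
        using K lip Lz Lq' c h by (intro mult_mono frac_le) auto
      also have "\<dots> = 24 / (h * c)\<^sup>2 * cmod (z - q')" by (simp add: power2_eq_square)
      also have "\<dots> \<le> C * cmod (z - q')" using C by (intro mult_right_mono) auto
      finally show ?thesis .
    qed
    moreover have "1 / d \<le> cmod (V (a t + \<i> * \<tau> * of_real d)) + C"
      if d: "0 < d" "d \<le> h / 64" "\<theta> (2 * d) < 1 / 2" and w: "a t + \<i> * \<tau> * of_real d \<notin> ?A" for d
    proof -
      define z where "z = a t + \<i> * \<tau> * of_real d"
      have zt: "z - a t = \<i> * \<tau> * of_real d" by (simp add: z_def)
      have n: "cmod (z - a t) = d" using d \<tau>1 by (simp add: zt norm_mult)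
      have "(z - a t) / \<tau> = \<i> * of_real d" unfolding zt using \<tau>1 by auto
      then have Im: "Im ((z - a t) / \<tau>) = d" by simp
      \<comment> \<open>The point at height d on the normal is outside the cone, because \<theta>(2
        d) < 1/2.\<close>
      have "z \<notin> below_arc h a"
      proof
        assume "z \<in> below_arc h a"
        then have "d \<le> \<theta> (2 * d) * (2 * d)"
          using above_below_cone(2)[OF a h \<theta> t \<tau>, of z] n d h unfolding Im by simp
        moreover have "\<theta> (2 * d) * (2 * d) < 1 / 2 * (2 * d)" using d by (intro mult_strict_right_mono) auto
        ultimately show False by simp
      qed
      then have "z \<in> above_arc h a" using above_below_arc_Un[OF a] w unfolding z_def[symmetric] by blast
      then have "near z" using n d by (simp add: near_def)
      moreover have "z \<notin> ?A" using w by (simp add: z_def)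
      ultimately have "cmod (V z - \<tau> / (z - a t)) \<le> C1" using V_near by blast
      moreover have "cmod (\<tau> / (z - a t)) = 1 / d" using \<tau>1 n by (simp add: norm_divide)
      ultimately show ?thesis
        using norm_triangle_ineq3[of "V z" "\<tau> / (z - a t)"] C C1 unfolding z_def[symmetric] by linarith
    qed
    ultimately show ?thesis unfolding arc_pole_def by (intro exI[of _ V]) blast
  qed
  show ?thesis by (rule that[OF C(1)]) (rule main)
qed

section \<open>Charts at Dini-smooth boundary points\<close>

text \<open>A rotation by pi together with reversal of the parameter exchanges the sides of the arc
  and preserves its direction.\<close>

lemma near_straight_reverse:
  assumes "near_straight h a" shows "near_straight h (\<lambda>s. - a (- s))"
  unfolding near_straight_def
proof (intro ballI)
  fix s t assume "s \<in> {-h..h}" "t \<in> {-h..h}"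
  then have "- s \<in> {-h..h}" "- t \<in> {-h..h}" by auto
  then have "cmod (a (- s) - a (- t) - of_real (- s - - t)) \<le> \<bar>- s - - t\<bar> / 8"
    using assms unfolding near_straight_def by blast
  moreover have "- a (- s) - - a (- t) - of_real (s - t) = - (a (- s) - a (- t) - of_real (- s - - t))" by simp
  moreover have "\<bar>- s - - t\<bar> = \<bar>s - t\<bar>" by simp
  ultimately show "cmod (- a (- s) - - a (- t) - of_real (s - t)) \<le> \<bar>s - t\<bar> / 8" by (simp only: norm_minus_cancel)
qed

lemma arc_tangent_reverse:
  assumes "arc_tangent \<theta> h a t \<tau>" shows "arc_tangent \<theta> h (\<lambda>s. - a (- s)) (- t) \<tau>"
proof -
  obtain c where c: "0 < c" "(a has_vector_derivative of_real c * \<tau>) (at t)"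
    using assms unfolding arc_tangent_def by blast
  have "(uminus has_vector_derivative (-1)) (at (- t))"
    using has_vector_derivative_minus[OF has_vector_derivative_id] by simp
  moreover have "(a has_vector_derivative of_real c * \<tau>) (at (- (- t)))" using c by simp
  ultimately have "((a \<circ> uminus) has_vector_derivative (-1) *\<^sub>R (of_real c * \<tau>)) (at (- t))"
    by (rule vector_diff_chain_at)
  from has_vector_derivative_minus[OF this]
  have "((\<lambda>s. - a (- s)) has_vector_derivative of_real c * \<tau>) (at (- t))" by (simp add: o_def)
  moreover have "\<bar>Im ((- a (- s) - - a (- (- t))) / \<tau>)\<bar>
      \<le> \<theta> (cmod (- a (- s) - - a (- (- t)))) * cmod (- a (- s) - - a (- (- t)))" if "s \<in> {-h..h}" for s
  proof -
    have "- s \<in> {-h..h}" using that by auto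
    then have "\<bar>Im ((a (- s) - a t) / \<tau>)\<bar> \<le> \<theta> (cmod (a (- s) - a t)) * cmod (a (- s) - a t)"
      using assms unfolding arc_tangent_def by blast
    moreover have "- a (- s) - - a (- (- t)) = - (a (- s) - a t)" by simp
    ultimately show ?thesis by (simp only: norm_minus_cancel minus_divide_left[symmetric] uminus_complex.sel abs_minus_cancel)
  qed
  ultimately show ?thesis using assms c(1) unfolding arc_tangent_def by blast
qed

text \<open>The squared distance to \<omega> has a local minimum at t, so \<omega> - a t is
  orthogonal to the tangent. The two alternatives are the two sides of the arc.\<close>

lemma arc_nearest_point_normal:
  assumes \<tau>: "arc_tangent \<theta> h a t \<tau>" and t: "\<bar>t\<bar> < h"
    and min: "\<And>s. s \<in> {-h..h} \<Longrightarrow> cmod (a t - \<omega>) \<le> cmod (a s - \<omega>)"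
  shows "\<omega> = a t + \<i> * \<tau> * of_real (cmod (a t - \<omega>)) \<or> \<omega> = a t - \<i> * \<tau> * of_real (cmod (a t - \<omega>))"
proof -
  obtain c where c: "0 < c" "(a has_vector_derivative of_real c * \<tau>) (at t)" and \<tau>1: "cmod \<tau> = 1"
    using \<tau> unfolding arc_tangent_def by blast
  define d where "d = cmod (a t - \<omega>)"
  define v where "v = of_real c * \<tau>"
  have der: "((\<lambda>s. (cmod (a s - \<omega>))\<^sup>2) has_real_derivative 2 * ((a t - \<omega>) \<bullet> v)) (at t)"
  proof -
    have "((\<lambda>s. a s - \<omega>) has_derivative (\<lambda>x. x *\<^sub>R v)) (at t)"
      using c(2) unfolding has_vector_derivative_def v_def by (auto intro!: derivative_eq_intros)
    from has_derivative_inner[OF this this]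
    have "((\<lambda>s. (a s - \<omega>) \<bullet> (a s - \<omega>)) has_derivative (\<lambda>x. (a t - \<omega>) \<bullet> x *\<^sub>R v + x *\<^sub>R v \<bullet> (a t - \<omega>))) (at t)" .
    moreover have "(\<lambda>x. (a t - \<omega>) \<bullet> x *\<^sub>R v + x *\<^sub>R v \<bullet> (a t - \<omega>)) = (*) (2 * ((a t - \<omega>) \<bullet> v))"
      by (auto simp: fun_eq_iff inner_commute)
    ultimately show ?thesis by (simp add: has_field_derivative_def power2_norm_eq_inner)
  qed
  have "2 * ((a t - \<omega>) \<bullet> v) = 0"
  proof (rule DERIV_local_min[OF der])
    show "0 < h - \<bar>t\<bar>" using t by simp
    show "\<forall>s. \<bar>t - s\<bar> < h - \<bar>t\<bar> \<longrightarrow> (cmod (a t - \<omega>))\<^sup>2 \<le> (cmod (a s - \<omega>))\<^sup>2"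
    proof (intro allI impI power_mono)
      fix s assume "\<bar>t - s\<bar> < h - \<bar>t\<bar>"
      then have "s \<in> {-h..h}" unfolding atLeastAtMost_iff by linarith
      then show "cmod (a t - \<omega>) \<le> cmod (a s - \<omega>)" by (rule min)
    qed auto
  qed
  moreover have "(a t - \<omega>) \<bullet> v = c * ((a t - \<omega>) \<bullet> \<tau>)" by (simp add: v_def flip: scaleR_conv_of_real)
  ultimately have "(a t - \<omega>) \<bullet> \<tau> = 0" using c(1) by simp
  then have "Re ((\<omega> - a t) / \<tau>) = 0"
    by (simp add: Re_divide inner_complex_def algebra_simps)
  moreover define x where "x = Im ((\<omega> - a t) / \<tau>)"
  ultimately have eq: "(\<omega> - a t) / \<tau> = \<i> * of_real x" by (simp add: complex_eq_iff)
  have "cmod ((\<omega> - a t) / \<tau>) = d" using \<tau>1 by (simp add: norm_divide d_def norm_minus_commute)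
  then have "\<bar>x\<bar> = d" unfolding eq by (simp add: norm_mult)
  then have x: "x = d \<or> x = - d" by (auto simp: abs_if split: if_splits)
  have "\<omega> = a t + \<tau> * ((\<omega> - a t) / \<tau>)" using \<tau>1 by auto
  then have "\<omega> = a t + \<i> * \<tau> * of_real x" unfolding eq by (simp add: mult_ac)
  then show ?thesis using x unfolding d_def[symmetric] by auto
qed

lemma boundary_dist_attained:
  assumes "frontier D \<noteq> {}"
  obtains p' where "p' \<in> frontier D" "boundary_dist D w = dist w p'"
  using infdist_attains_inf[OF frontier_closed assms] unfolding boundary_dist_def by blast

lemma boundary_dist_le: "x \<in> frontier D \<Longrightarrow> boundary_dist D w \<le> dist w x"
  unfolding boundary_dist_def by (rule infdist_le)

lemma boundary_dist_pos:
  assumes "open D" "w \<in> D" "frontier D \<noteq> {}"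
  shows "0 < boundary_dist D w"
proof -
  have "w \<notin> frontier D" using assms by (simp add: frontier_def interior_open)
  then show ?thesis using infdist_pos_not_in_closed[OF frontier_closed assms(3)] by (simp add: boundary_dist_def)
qed

text \<open>The arc is oriented so that \<open>w\<close> lies on its upper side.\<close>

definition frontier_chart ::
  "complex set \<Rightarrow> complex \<Rightarrow> real \<Rightarrow> (real \<Rightarrow> real) \<Rightarrow> real \<Rightarrow> complex \<Rightarrow> complex \<Rightarrow> complex \<Rightarrow> (real \<Rightarrow> complex) \<Rightarrow> real \<Rightarrow> complex \<Rightarrow> bool" where
  "frontier_chart D p h \<theta> r w p' u a t \<tau> \<longleftrightarrow> cmod u = 1 \<and> near_straight h a \<and> a 0 = 0 \<and> \<bar>t\<bar> \<le> h / 2 \<and>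
     arc_tangent \<theta> h a t \<tau> \<and> p' = p + u * a t \<and> w = p + u * (a t + \<i> * \<tau> * of_real (boundary_dist D w)) \<and>
     (\<forall>s\<in>{-h..h}. p + u * a s \<in> frontier D) \<and>
     (\<forall>x\<in>frontier D. dist x p' < r \<longrightarrow> (\<exists>s\<in>{-h..h}. x = p + u * a s))"

text \<open>h, \<theta> and r are fixed here, before w and its nearest frontier point p'. Since p'
  is nearest, w lies on the normal at p'. If it lies on the lower side, the chart is replaced by the
  reversed arc with -u and -t.\<close>

lemma dini_smooth_frontier_chart:
  assumes p: "dini_smooth_boundary_point D p" and \<delta>: "0 < \<delta>"
  obtains h \<theta> r where "0 < h" "h < \<delta>" "dini_modulus \<theta>" "0 < r" "p \<in> frontier D"
    "\<And>w p'. w \<in> ball p r \<Longrightarrow> p' \<in> frontier D \<Longrightarrow> boundary_dist D w = dist w p' \<Longrightarrow>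
       \<exists>u a t \<tau>. frontier_chart D p h \<theta> r w p' u a t \<tau>"
proof -
  obtain u a h \<theta> R where u: "cmod u = 1" and h: "0 < h" "h < \<delta>" and \<theta>: "dini_modulus \<theta>" and R: "0 < R"
    and a0: "a 0 = 0" and a: "near_straight h a" and A: "\<And>s. s \<in> {-h..h} \<Longrightarrow> p + u * a s \<in> frontier D"
    and near: "\<And>x. x \<in> frontier D \<Longrightarrow> x \<in> ball p R \<Longrightarrow> \<exists>s. \<bar>s\<bar> < h / 2 \<and> x = p + u * a s"
    and tang: "\<And>t. t \<in> {-h..h} \<Longrightarrow> \<exists>\<tau>. arc_tangent \<theta> h a t \<tau>"
    using dini_smooth_boundary_arc[OF p \<delta>] by metis
  have u0: "u \<noteq> 0" using u by auto
  have pf: "p \<in> frontier D" using A[of 0] a0 h by simp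
  have chart: "\<exists>u a t \<tau>. frontier_chart D p h \<theta> (R / 4) w p' u a t \<tau>"
    if w: "w \<in> ball p (R / 4)" and p': "p' \<in> frontier D" "boundary_dist D w = dist w p'" for w p'
  proof -
    define d where "d = boundary_dist D w"
    have "d \<le> dist w p" unfolding d_def by (rule boundary_dist_le[OF pf])
    then have d4: "d < R / 4" using w by (simp add: dist_commute)
    have pp': "dist p p' < R / 2" using dist_triangle[of p p' w] w d4 p'(2) by (simp add: d_def)
    then obtain t where t: "\<bar>t\<bar> < h / 2" "p' = p + u * a t" using near[OF p'(1)] R by auto
    have th: "t \<in> {-h..h}" using t h by auto
    obtain \<tau> where \<tau>: "arc_tangent \<theta> h a t \<tau>" using tang[OF th] by blast
    define \<omega> where "\<omega> = (w - p) / u"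
    have dist_eq: "cmod (a s - \<omega>) = dist w (p + u * a s)" for s
    proof -
      have "a s - \<omega> = (p + u * a s - w) / u" using u0 by (simp add: \<omega>_def field_simps)
      then show ?thesis using u by (simp add: norm_divide dist_norm norm_minus_commute)
    qed
    have dt: "cmod (a t - \<omega>) = d" unfolding dist_eq d_def p'(2) t(2) ..
    have "\<omega> = a t + \<i> * \<tau> * of_real (cmod (a t - \<omega>)) \<or> \<omega> = a t - \<i> * \<tau> * of_real (cmod (a t - \<omega>))"
    proof (rule arc_nearest_point_normal[OF \<tau>])
      show "\<bar>t\<bar> < h" using t h by linarith
      fix s assume s: "s \<in> {-h..h}"
      show "cmod (a t - \<omega>) \<le> cmod (a s - \<omega>)"
        unfolding dt dist_eq[of s] d_def by (rule boundary_dist_le[OF A[OF s]])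
    qed
    moreover have w\<omega>: "w = p + u * \<omega>" using u0 by (simp add: \<omega>_def)
    ultimately have side: "w = p + u * (a t + \<i> * \<tau> * of_real d) \<or> w = p + u * (a t - \<i> * \<tau> * of_real d)"
      unfolding dt by auto
    have local: "\<exists>s\<in>{-h..h}. x = p + u * a s" if x: "x \<in> frontier D" "dist x p' < R / 4" for x
    proof -
      have "dist p x < R" using dist_triangle[of p x p'] pp' x(2) R by (simp add: dist_commute)
      then obtain s where "\<bar>s\<bar> < h / 2" "x = p + u * a s" using near[OF x(1)] by auto
      then show ?thesis using h by (intro bexI[of _ s]) auto
    qed
    show ?thesis
    proof (cases "w = p + u * (a t + \<i> * \<tau> * of_real d)")
      case True
      have "\<bar>t\<bar> \<le> h / 2" using t by simp
      then have "frontier_chart D p h \<theta> (R / 4) w p' u a t \<tau>"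
        unfolding frontier_chart_def using u a a0 t(2) \<tau> True[unfolded d_def] A local by blast
      then show ?thesis by blast
    next
      case False
      then have F: "w = p + u * (a t - \<i> * \<tau> * of_real d)" using side by blast
      let ?b = "\<lambda>s. - a (- s)"
      have mem: "- s \<in> {-h..h}" if "s \<in> {-h..h}" for s using that by auto
      have eq: "p + - u * ?b s = p + u * a (- s)" for s by simp
      have w': "w = p + - u * (?b (- t) + \<i> * \<tau> * of_real d)" using F by (simp add: algebra_simps)
      have "\<exists>s\<in>{-h..h}. x = p + - u * ?b s" if x: "x \<in> frontier D" "dist x p' < R / 4" for x
      proof -
        obtain s where "s \<in> {-h..h}" "x = p + u * a s" using local[OF x] by blast
        then show ?thesis by (intro bexI[of _ "- s"]) auto
      qed
      moreover have "\<forall>s\<in>{-h..h}. p + - u * ?b s \<in> frontier D" using A[OF mem] unfolding eq by blast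
      moreover have "p' = p + - u * ?b (- t)" using t(2) by simp
      moreover have "\<bar>- t\<bar> \<le> h / 2" "?b 0 = 0" "cmod (- u) = 1" using t(1) a0 u by simp_all
      ultimately have "frontier_chart D p h \<theta> (R / 4) w p' (- u) ?b (- t) \<tau>"
        using near_straight_reverse[OF a] arc_tangent_reverse[OF \<tau>] w'
        unfolding frontier_chart_def d_def by blast
      then show ?thesis by blast
    qed
  qed
  have "0 < R / 4" using R by simp
  then show ?thesis by (rule that[OF h \<theta> _ pf chart])
qed

text \<open>The image of the disc B is connected, misses the frontier and contains w, so it lies in
  D. The image b of its centre has height y0 over p' and stays in a compact set independent of w,
  while w comes from a point of height s \<ge> d / 2, where the Harnack factor of B is s / (2
  \<rho>).\<close>

lemma harnack_near_boundary:
  assumes D: "open D" and p: "dini_smooth_boundary_point D p"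
  obtains r c K where "0 < r" "0 < c" "compact K" "K \<subseteq> D"
    "\<And>w. w \<in> D \<inter> ball p r \<Longrightarrow> \<exists>b\<in>K. harnack_comparable D (c * boundary_dist D w) b w"
proof -
  obtain h \<theta> r0 where h: "0 < h" and \<theta>: "dini_modulus \<theta>" and r0: "0 < r0" and pf: "p \<in> frontier D"
    and chart: "\<And>w p'. w \<in> ball p r0 \<Longrightarrow> p' \<in> frontier D \<Longrightarrow> boundary_dist D w = dist w p' \<Longrightarrow>
       \<exists>u a t \<tau>. frontier_chart D p h \<theta> r0 w p' u a t \<tau>"
    by (rule dini_smooth_frontier_chart[OF p zero_less_one]) blast
  obtain \<delta> where \<delta>: "0 < \<delta>" "\<And>x. 0 \<le> x \<Longrightarrow> x \<le> \<delta> \<Longrightarrow> \<theta> x < 1 / 2"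
    using dini_modulus_small[OF \<theta>, of "1/2"] by auto
  define R where "R = min r0 \<delta>"
  have R: "0 < R" "R \<le> r0" "R \<le> \<delta>" using r0 \<delta> by (auto simp: R_def)
  obtain \<rho> \<Phi> where \<rho>: "0 < \<rho>" and hol: "\<Phi> holomorphic_on {z. 0 < Im z \<and> cmod z < 2 * \<rho>}"
    and \<Phi>: "\<And>z. 0 < Im z \<Longrightarrow> cmod z < 2 * \<rho> \<Longrightarrow> cmod (\<Phi> z) < R \<and> \<theta> (cmod (\<Phi> z)) * cmod (\<Phi> z) < Im (\<Phi> z)"
    and axis: "\<And>t. 0 < t \<Longrightarrow> t < 2 * \<rho> \<Longrightarrow> \<exists>y. \<Phi> (\<i> * of_real t) = \<i> * of_real y \<and> t \<le> y \<and> y \<le> 2 * t"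
    and hit: "\<And>d. 0 < d \<Longrightarrow> d \<le> \<rho> \<Longrightarrow> \<exists>t. d / 2 \<le> t \<and> t \<le> d \<and> \<Phi> (\<i> * of_real t) = \<i> * of_real d"
    by (rule interior_model_map[OF \<theta> R(1)]) blast
  define c0 where "c0 = \<i> * complex_of_real \<rho>"
  define B where "B = ball c0 \<rho>"
  have B: "0 < Im z \<and> cmod z < 2 * \<rho>" if "z \<in> B" for z
  proof -
    have n: "cmod (c0 - z) < \<rho>" using that by (simp add: B_def dist_norm)
    then have "\<bar>Im (c0 - z)\<bar> < \<rho>" using abs_Im_le_cmod order.strict_trans1 by blast
    moreover have "cmod c0 = \<rho>" using \<rho> by (simp add: c0_def norm_mult)
    then have "cmod z < 2 * \<rho>" using n norm_triangle_ineq4[of c0 "c0 - z"] by simp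
    ultimately show ?thesis by (simp add: c0_def abs_less_iff)
  qed
  obtain y0 where y0: "\<Phi> c0 = \<i> * of_real y0" "\<rho> \<le> y0" using axis[of \<rho>] \<rho> unfolding c0_def by auto
  have c0B: "c0 \<in> B" using \<rho> by (simp add: B_def)
  have y0R: "0 < y0" "y0 < R" using \<Phi>[of c0] B[OF c0B] y0 \<rho> by (auto simp: norm_mult)
  \<comment> \<open>Frontier points within R of p' lie in a cone with \<theta> < 1/2, whose distance
    from i y0 is at least y0 / 2; all other frontier points are at least R - y0 away from b.\<close>
  define \<delta>0 where "\<delta>0 = min (y0 / 2) (R - y0)"
  have \<delta>0: "0 < \<delta>0" using y0R by (simp add: \<delta>0_def)
  \<comment> \<open>The radius 3 r0 comes from the path p, w, p', b, each step of which is shorter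
    than r0.\<close>
  define K where "K = closure D \<inter> {z. \<delta>0 \<le> infdist z (frontier D)} \<inter> cball p (3 * r0)"
  have "compact K" unfolding K_def
    by (intro closed_Int_compact closed_Int closed_closure compact_cball closed_Collect_le continuous_intros)
  moreover have "K \<subseteq> D"
  proof
    fix z assume z: "z \<in> K"
    have "z \<notin> frontier D"
    proof
      assume "z \<in> frontier D"
      then have "infdist z (frontier D) = 0" by simp
      then show False using z \<delta>0 by (simp add: K_def)
    qed
    then show "z \<in> D" using z interior_subset unfolding K_def frontier_def by blast
  qed
  moreover have "\<exists>b\<in>K. harnack_comparable D (1 / (4 * \<rho>) * boundary_dist D w) b w"
    if w: "w \<in> D \<inter> ball p (min r0 \<rho>)" for w
  proof -
    have wD: "w \<in> D" and wr: "w \<in> ball p r0" "dist p w < \<rho>" using w by auto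
    have fne: "frontier D \<noteq> {}" using pf by blast
    obtain p' where p': "p' \<in> frontier D" "boundary_dist D w = dist w p'"
      by (rule boundary_dist_attained[OF fne])
    define d where "d = boundary_dist D w"
    have d: "0 < d" "d < \<rho>" "d < r0"
      using boundary_dist_pos[OF D wD fne] boundary_dist_le[OF pf, of w] wr by (auto simp: d_def dist_commute)
    obtain u a t \<tau> where "frontier_chart D p h \<theta> r0 w p' u a t \<tau>" using chart[OF wr(1) p'] by blast
    then have u: "cmod u = 1" and \<tau>: "arc_tangent \<theta> h a t \<tau>" and p't: "p' = p + u * a t"
      and wt: "w = p + u * (a t + \<i> * \<tau> * of_real d)"
      and local: "\<And>x. x\<in>frontier D \<Longrightarrow> dist x p' < r0 \<Longrightarrow> \<exists>s\<in>{-h..h}. x = p + u * a s"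
      unfolding frontier_chart_def d_def by blast+
    have \<tau>1: "cmod \<tau> = 1" using \<tau> by (simp add: arc_tangent_def)
    have n0: "u \<noteq> 0" "\<tau> \<noteq> 0" using u \<tau>1 by auto
    have cone: "\<bar>Im \<zeta>\<bar> \<le> \<theta> (cmod \<zeta>) * cmod \<zeta>" if \<zeta>f: "p' + u * \<tau> * \<zeta> \<in> frontier D" "cmod \<zeta> < r0" for \<zeta>
    proof -
      have "dist (p' + u * \<tau> * \<zeta>) p' < r0" using \<zeta>f u \<tau>1 by (simp add: dist_norm norm_mult)
      then obtain s where s: "s \<in> {-h..h}" "p' + u * \<tau> * \<zeta> = p + u * a s" using local[OF \<zeta>f(1)] by blast
      then have "u * (\<tau> * \<zeta>) = u * (a s - a t)" by (simp add: p't algebra_simps)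
      then have e: "\<tau> * \<zeta> = a s - a t" using n0 by simp
      then have \<zeta>: "\<zeta> = (a s - a t) / \<tau>" using n0 by (simp add: field_simps)
      have "cmod \<zeta> = cmod (a s - a t)" using \<tau>1 by (simp add: \<zeta> norm_divide)
      then show ?thesis using \<tau> s(1) unfolding arc_tangent_def \<zeta> by auto
    qed
    define F where "F z = p' + u * \<tau> * \<Phi> z" for z
    have holB: "\<Phi> holomorphic_on B" using hol by (rule holomorphic_on_subset) (use B in blast)
    have holF: "F holomorphic_on B" unfolding F_def by (intro holomorphic_intros holB)
    have Ffr: "F z \<notin> frontier D" if z: "z \<in> B" for z
    proof
      assume "F z \<in> frontier D"
      moreover have b: "cmod (\<Phi> z) < R" "\<theta> (cmod (\<Phi> z)) * cmod (\<Phi> z) < Im (\<Phi> z)" using \<Phi> B[OF z] by auto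
      ultimately have "\<bar>Im (\<Phi> z)\<bar> \<le> \<theta> (cmod (\<Phi> z)) * cmod (\<Phi> z)" using R by (intro cone) (auto simp: F_def)
      then show False using b by simp
    qed
    obtain s where s: "d / 2 \<le> s" "s \<le> d" "\<Phi> (\<i> * of_real s) = \<i> * of_real d" using hit[of d] d by auto
    define z0 where "z0 = \<i> * complex_of_real s"
    have z0c: "cmod (z0 - c0) = \<rho> - s"
    proof -
      have "z0 - c0 = \<i> * of_real (s - \<rho>)" by (simp add: z0_def c0_def algebra_simps)
      then show ?thesis using s d by (simp add: norm_mult del: of_real_diff)
    qed
    have z0B: "z0 \<in> B" using z0c s d by (simp add: B_def dist_norm norm_minus_commute)
    have Fw: "F z0 = w" using s by (simp add: F_def z0_def wt p't algebra_simps)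
    have "connected (F ` B)" unfolding B_def
      by (intro connected_continuous_image holomorphic_on_imp_continuous_on holF[unfolded B_def]) simp
    then have FD: "F ` B \<subseteq> D"
      using connected_Int_frontier[of "F ` B" D] Ffr z0B Fw wD by blast
    define b where "b = F c0"
    have bD: "b \<in> D" using FD c0B by (auto simp: b_def)
    have bp': "b = p' + u * \<tau> * (\<i> * of_real y0)" by (simp add: b_def F_def y0)
    have db: "dist b p' = y0" using u \<tau>1 y0R by (simp add: bp' dist_norm norm_mult)
    have "\<delta>0 \<le> dist b x" if x: "x \<in> frontier D" for x
    proof (cases "dist x p' < R")
      case False
      then show ?thesis using dist_triangle[of x p' b] db by (simp add: \<delta>0_def dist_commute)
    next
      case True
      define \<zeta> where "\<zeta> = (x - p') / (u * \<tau>)"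
      have xe: "x = p' + u * \<tau> * \<zeta>" using n0 by (simp add: \<zeta>_def)
      have "cmod \<zeta> = dist x p'" using u \<tau>1 by (simp add: \<zeta>_def norm_divide norm_mult dist_norm)
      then have \<zeta>R: "cmod \<zeta> < R" using True by simp
      have "\<bar>Im \<zeta>\<bar> \<le> \<theta> (cmod \<zeta>) * cmod \<zeta>" using x \<zeta>R R by (intro cone) (auto simp: xe)
      also have "\<dots> \<le> 1 / 2 * cmod \<zeta>" using \<delta>(2)[of "cmod \<zeta>"] \<zeta>R R by (intro mult_right_mono) auto
      finally have Im: "Im \<zeta> \<le> cmod \<zeta> / 2" by simp
      have "y0 * (2 * Im \<zeta>) \<le> y0 * cmod \<zeta>" using Im y0R by (intro mult_left_mono) auto
      moreover have "0 \<le> (cmod \<zeta> - y0 / 2)\<^sup>2" by simp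
      then have "y0 * cmod \<zeta> \<le> (cmod \<zeta>)\<^sup>2 + y0\<^sup>2 / 4" by (simp add: power2_eq_square algebra_simps)
      moreover have "(y0 / 2)\<^sup>2 = y0\<^sup>2 / 4" "0 \<le> y0\<^sup>2" by (simp_all add: power_divide)
      ultimately have "(y0 / 2)\<^sup>2 \<le> (cmod \<zeta>)\<^sup>2 - y0 * (2 * Im \<zeta>) + y0\<^sup>2" by linarith
      also have "\<dots> = (cmod (\<zeta> - \<i> * of_real y0))\<^sup>2"
        unfolding cmod_power2 by (simp add: algebra_simps power2_eq_square)
      finally have "y0 / 2 \<le> cmod (\<zeta> - \<i> * of_real y0)" by (rule power2_le_imp_le) simp
      moreover have "b - x = u * \<tau> * (\<i> * of_real y0 - \<zeta>)" unfolding bp' xe by (simp add: algebra_simps)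
      then have "dist b x = cmod (\<zeta> - \<i> * of_real y0)"
        using u \<tau>1 by (simp add: dist_norm norm_mult norm_minus_commute)
      ultimately show ?thesis by (simp add: \<delta>0_def)
    qed
    then have "\<delta>0 \<le> infdist b (frontier D)"
      using boundary_dist_attained[OF fne, of b] unfolding boundary_dist_def by metis
    moreover have "dist p b \<le> 3 * r0"
      using dist_triangle[of p b w] dist_triangle[of w b p'] wr(1) d p'(2) db y0R R
      by (simp add: d_def dist_commute)
    ultimately have bK: "b \<in> K" using bD closure_subset by (auto simp: K_def)
    have "1 / (4 * \<rho>) * d * (1 - cmod (f b)) \<le> 1 - cmod (f w) \<and>
       1 / (4 * \<rho>) * d * (1 - cmod (f w)) \<le> 1 - cmod (f b)" if f: "f \<in> unit_disc_maps D" for f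
    proof -
      have fF: "(f \<circ> F) \<in> unit_disc_maps (ball c0 \<rho>)"
        using f FD holF holomorphic_on_compose_gen[of F B f D] unfolding unit_disc_maps_def B_def by fastforce
      have e: "(1 - cmod (z0 - c0) / \<rho>) / 2 = s / (2 * \<rho>)" using \<rho> by (simp add: z0c diff_divide_distrib)
      note H = harnack_ball[OF fF z0B[unfolded B_def], unfolded e o_def Fw b_def[symmetric]]
      have "d / (4 * \<rho>) \<le> s / (2 * \<rho>)" using s \<rho> by (simp add: field_simps)
      then have m: "x * (d / (4 * \<rho>)) \<le> x * (s / (2 * \<rho>))" if "0 \<le> x" for x
        using that by (intro mult_left_mono)
      have "cmod (f b) < 1" "cmod (f w) < 1" using f bD wD by (auto intro: unit_disc_maps_norm)
      then have "(1 - cmod (f b)) * (d / (4 * \<rho>)) \<le> 1 - cmod (f w)" "(1 - cmod (f w)) * (d / (4 * \<rho>)) \<le> 1 - cmod (f b)"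
        using order.trans[OF m H(1)] order.trans[OF m H(2)] by auto
      then show ?thesis by (simp add: mult.commute)
    qed
    then show ?thesis using bK unfolding d_def harnack_comparable_def by blast
  qed
  moreover have "0 < min r0 \<rho>" "0 < 1 / (4 * \<rho>)" using r0 \<rho> by auto
  ultimately show ?thesis by (intro that[of "min r0 \<rho>" "1 / (4 * \<rho>)" K]) blast+
qed

section \<open>Pole maps on the domain\<close>

definition boundary_pole ::
  "complex set \<Rightarrow> real \<Rightarrow> real \<Rightarrow> (real \<Rightarrow> real) \<Rightarrow> complex \<Rightarrow> complex \<Rightarrow> complex \<Rightarrow> complex \<Rightarrow> (complex \<Rightarrow> complex) \<Rightarrow> bool" where
  "boundary_pole D C r \<theta> p' q' q w V \<longleftrightarrow>
     V holomorphic_on D \<and>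
     (\<forall>z\<in>D. cmod (V z) * dist z p' \<le> 1 + C * dist z p') \<and>
     (\<forall>z\<in>D. C < cmod (V z) \<longrightarrow> Im (V z) \<le> \<theta> (1 / cmod (V z)) * cmod (V z)) \<and>
     (\<forall>z\<in>ball q r. cmod (V z) \<le> C * dist z q') \<and>
     1 / boundary_dist D w \<le> cmod (V w) + C"

text \<open>\<open>arc_pole_map\<close> transported by the chart at p'. The choice h < |p - q| / 4
  keeps q off the arc, and the Moebius error enters through the new modulus 4 \<theta>(4 x) + C
  x.\<close>

lemma boundary_pole_map:
  assumes D: "open D" and p: "dini_smooth_boundary_point D p" and pq: "p \<noteq> q"
  obtains C r \<theta> where "1 \<le> C" "0 < r" "dini_modulus \<theta>"
    "\<And>w p' q'. w \<in> D \<inter> ball p r \<Longrightarrow> p' \<in> frontier D \<Longrightarrow> boundary_dist D w = dist w p' \<Longrightarrow> q' \<in> ball q r \<Longrightarrow>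
      \<exists>V. boundary_pole D C r \<theta> p' q' q w V"
proof -
  have "0 < dist p q / 4" using pq by simp
  then obtain h \<theta> r0 where h: "0 < h" "h < dist p q / 4" and \<theta>: "dini_modulus \<theta>" and r0: "0 < r0" and pf: "p \<in> frontier D"
    and chart: "\<And>w p'. w \<in> ball p r0 \<Longrightarrow> p' \<in> frontier D \<Longrightarrow> boundary_dist D w = dist w p' \<Longrightarrow>
       \<exists>u a t \<tau>. frontier_chart D p h \<theta> r0 w p' u a t \<tau>"
    by (rule dini_smooth_frontier_chart[OF p]) blast
  obtain C where C: "1 \<le> C" and pole: "\<And>a q q' t \<tau> \<theta>. near_straight h a \<Longrightarrow> a 0 = 0 \<Longrightarrow> dini_modulus \<theta> \<Longrightarrow> \<bar>t\<bar> \<le> h / 2 \<Longrightarrow> arc_tangent \<theta> h a t \<tau> \<Longrightarrow> 4 * h \<le> cmod q \<Longrightarrow> q' \<in> ball q h \<Longrightarrow>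
      \<exists>V. arc_pole h C \<theta> a t \<tau> q q' V"
    by (rule arc_pole_map[OF h(1)]) blast
  obtain \<delta> where \<delta>: "0 < \<delta>" "\<And>x. 0 \<le> x \<Longrightarrow> x \<le> \<delta> \<Longrightarrow> \<theta> x < 1 / 2"
    using dini_modulus_small[OF \<theta>, of "1/2"] by auto
  define r where "r = min (min r0 (\<delta> / 2)) (h / 64)"
  have r: "0 < r" "r \<le> r0" "r \<le> \<delta> / 2" "r \<le> h / 64" using r0 \<delta> h by (auto simp: r_def)
  have "\<exists>V. boundary_pole D C r (\<lambda>x. 4 * \<theta> (4 * x) + C * x) p' q' q w V"
    if w: "w \<in> D \<inter> ball p r" and p': "p' \<in> frontier D" "boundary_dist D w = dist w p'" and q': "q' \<in> ball q r" for w p' q'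
  proof -
    define d where "d = boundary_dist D w"
    have d: "0 < d" "d \<le> r"
      using boundary_dist_pos[OF D _ , of w] boundary_dist_le[OF pf, of w] w pf by (auto simp: d_def dist_commute)
    have "w \<in> ball p r0" using w r by auto
    then obtain u a t \<tau> where "frontier_chart D p h \<theta> r0 w p' u a t \<tau>" using chart p' by blast
    then have u: "cmod u = 1" and a: "near_straight h a" "a 0 = 0" and t: "\<bar>t\<bar> \<le> h / 2" and \<tau>: "arc_tangent \<theta> h a t \<tau>"
      and p't: "p' = p + u * a t" and wt: "w = p + u * (a t + \<i> * \<tau> * of_real d)"
      and A: "\<And>s. s\<in>{-h..h} \<Longrightarrow> p + u * a s \<in> frontier D"
      unfolding frontier_chart_def d_def by blast+
    have u0: "u \<noteq> 0" using u by auto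
    define N where "N z = (z - p) / u" for z
    have N: "p + u * N z = z" for z using u0 by (simp add: N_def)
    have Nd: "cmod (N z - N z') = dist z z'" for z z'
      using u by (simp add: N_def diff_divide_distrib[symmetric] norm_divide dist_norm)
    have Np': "N p' = a t" using u0 by (simp add: N_def p't)
    have ND: "N z \<notin> a ` {-h..h}" if "z \<in> D" for z
    proof
      assume "N z \<in> a ` {-h..h}"
      then have "z \<in> frontier D" using A N by (metis imageE)
      then show False using that D by (simp add: frontier_def interior_open)
    qed
    have q4: "4 * h \<le> cmod (N q)" using h u by (simp add: N_def norm_divide dist_norm norm_minus_commute)
    have Nq: "N z \<in> ball (N q) h" if "z \<in> ball q r" for z
      using that r h by (simp add: dist_norm[of "N q"] Nd)
    obtain V where V: "V holomorphic_on - (a ` {-h..h})"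
        "\<And>z. z \<notin> a ` {-h..h} \<Longrightarrow> cmod (V z) * cmod (z - a t) \<le> 1 + C * cmod (z - a t)"
        "\<And>z. z \<notin> a ` {-h..h} \<Longrightarrow> C < cmod (V z) \<Longrightarrow>
           Im (V z) \<le> (4 * \<theta> (4 * (1 / cmod (V z))) + C * (1 / cmod (V z))) * cmod (V z)"
        "\<And>z. z\<in>ball (N q) h \<Longrightarrow> cmod (V z) \<le> C * cmod (z - N q')"
        "\<And>d. 0 < d \<Longrightarrow> d \<le> h / 64 \<Longrightarrow> \<theta> (2 * d) < 1 / 2 \<Longrightarrow> a t + \<i> * \<tau> * of_real d \<notin> a ` {-h..h} \<Longrightarrow>
           1 / d \<le> cmod (V (a t + \<i> * \<tau> * of_real d)) + C"
      using pole[OF a \<theta> t \<tau> q4 Nq[OF q']] unfolding arc_pole_def by blast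
    have "N holomorphic_on D" unfolding N_def[abs_def] using u0 by (intro holomorphic_intros) auto
    then have "(\<lambda>z. V (N z)) holomorphic_on D"
      by (rule holomorphic_on_compose_gen[OF _ V(1), unfolded o_def]) (use ND in auto)
    moreover have "cmod (V (N z)) * dist z p' \<le> 1 + C * dist z p'" if "z \<in> D" for z
      using V(2)[OF ND[OF that]] unfolding Np'[symmetric] Nd .
    moreover have "Im (V (N z)) \<le> (4 * \<theta> (4 * (1 / cmod (V (N z)))) + C * (1 / cmod (V (N z)))) * cmod (V (N z))"
      if "z \<in> D" "C < cmod (V (N z))" for z
      by (rule V(3)[OF ND[OF that(1)] that(2)])
    moreover have "cmod (V (N z)) \<le> C * dist z q'" if "z \<in> ball q r" for z
      using V(4)[OF Nq[OF that]] unfolding Nd .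
    moreover have "1 / d \<le> cmod (V (N w)) + C"
    proof -
      have Nw: "N w = a t + \<i> * \<tau> * of_real d" using u0 by (simp add: N_def wt)
      have "N w \<notin> a ` {-h..h}" using ND w by blast
      moreover have "\<theta> (2 * d) < 1 / 2" using d r by (intro \<delta>(2)) auto
      ultimately show ?thesis using V(5)[of d] d r unfolding Nw by auto
    qed
    ultimately show ?thesis unfolding d_def boundary_pole_def by (intro exI[of _ "\<lambda>z. V (N z)"]) blast
  qed
  moreover have "dini_modulus (\<lambda>x. 4 * \<theta> (4 * x) + C * x)" using C by (intro dini_modulus_combine[OF \<theta>]) auto
  ultimately show ?thesis using C r(1) by (intro that[of C r "\<lambda>x. 4 * \<theta> (4 * x) + C * x"]) blast+
qed

section \<open>Bounds for the Caratheodory distance\<close>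

text \<open>The Cayley transform centred at H z. Its defect 1 - |f w|^2 is 4 Re (H w) Re (H z) / |H
  w + cnj (H z)|^2, and the denominator is at least (|H z| / 2)^2 if |H w| \<le> |H z| / 2.\<close>

lemma half_plane_to_disc:
  assumes H: "H holomorphic_on D" "\<And>x. x \<in> D \<Longrightarrow> 0 < Re (H x)" and z: "z \<in> D" and w: "w \<in> D"
    and le: "2 * cmod (H w) \<le> cmod (H z)"
  shows "\<exists>f\<in>unit_disc_maps D. f z = 0 \<and> 1 - cmod (f w) \<le> 16 * cmod (H w) / cmod (H z)"
proof -
  define f where "f x = (H x - H z) / (H x + cnj (H z))" for x
  have nz: "H x + cnj (H z) \<noteq> 0" if "x \<in> D" for x
    using H(2)[OF that] H(2)[OF z] by (auto simp: complex_eq_iff)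
  have id: "(cmod (H x + cnj (H z)))\<^sup>2 = (cmod (H x - H z))\<^sup>2 + 4 * Re (H x) * Re (H z)" for x
    unfolding cmod_power2 by (simp add: power2_eq_square algebra_simps)
  have "cmod (f x) < 1" if x: "x \<in> D" for x
  proof -
    have "0 < Re (H x) * Re (H z)" using H(2)[OF x] H(2)[OF z] by simp
    then have "(cmod (H x - H z))\<^sup>2 < (cmod (H x + cnj (H z)))\<^sup>2" by (simp add: id)
    then have "cmod (H x - H z) < cmod (H x + cnj (H z))" by (rule power2_less_imp_less) simp
    then show ?thesis using nz[OF x] by (simp add: f_def norm_divide)
  qed
  moreover have "f holomorphic_on D" unfolding f_def using nz by (auto intro!: holomorphic_intros H)
  ultimately have f: "f \<in> unit_disc_maps D" by (auto simp: unit_disc_maps_def)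
  define x y s where "x = cmod (H w)" and "y = cmod (H z)" and "s = cmod (H w + cnj (H z))"
  have y: "0 < y" using H(2)[OF z] by (auto simp: y_def)
  have s: "y / 2 \<le> s" "0 < s"
    using norm_triangle_ineq2[of "cnj (H z)" "- H w"] le nz[OF w] by (auto simp: x_def y_def s_def add.commute)
  have "(cmod (f w))\<^sup>2 = (cmod (H w - H z))\<^sup>2 / s\<^sup>2" by (simp add: f_def norm_divide power_divide s_def)
  also have "\<dots> = 1 - 4 * Re (H w) * Re (H z) / s\<^sup>2"
  proof -
    have "(cmod (H w - H z))\<^sup>2 = s\<^sup>2 - 4 * Re (H w) * Re (H z)" using id[of w] by (simp add: s_def)
    then show ?thesis using s(2) by (simp add: diff_divide_distrib)
  qed
  finally have eq: "1 - (cmod (f w))\<^sup>2 = 4 * Re (H w) * Re (H z) / s\<^sup>2" by simp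
  have fw: "cmod (f w) < 1" using f w by (rule unit_disc_maps_norm)
  have "cmod (f w) * cmod (f w) \<le> cmod (f w) * 1" using fw by (intro mult_left_mono) auto
  then have "1 - cmod (f w) \<le> 1 - (cmod (f w))\<^sup>2" by (simp add: power2_eq_square)
  also have "\<dots> \<le> 4 * x * y / s\<^sup>2"
    unfolding eq x_def y_def using H(2)[OF w] H(2)[OF z] complex_Re_le_cmod[of "H w"] complex_Re_le_cmod[of "H z"]
    by (intro divide_right_mono mult_mono) auto
  also have "\<dots> \<le> 4 * x * y / (y / 2)\<^sup>2"
    using s y by (intro divide_left_mono power_mono mult_pos_pos) (auto simp: x_def)
  also have "\<dots> = 16 * x / y" using y by (simp add: power2_eq_square field_simps)
  finally have "1 - cmod (f w) \<le> 16 * x / y" .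
  moreover have "f z = 0" by (simp add: f_def)
  ultimately show ?thesis using f unfolding x_def y_def by blast
qed

text \<open>H is the exponential of the map into the strip, hence takes values in the right
  half-plane. It depends on z and w through the nearest points q' and p'; r and B do not.\<close>

lemma boundary_separating_map:
  assumes D: "open D" and pq: "p \<noteq> q"
    and p: "dini_smooth_boundary_point D p" and q: "dini_smooth_boundary_point D q"
  obtains r B where "0 < r" "0 < B"
    "\<And>z w. z \<in> D \<inter> ball q r \<Longrightarrow> w \<in> D \<inter> ball p r \<Longrightarrow>
      \<exists>H. H holomorphic_on D \<and> (\<forall>x\<in>D. 0 < Re (H x)) \<and>
        cmod (H w) \<le> B * boundary_dist D w \<and> 1 / cmod (H z) \<le> B * boundary_dist D z"
proof -
  obtain C1 r1 \<theta>1 where C1: "1 \<le> C1" "0 < r1" "dini_modulus \<theta>1"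
    and pole1: "\<And>w p' q'. w \<in> D \<inter> ball p r1 \<Longrightarrow> p' \<in> frontier D \<Longrightarrow> boundary_dist D w = dist w p' \<Longrightarrow> q' \<in> ball q r1 \<Longrightarrow>
      \<exists>V. boundary_pole D C1 r1 \<theta>1 p' q' q w V"
    by (rule boundary_pole_map[OF D p pq]) blast
  obtain C2 r2 \<theta>2 where C2: "1 \<le> C2" "0 < r2" "dini_modulus \<theta>2"
    and pole2: "\<And>w p' q'. w \<in> D \<inter> ball q r2 \<Longrightarrow> p' \<in> frontier D \<Longrightarrow> boundary_dist D w = dist w p' \<Longrightarrow> q' \<in> ball p r2 \<Longrightarrow>
      \<exists>V. boundary_pole D C2 r2 \<theta>2 p' q' p w V"
    by (rule boundary_pole_map[OF D q pq[symmetric]]) blast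
  have pf: "p \<in> frontier D" by (rule dini_smooth_frontier_chart[OF p zero_less_one])
  have qf: "q \<in> frontier D" by (rule dini_smooth_frontier_chart[OF q zero_less_one])
  have fne: "frontier D \<noteq> {}" using pf by blast
  define C where "C = max C1 C2"
  define R where "R = min r1 r2"
  have C: "1 \<le> C" "C1 \<le> C" "C2 \<le> C" and R: "0 < R" "R \<le> r1" "R \<le> r2" using C1 C2 by (auto simp: C_def R_def)
  obtain \<delta>1 where \<delta>1: "0 < \<delta>1" "\<And>x. 0 \<le> x \<Longrightarrow> x \<le> \<delta>1 \<Longrightarrow> \<theta>1 x < 1 / 4"
    using dini_modulus_small[OF C1(3), of "1/4"] by auto
  obtain \<delta>2 where \<delta>2: "0 < \<delta>2" "\<And>x. 0 \<le> x \<Longrightarrow> x \<le> \<delta>2 \<Longrightarrow> \<theta>2 x < 1 / 4"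
    using dini_modulus_small[OF C2(3), of "1/4"] by auto
  \<comment> \<open>1 / \<delta>1 and 1 / \<delta>2 make the moduli less than 1/4 in the cones; C +
    4 / R confines the points with |V| > \<Lambda> to distance R / 4 from the pole of V, and there
    the other pole map is at most C R \<le> \<Lambda>.\<close>
  define \<Lambda> where "\<Lambda> = max (max (1 / \<delta>1) (1 / \<delta>2)) (max (C + 4 / R) (C * R))"
  have \<Lambda>: "1 / \<delta>1 \<le> \<Lambda>" "1 / \<delta>2 \<le> \<Lambda>" "C + 4 / R \<le> \<Lambda>" "C * R \<le> \<Lambda>" by (auto simp: \<Lambda>_def)
  have "0 < 4 / R" using R by simp
  then have \<Lambda>1: "1 \<le> \<Lambda>" "C < \<Lambda>" using \<Lambda>(3) C by linarith+
  have inv: "1 / \<Lambda> \<le> \<delta>" if "1 / \<delta> \<le> \<Lambda>" "0 < \<delta>" for \<delta>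
    using that \<Lambda>1 by (simp add: field_simps)
  \<comment> \<open>M bounds the product |V'| |V| near the pole of V: at distance \<rho> \<le> R
    from it, |V'| \<le> C \<rho> and |V| \<rho> \<le> 1 + C \<rho>.\<close>
  define M where "M = C * (1 + C * R)"
  have M: "0 < M" using C R by (simp add: M_def add_pos_pos)
  \<comment> \<open>The first bound makes the other strip map at most 1 / (8 |V|), half of the
    margin; the second one keeps both strip maps small where neither pole map exceeds
    \<Lambda>.\<close>
  define \<epsilon> where "\<epsilon> = min (1 / (8 * M)) (1 / (4 * \<Lambda>))"
  have \<epsilon>: "0 < \<epsilon>" "\<epsilon> * M \<le> 1 / 8" "\<epsilon> * \<Lambda> \<le> 1 / 4"
  proof -
    show "0 < \<epsilon>" using M \<Lambda>1 by (simp add: \<epsilon>_def)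
    have "\<epsilon> * M \<le> 1 / (8 * M) * M" using M by (intro mult_right_mono) (auto simp: \<epsilon>_def)
    then show "\<epsilon> * M \<le> 1 / 8" using M by simp
    have "\<epsilon> * \<Lambda> \<le> 1 / (4 * \<Lambda>) * \<Lambda>" using \<Lambda>1 by (intro mult_right_mono) (auto simp: \<epsilon>_def)
    then show "\<epsilon> * \<Lambda> \<le> 1 / 4" using \<Lambda>1 by simp
  qed
  obtain E1 G1 W1 where E1: "strip_model \<Lambda> \<epsilon> \<theta>1 E1 G1 W1"
    by (rule strip_model_map[OF C1(3) \<Lambda>1(1) _ \<epsilon>(1)], rule \<delta>1(2)) (use inv[OF \<Lambda>(1) \<delta>1(1)] in auto)
  obtain E2 G2 W2 where E2: "strip_model \<Lambda> \<epsilon> \<theta>2 E2 G2 W2"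
    by (rule strip_model_map[OF C2(3) \<Lambda>1(1) _ \<epsilon>(1)], rule \<delta>2(2)) (use inv[OF \<Lambda>(2) \<delta>2(1)] in auto)
  define G where "G = max G1 G2"
  define B where "B = 2 * exp (G + 1)"
  define r where "r = min (R / 4) (1 / (4 * \<Lambda>))"
  have r: "0 < r" "r \<le> R / 4" "r \<le> 1 / (4 * \<Lambda>)" using R \<Lambda>1 by (auto simp: r_def)
  text \<open>Along either of the two poles the strip map of that pole has a margin proportional to the
    distance, which absorbs the contribution of the other pole map, as that one vanishes there.\<close>
  have near: "\<bar>Im (E (V x)) - Im (E' (V' x))\<bar> < pi / 2 \<and> cmod (V' x) \<le> \<Lambda>"
    if V: "boundary_pole D C0 r0 \<theta> p' q' q0 w V" and V': "boundary_pole D C0' r0' \<theta>' q' p' p0 z V'"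
      and E: "strip_model \<Lambda> \<epsilon> \<theta> E F W" and E': "strip_model \<Lambda> \<epsilon> \<theta>' E' F' W'"
      and c: "C0 \<le> C" "C0' \<le> C" "R \<le> r0'" and p0: "dist p0 p' < R / 2"
      and x: "x \<in> D" and big: "\<Lambda> < cmod (V x)"
    for C0 r0 \<theta> p' q' q0 w V C0' r0' \<theta>' p0 z V' E F W E' F' W' x
  proof -
    define v \<rho> where "v = cmod (V x)" and "\<rho> = dist x p'"
    have v: "C + 4 / R < v" "0 < v" using big \<Lambda> \<Lambda>1 by (auto simp: v_def)
    have "v * \<rho> \<le> 1 + C0 * \<rho>" using V x unfolding boundary_pole_def v_def \<rho>_def by blast
    also have "\<dots> \<le> 1 + C * \<rho>" using c(1) by (simp add: \<rho>_def mult_right_mono)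
    finally have v\<rho>: "v * \<rho> \<le> 1 + C * \<rho>" .
    have "4 / R * \<rho> \<le> (v - C) * \<rho>" using v by (intro mult_right_mono) (auto simp: \<rho>_def)
    also have "\<dots> \<le> 1" using v\<rho> by (simp add: left_diff_distrib)
    finally have \<rho>: "\<rho> \<le> R / 4" using R by (simp add: field_simps)
    have "dist p0 x < r0'" using dist_triangle[of p0 x p'] p0 \<rho> c(3) R by (simp add: \<rho>_def dist_commute)
    then have "cmod (V' x) \<le> C0' * \<rho>" using V' unfolding boundary_pole_def \<rho>_def by auto
    also have "\<dots> \<le> C * \<rho>" using c(2) by (simp add: \<rho>_def mult_right_mono)
    finally have V'\<rho>: "cmod (V' x) \<le> C * \<rho>" .
    also have "\<dots> \<le> C * R" using \<rho> C R by (intro mult_left_mono) auto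
    finally have V'\<Lambda>: "cmod (V' x) \<le> \<Lambda>" using \<Lambda> by linarith
    have "cmod (V' x) * v \<le> C * (v * \<rho>)" using mult_right_mono[OF V'\<rho>, of v] v by (simp add: mult_ac)
    also have "\<dots> \<le> C * (1 + C * R)"
      using v\<rho> \<rho> R C by (intro mult_left_mono) (auto intro: order.trans mult_left_mono)
    finally have "cmod (V' x) \<le> M / v" using v by (simp add: M_def field_simps)
    then have "\<epsilon> * cmod (V' x) \<le> \<epsilon> * (M / v)" using \<epsilon> by (intro mult_left_mono) auto
    also have "\<dots> = \<epsilon> * M / v" by simp
    also have "\<dots> \<le> 1 / 8 / v" using \<epsilon> v by (intro divide_right_mono) auto
    finally have "\<epsilon> * cmod (V' x) \<le> 1 / (8 * v)" by simp
    moreover have "cmod (E' (V' x)) \<le> \<epsilon> * cmod (V' x)" using E' V'\<Lambda> unfolding strip_model_def by blast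
    ultimately have i': "\<bar>Im (E' (V' x))\<bar> \<le> 1 / (8 * v)" using abs_Im_le_cmod[of "E' (V' x)"] by linarith
    have "C0 < cmod (V x)" using big c \<Lambda>1 by simp
    then have "Im (V x) \<le> \<theta> (1 / cmod (V x)) * cmod (V x)" using V x unfolding boundary_pole_def by blast
    then have i: "\<bar>Im (E (V x))\<bar> \<le> pi / 2 - 1 / (4 * v)" using E big unfolding strip_model_def v_def by blast
    have "1 / (8 * v) < 1 / (4 * v)" using v by (simp add: field_simps)
    then show ?thesis using i i' V'\<Lambda> by linarith
  qed
  have "\<exists>H. H holomorphic_on D \<and> (\<forall>x\<in>D. 0 < Re (H x)) \<and>
        cmod (H w) \<le> B * boundary_dist D w \<and> 1 / cmod (H z) \<le> B * boundary_dist D z"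
    if z: "z \<in> D \<inter> ball q r" and w: "w \<in> D \<inter> ball p r" for z w
  proof -
    obtain p' where p': "p' \<in> frontier D" "boundary_dist D w = dist w p'" by (rule boundary_dist_attained[OF fne])
    obtain q' where q': "q' \<in> frontier D" "boundary_dist D z = dist z q'" by (rule boundary_dist_attained[OF fne])
    have dw: "0 < boundary_dist D w" "boundary_dist D w < r"
      using boundary_dist_pos[OF D _ fne, of w] boundary_dist_le[OF pf, of w] w by (auto simp: dist_commute)
    have dz: "0 < boundary_dist D z" "boundary_dist D z < r"
      using boundary_dist_pos[OF D _ fne, of z] boundary_dist_le[OF qf, of z] z by (auto simp: dist_commute)
    have pp': "dist p p' < R / 2" using dist_triangle[of p p' w] w dw p'(2) r by auto
    have qq': "dist q q' < R / 2" using dist_triangle[of q q' z] z dz q'(2) r by auto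
    have wr: "w \<in> D \<inter> ball p r1" and zr: "z \<in> D \<inter> ball q r2" using w z r R by auto
    have q'b: "q' \<in> ball q r1" and p'b: "p' \<in> ball p r2" using pp' qq' R by auto
    obtain V1 where V1: "boundary_pole D C1 r1 \<theta>1 p' q' q w V1" using pole1[OF wr p' q'b] by blast
    obtain V2 where V2: "boundary_pole D C2 r2 \<theta>2 q' p' p z V2" using pole2[OF zr q' p'b] by blast
    define H where "H x = exp (E1 (V1 x) - E2 (V2 x))" for x
    note near1 = near[OF V1 V2 E1 E2 C(2,3) R(3) pp']
    note near2 = near[OF V2 V1 E2 E1 C(3,2) R(2) qq']
    have comp: "(\<lambda>x. E (V x)) holomorphic_on D"
      if E: "strip_model \<Lambda> \<epsilon> \<theta> E F W" and V: "boundary_pole D C0 r0 \<theta> a b c y V" and C0: "C0 \<le> C" for E F W C0 r0 \<theta> a b c y V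
    proof (rule holomorphic_on_compose_gen[of V D E W, unfolded o_def])
      show "V ` D \<subseteq> W"
      proof
        fix u assume "u \<in> V ` D"
        then obtain x where x: "x \<in> D" "u = V x" by blast
        have "C0 < \<Lambda>" using C0 \<Lambda>1 by simp
        then show "u \<in> W" using E V x unfolding strip_model_def boundary_pole_def by (metis order.strict_trans)
      qed
    qed (use E V in \<open>auto simp: strip_model_def boundary_pole_def\<close>)
    have "H holomorphic_on D" unfolding H_def
      by (intro holomorphic_intros comp[OF E1 V1 C(2)] comp[OF E2 V2 C(3)])
    moreover have "0 < Re (H x)" if x: "x \<in> D" for x
    proof -
      have "\<bar>Im (E1 (V1 x)) - Im (E2 (V2 x))\<bar> < pi / 2"
      proof (cases "\<Lambda> < cmod (V1 x)")
        case True then show ?thesis using near1[OF x] by blast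
      next
        case F1: False
        show ?thesis
        proof (cases "\<Lambda> < cmod (V2 x)")
          case True then show ?thesis using near2[OF x] by (simp add: abs_minus_commute)
        next
          case False
          have "cmod (E1 (V1 x)) \<le> \<epsilon> * cmod (V1 x)" "cmod (E2 (V2 x)) \<le> \<epsilon> * cmod (V2 x)"
            using F1 False E1 E2 unfolding strip_model_def by auto
          moreover have "\<epsilon> * cmod (V1 x) \<le> \<epsilon> * \<Lambda>" "\<epsilon> * cmod (V2 x) \<le> \<epsilon> * \<Lambda>"
            using F1 False \<epsilon> by (auto intro!: mult_left_mono)
          ultimately show ?thesis
            using \<epsilon>(3) abs_Im_le_cmod[of "E1 (V1 x)"] abs_Im_le_cmod[of "E2 (V2 x)"] pi_gt3 by linarith
        qed
      qed
      then have "0 < cos (Im (E1 (V1 x)) - Im (E2 (V2 x)))" by (intro cos_gt_zero_pi) linarith+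
      then show ?thesis by (simp add: H_def Re_exp)
    qed
    moreover have bound: "Re (E (V y)) - Re (E' (V' y)) \<le> ln (B * boundary_dist D y)"
      if V: "boundary_pole D C0 r0 \<theta> a b c y V" and E: "strip_model \<Lambda> \<epsilon> \<theta> E F W" and E': "strip_model \<Lambda> \<epsilon> \<theta>' E' F' W'" and C0: "C0 \<le> C" and F: "F \<le> G"
        and y: "y \<in> D" and d0: "0 < boundary_dist D y" "boundary_dist D y < r" and small: "\<Lambda> < cmod (V y) \<Longrightarrow> cmod (V' y) \<le> \<Lambda>"
      for E F W E' F' W' C0 r0 \<theta> \<theta>' a b c y V V'
    proof -
      define d where "d = boundary_dist D y"
      have d: "0 < d" "d < r" using d0 by (auto simp: d_def)
      have "d < 1 / (4 * \<Lambda>)" using d r by linarith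
      then have "4 * \<Lambda> < 1 / d" using d \<Lambda>1 by (simp add: field_simps)
      moreover have "1 / d \<le> cmod (V y) + C" using V C0 unfolding boundary_pole_def d_def by auto
      ultimately have lo: "1 / (2 * d) \<le> cmod (V y)" and big: "\<Lambda> < cmod (V y)" using \<Lambda>1 by auto
      have "C0 < cmod (V y)" using big C0 \<Lambda>1 by simp
      then have "Im (V y) \<le> \<theta> (1 / cmod (V y)) * cmod (V y)" using V y unfolding boundary_pole_def by blast
      then have "Re (E (V y)) \<le> F - ln (cmod (V y))" using E big unfolding strip_model_def by blast
      moreover have "ln (1 / (2 * d)) \<le> ln (cmod (V y))" using lo d by (subst ln_le_cancel_iff) auto
      moreover have "ln (1 / (2 * d)) = - ln (2 * d)" using d by (simp add: ln_div)
      moreover have "cmod (E' (V' y)) \<le> \<epsilon> * cmod (V' y)" using E' small[OF big] unfolding strip_model_def by blast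
      moreover have "\<epsilon> * cmod (V' y) \<le> \<epsilon> * \<Lambda>" using small[OF big] \<epsilon> by (intro mult_left_mono) auto
      ultimately have "Re (E (V y)) - Re (E' (V' y)) \<le> G + 1 + ln (2 * d)"
        using F \<epsilon>(3) abs_Re_le_cmod[of "E' (V' y)"] by linarith
      also have "\<dots> = ln (B * d)" using d by (simp add: B_def ln_mult)
      finally show ?thesis unfolding d_def .
    qed
    have "Re (E1 (V1 w)) - Re (E2 (V2 w)) \<le> ln (B * boundary_dist D w)"
      using near1[of w] w dw by (intro bound[OF V1 E1 E2 C(2)]) (auto simp: G_def)
    then have "cmod (H w) \<le> exp (ln (B * boundary_dist D w))" by (simp add: H_def norm_exp_eq_Re)
    then have "cmod (H w) \<le> B * boundary_dist D w" using dw by (simp add: B_def)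
    moreover have "Re (E2 (V2 z)) - Re (E1 (V1 z)) \<le> ln (B * boundary_dist D z)"
      using near2[of z] z dz by (intro bound[OF V2 E2 E1 C(3)]) (auto simp: G_def)
    then have "1 / cmod (H z) \<le> exp (ln (B * boundary_dist D z))"
      by (simp add: H_def norm_exp_eq_Re inverse_eq_divide[symmetric] exp_minus[symmetric])
    then have "1 / cmod (H z) \<le> B * boundary_dist D z" using dz by (simp add: B_def)
    ultimately show ?thesis by blast
  qed
  moreover have "0 < B" by (simp add: B_def)
  ultimately show ?thesis using r(1) by (intro that) blast+
qed

section \<open>From bounds on disc maps to the distance\<close>

lemma two_artanh: "0 \<le> x \<Longrightarrow> x < 1 \<Longrightarrow> 2 * artanh x = ln (1 + x) - ln (1 - x)" for x :: real
  by (simp add: artanh_def ln_div)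

lemma two_artanh_bounds:
  fixes x :: real
  assumes "0 \<le> x" "x < 1"
  shows "- ln (1 - x) \<le> 2 * artanh x" "2 * artanh x \<le> ln 2 - ln (1 - x)"
  using assms by (simp_all add: two_artanh)

lemma artanh_norm_le:
  assumes f: "f \<in> unit_disc_maps D" "w \<in> D" and c: "0 < c" "c \<le> 1 - cmod (f w)"
  shows "artanh (cmod (f w)) \<le> (ln 2 - ln c) / 2"
proof -
  have n: "cmod (f w) < 1" using f by (rule unit_disc_maps_norm)
  have "ln c \<le> ln (1 - cmod (f w))" using c by (subst ln_le_cancel_iff) auto
  then show ?thesis using two_artanh_bounds(2)[OF norm_ge_zero n] by simp
qed

lemma caratheodory_dist_eq:
  "caratheodory_dist D z w = (SUP f\<in>{f \<in> unit_disc_maps D. f z = 0}. artanh (cmod (f w)))"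
  by (simp add: caratheodory_dist_def unit_disc_maps_def conj_assoc)

lemma caratheodory_dist_le:
  assumes D: "w \<in> D" and c: "0 < c" "\<And>f. f \<in> unit_disc_maps D \<Longrightarrow> f z = 0 \<Longrightarrow> c \<le> 1 - cmod (f w)"
  shows "2 * caratheodory_dist D z w \<le> ln 2 - ln c"
proof -
  have "(\<lambda>_. 0) \<in> {f \<in> unit_disc_maps D. f z = 0}" by (auto simp: unit_disc_maps_def)
  then have "{f \<in> unit_disc_maps D. f z = 0} \<noteq> {}" by blast
  then have "caratheodory_dist D z w \<le> (ln 2 - ln c) / 2"
    unfolding caratheodory_dist_eq using artanh_norm_le[OF _ D c(1)] c(2) by (intro cSUP_least) auto
  then show ?thesis by simp
qed

text \<open>A value is below the real supremum only if the set is bounded above. A Harnack chain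
  from z to w provides this, since 1 - |f z| = 1 for all competitors.\<close>

lemma caratheodory_dist_ge:
  assumes D: "open D" "connected D" "z \<in> D" "w \<in> D" and f: "f \<in> unit_disc_maps D" "f z = 0" and c: "1 - cmod (f w) \<le> c"
  shows "- ln c \<le> 2 * caratheodory_dist D z w"
proof -
  have n: "cmod (f w) < 1" using f D by (auto intro: unit_disc_maps_norm)
  obtain k where k: "k > 0" "harnack_comparable D k z w" using harnack_chain[OF D] by blast
  have "bdd_above ((\<lambda>f. artanh (cmod (f w))) ` {f \<in> unit_disc_maps D. f z = 0})"
    using artanh_norm_le[OF _ D(4) k(1)] harnack_comparableD(1)[OF k(2)]
    by (intro bdd_aboveI2[where M = "(ln 2 - ln k) / 2"]) fastforce
  then have "artanh (cmod (f w)) \<le> caratheodory_dist D z w"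
    unfolding caratheodory_dist_eq using f by (intro cSUP_upper) auto
  moreover have "ln (1 - cmod (f w)) \<le> ln c" using c n by (subst ln_le_cancel_iff) auto
  ultimately show ?thesis using two_artanh_bounds(1)[OF norm_ge_zero n] by linarith
qed

text \<open>Start from 1 - |f z| = 1. The way from z to the compact set near q costs a factor
  proportional to the boundary distance of z, the way to w from the compact set near p one
  proportional to that of w, and the way between the compact sets a constant.\<close>

lemma caratheodory_dist_upper:
  assumes D: "open D" "connected D"
    and p: "dini_smooth_boundary_point D p" and q: "dini_smooth_boundary_point D q"
  obtains r B where "0 < r"
    "\<And>z w. z \<in> D \<inter> ball q r \<Longrightarrow> w \<in> D \<inter> ball p r \<Longrightarrow>
      2 * caratheodory_dist D z w + ln (boundary_dist D z) + ln (boundary_dist D w) \<le> B"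
proof -
  obtain r1 c1 K1 where 1: "0 < r1" "0 < c1" "compact K1" "K1 \<subseteq> D"
    "\<And>w. w \<in> D \<inter> ball p r1 \<Longrightarrow> \<exists>b\<in>K1. harnack_comparable D (c1 * boundary_dist D w) b w"
    by (rule harnack_near_boundary[OF D(1) p]) blast
  obtain r2 c2 K2 where 2: "0 < r2" "0 < c2" "compact K2" "K2 \<subseteq> D"
    "\<And>w. w \<in> D \<inter> ball q r2 \<Longrightarrow> \<exists>b\<in>K2. harnack_comparable D (c2 * boundary_dist D w) b w"
    by (rule harnack_near_boundary[OF D(1) q]) blast
  obtain c where c: "0 < c" "\<And>f a b. f\<in>unit_disc_maps D \<Longrightarrow> a\<in>K2 \<Longrightarrow> b\<in>K1 \<Longrightarrow> c * (1 - cmod (f a)) \<le> 1 - cmod (f b)"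
    using harnack_compact[OF D 2(3,4) 1(3,4)] by blast
  have fne: "frontier D \<noteq> {}" by (rule dini_smooth_frontier_chart[OF p zero_less_one]) blast
  define k where "k = c1 * c * c2"
  have k: "0 < k" using 1 2 c by (simp add: k_def)
  have "2 * caratheodory_dist D z w + ln (boundary_dist D z) + ln (boundary_dist D w) \<le> ln 2 - ln k"
    if z: "z \<in> D \<inter> ball q (min r1 r2)" and w: "w \<in> D \<inter> ball p (min r1 r2)" for z w
  proof -
    define dz dw where "dz = boundary_dist D z" and "dw = boundary_dist D w"
    have d: "0 < dz" "0 < dw" using boundary_dist_pos[OF D(1) _ fne] z w by (auto simp: dz_def dw_def)
    have w1: "w \<in> D \<inter> ball p r1" and z2: "z \<in> D \<inter> ball q r2" using w z by auto
    obtain b1 where b1: "b1 \<in> K1" "harnack_comparable D (c1 * dw) b1 w"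
      using 1(5)[OF w1] unfolding dw_def by blast
    obtain b2 where b2: "b2 \<in> K2" "harnack_comparable D (c2 * dz) b2 z"
      using 2(5)[OF z2] unfolding dz_def by blast
    have "2 * caratheodory_dist D z w \<le> ln 2 - ln (k * dz * dw)"
    proof (rule caratheodory_dist_le)
      show "0 < k * dz * dw" using k d by simp
      fix f assume f: "f \<in> unit_disc_maps D" "f z = 0"
      have "c * (c2 * dz) \<le> c * (1 - cmod (f b2))" using harnack_comparableD(2)[OF b2(2) f(1)] f(2) c(1) by (intro mult_left_mono) auto
      also have "\<dots> \<le> 1 - cmod (f b1)" by (rule c(2)[OF f(1) b2(1) b1(1)])
      finally have "c1 * dw * (c * (c2 * dz)) \<le> c1 * dw * (1 - cmod (f b1))"
        using 1(2) d by (intro mult_left_mono) auto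
      also have "\<dots> \<le> 1 - cmod (f w)" by (rule harnack_comparableD(1)[OF b1(2) f(1)])
      finally show "k * dz * dw \<le> 1 - cmod (f w)" by (simp add: k_def mult_ac)
    qed (use z w in auto)
    also have "ln (k * dz * dw) = ln k + ln dz + ln dw" using k d by (simp add: ln_mult)
    finally show ?thesis by (simp add: dz_def dw_def)
  qed
  then show ?thesis using that[of "min r1 r2"] 1(1) 2(1) by auto
qed

lemma caratheodory_dist_lower:
  assumes D: "open D" "connected D" and pq: "p \<noteq> q"
    and p: "dini_smooth_boundary_point D p" and q: "dini_smooth_boundary_point D q"
  obtains r B where "0 < r"
    "\<And>z w. z \<in> D \<inter> ball q r \<Longrightarrow> w \<in> D \<inter> ball p r \<Longrightarrow>
      B \<le> 2 * caratheodory_dist D z w + ln (boundary_dist D z) + ln (boundary_dist D w)"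
proof -
  obtain r0 A where r0: "0 < r0" and A: "0 < A" and sep: "\<And>z w. z \<in> D \<inter> ball q r0 \<Longrightarrow> w \<in> D \<inter> ball p r0 \<Longrightarrow>
      \<exists>H. H holomorphic_on D \<and> (\<forall>x\<in>D. 0 < Re (H x)) \<and>
        cmod (H w) \<le> A * boundary_dist D w \<and> 1 / cmod (H z) \<le> A * boundary_dist D z"
    by (rule boundary_separating_map[OF D(1) pq p q]) blast
  have pf: "p \<in> frontier D" by (rule dini_smooth_frontier_chart[OF p zero_less_one])
  have qf: "q \<in> frontier D" by (rule dini_smooth_frontier_chart[OF q zero_less_one])
  have fne: "frontier D \<noteq> {}" using pf by blast
  \<comment> \<open>Then A times either boundary distance is at most 1/2, so |H w| \<le> 1/2 and |H
    z| \<ge> 2, as \<open>half_plane_to_disc\<close> requires.\<close>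
  define r where "r = min r0 (1 / (2 * A))"
  have r: "0 < r" "r \<le> r0" "r \<le> 1 / (2 * A)" using r0 A by (auto simp: r_def)
  have "- ln (16 * A\<^sup>2) \<le> 2 * caratheodory_dist D z w + ln (boundary_dist D z) + ln (boundary_dist D w)"
    if z: "z \<in> D \<inter> ball q r" and w: "w \<in> D \<inter> ball p r" for z w
  proof -
    define dz dw where "dz = boundary_dist D z" and "dw = boundary_dist D w"
    have zD: "z \<in> D" and wD: "w \<in> D" using z w by auto
    have d: "0 < dz" "0 < dw" using boundary_dist_pos[OF D(1) _ fne] z w by (auto simp: dz_def dw_def)
    have "dz < r" "dw < r"
      using boundary_dist_le[OF pf, of w] boundary_dist_le[OF qf, of z] z w by (auto simp: dz_def dw_def dist_commute)
    then have "dz \<le> 1 / (2 * A)" "dw \<le> 1 / (2 * A)" using r(3) by linarith+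
    then have "A * dz \<le> A * (1 / (2 * A))" "A * dw \<le> A * (1 / (2 * A))" using A by (intro mult_left_mono; simp)+
    then have Ad: "A * dz \<le> 1 / 2" "A * dw \<le> 1 / 2" using A by auto
    have "z \<in> D \<inter> ball q r0" "w \<in> D \<inter> ball p r0" using z w r by auto
    then obtain H where H: "H holomorphic_on D" "\<And>x. x\<in>D \<Longrightarrow> 0 < Re (H x)"
        "cmod (H w) \<le> A * dw" "1 / cmod (H z) \<le> A * dz"
      using sep unfolding dz_def dw_def by blast
    have Hz: "0 < cmod (H z)" using H(2)[OF zD] by auto
    have "1 / cmod (H z) \<le> 1 / 2" using H(4) Ad by linarith
    then have "2 \<le> cmod (H z)" using Hz by (simp add: field_simps)
    moreover have "2 * cmod (H w) \<le> 1" using H(3) Ad by linarith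
    ultimately have "2 * cmod (H w) \<le> cmod (H z)" by linarith
    then obtain f where f: "f\<in>unit_disc_maps D" "f z = 0" "1 - cmod (f w) \<le> 16 * cmod (H w) / cmod (H z)"
      using half_plane_to_disc[OF H(1,2) zD wD] by blast
    have "cmod (H w) * (1 / cmod (H z)) \<le> (A * dw) * (A * dz)" using H(3,4) A d by (intro mult_mono) auto
    moreover have "16 * cmod (H w) / cmod (H z) = 16 * (cmod (H w) * (1 / cmod (H z)))" by simp
    moreover have "16 * A\<^sup>2 * (dz * dw) = 16 * ((A * dw) * (A * dz))" by (simp add: power2_eq_square)
    ultimately have "16 * cmod (H w) / cmod (H z) \<le> 16 * A\<^sup>2 * (dz * dw)" by linarith
    then have "1 - cmod (f w) \<le> 16 * A\<^sup>2 * (dz * dw)" using f(3) by linarith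
    then have "- ln (16 * A\<^sup>2 * (dz * dw)) \<le> 2 * caratheodory_dist D z w"
      by (rule caratheodory_dist_ge[OF D zD wD f(1,2)])
    moreover have "ln (16 * A\<^sup>2 * (dz * dw)) = ln (16 * A\<^sup>2) + (ln dz + ln dw)"
      using A d by (subst ln_mult_pos) (auto simp: ln_mult_pos)
    ultimately show ?thesis by (simp add: dz_def dw_def)
  qed
  then show ?thesis using that r(1) by blast
qed

theorem proposition7:
  fixes D :: "complex set" and p q :: complex
  assumes "open D" and "connected D" and "D \<noteq> {}"
    and "p \<noteq> q"
    and "dini_smooth_boundary_point D p"
    and "dini_smooth_boundary_point D q"
  shows "\<exists>Vq Vp. open Vq \<and> q \<in> Vq \<and> open Vp \<and> p \<in> Vp \<and>
           bounded ((\<lambda>(z, w). 2 * caratheodory_dist D z w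
                              + ln (boundary_dist D z) + ln (boundary_dist D w))
                    ` ((D \<inter> Vq) \<times> (D \<inter> Vp)))"
proof -
  obtain r1 B1 where 1: "0 < r1" "\<And>z w. z \<in> D \<inter> ball q r1 \<Longrightarrow> w \<in> D \<inter> ball p r1 \<Longrightarrow>
      2 * caratheodory_dist D z w + ln (boundary_dist D z) + ln (boundary_dist D w) \<le> B1"
    by (rule caratheodory_dist_upper[OF assms(1,2,5,6)]) blast
  obtain r2 B2 where 2: "0 < r2" "\<And>z w. z \<in> D \<inter> ball q r2 \<Longrightarrow> w \<in> D \<inter> ball p r2 \<Longrightarrow>
      B2 \<le> 2 * caratheodory_dist D z w + ln (boundary_dist D z) + ln (boundary_dist D w)"
    by (rule caratheodory_dist_lower[OF assms(1,2,4,5,6)]) blast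
  define r where "r = min r1 r2"
  have r: "0 < r" "ball x r \<subseteq> ball x r1" "ball x r \<subseteq> ball x r2" for x :: complex
    using 1(1) 2(1) by (auto simp: r_def)
  have "(\<lambda>(z, w). 2 * caratheodory_dist D z w + ln (boundary_dist D z) + ln (boundary_dist D w))
      ` ((D \<inter> ball q r) \<times> (D \<inter> ball p r)) \<subseteq> {B2..B1}"
  proof (intro image_subsetI, clarify)
    fix z w assume "z \<in> D" "z \<in> ball q r" "w \<in> D" "w \<in> ball p r"
    then have "z \<in> D \<inter> ball q r1" "w \<in> D \<inter> ball p r1" "z \<in> D \<inter> ball q r2" "w \<in> D \<inter> ball p r2"
      using r(2,3) by blast+
    then show "2 * caratheodory_dist D z w + ln (boundary_dist D z) + ln (boundary_dist D w) \<in> {B2..B1}"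
      using 1(2) 2(2) by simp
  qed
  then have "bounded ((\<lambda>(z, w). 2 * caratheodory_dist D z w + ln (boundary_dist D z) + ln (boundary_dist D w))
      ` ((D \<inter> ball q r) \<times> (D \<inter> ball p r)))"
    by (rule bounded_subset[OF bounded_closed_interval])
  then show ?thesis using r(1) by (intro exI[of _ "ball q r"] exI[of _ "ball p r"]) auto
qed

end
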